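(* Fix a constant $c<1/\sqrt{2}$ and suppose $p\le c\,n^{-1/2}$. Then the Glauber dynamics for sampling from $\mu_{\mathcal{T},p}$ has mixing time $O(n^2\log n)$. In particular, there are randomized algorithms running in time polynomial in $n$ and $1/\varepsilon$ that (1) output a number $M$ such that, with probability at least $2/3$, $M$ is an $\varepsilon$-relative approximation to $\mu_p(\mathcal{T})$; (2) output a graph $G\in\mathcal{T}$ whose distribution $\hat\mu$ satisfies $\|\hat\mu-\mu_{\mathcal{T},p}\|_{TV}<\varepsilon$.
   Context: All graphs are on the vertex set $[n]$ and are identified with their edge sets. Let $\mathcal{T}=\mathcal{T}(n)$ be the set of triangle-free graphs on $[n]$. Let $\mu_p$ be the law of the Erdős–Rényi random graph $G(n,p)$, i.e. $\mu_p(G)=p^{|G|}(1-p)^{\binom n2-|G|}$, so $\mu_p(\mathcal{T})$ is the probability that $G(n,p)$ is triangle-free. Let $\mu_{\mathcal{T},p}=\mu_p(\cdot\mid\mathcal{T})$ be $G(n,p)$ conditioned on being triangle-free. The Glauber dynamics for $\mu_{\mathcal{T},p}$ is the Markov chain on $\mathcal{T}$ which at each step chooses a pair $e\in\binom{[n]}{2}$ uniformly at random and resamples its status from its conditional law given all other pairs: $e$ is included with probability $p$ if adding $e$ creates no triangle, and with probability $0$ otherwise; otherwise $e$ is removed. The mixing time is $\max_{X_0}\min\{t:\|\mu_t^{X_0}-\mu\|_{TV}<1/4\}$, where $\mu_t^{X_0}$ is the law of the chain after $t$ steps from $X_0$ and $\mu$ is the stationary distribution. A number $\hat Z>0$ is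 an $\varepsilon$-relative approximation to $Z>0$ if $e^{-\varepsilon}\hat Z\le Z\le e^{\varepsilon}\hat Z$. *)

theory Defs
  imports "HOL-Probability.Probability"
begin

section \<open>Triangle-free graphs and the Glauber dynamics\<close>

type_synonym graph = "nat set set"

definition pairs :: "nat \<Rightarrow> nat set set" where
  "pairs n = {e. e \<subseteq> {1..n} \<and> card e = 2}"

definition triangle_free :: "graph \<Rightarrow> bool" where
  "triangle_free G \<longleftrightarrow>
     \<not> (\<exists>x y z. x \<noteq> y \<and> y \<noteq> z \<and> x \<noteq> z \<and> {x, y} \<in> G \<and> {y, z} \<in> G \<and> {x, z} \<in> G)"

definition TF :: "nat \<Rightarrow> graph set" where
  "TF n = {G. G \<subseteq> pairs n \<and> triangle_free G}"

text \<open>The law of \<open>G(n,p)\<close>: every pair is present independently with probability \<open>p\<close>.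
  Lemma \<open>pmf_gnp\<close> below gives the usual formula.\<close>

definition gnp :: "nat \<Rightarrow> real \<Rightarrow> graph pmf" where
  "gnp n p = map_pmf (\<lambda>f. {e \<in> pairs n. f e}) (Pi_pmf (pairs n) False (\<lambda>_. bernoulli_pmf p))"

text \<open>The conditioning event has positive probability whenever \<open>p < 1\<close>
  (it contains the empty graph).\<close>

definition gnp_TF :: "nat \<Rightarrow> real \<Rightarrow> graph pmf" where
  "gnp_TF n p = cond_pmf (gnp n p) (TF n)"

text \<open>For \<open>n \<ge> 2\<close> the set of pairs is nonempty and the uniform choice is meaningful.\<close>

definition glauber_step :: "nat \<Rightarrow> real \<Rightarrow> graph \<Rightarrow> graph pmf" where
  "glauber_step n p G = do {
     e \<leftarrow> pmf_of_set (pairs n);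
     b \<leftarrow> bernoulli_pmf p;
     return_pmf (if b \<and> triangle_free (insert e G) then insert e G else G - {e})
   }"

primrec glauber_law :: "nat \<Rightarrow> real \<Rightarrow> graph \<Rightarrow> nat \<Rightarrow> graph pmf" where
  "glauber_law n p X0 0 = return_pmf X0"
| "glauber_law n p X0 (Suc t) = bind_pmf (glauber_law n p X0 t) (glauber_step n p)"

definition tv_dist :: "'a pmf \<Rightarrow> 'a pmf \<Rightarrow> real" where
  "tv_dist P Q = (SUP A. \<bar>measure_pmf.prob P A - measure_pmf.prob Q A\<bar>)"

text \<open>Valued in the extended naturals, so that the minimum over an empty set of times
  (a chain which does not mix) is \<open>\<infinity>\<close>.\<close>

definition mixing_time :: "nat \<Rightarrow> real \<Rightarrow> enat" where
  "mixing_time n p =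
     (SUP X0\<in>TF n. Inf {enat t | t. tv_dist (glauber_law n p X0 t) (gnp_TF n p) < 1/4})"

definition rel_approx :: "real \<Rightarrow> real \<Rightarrow> real \<Rightarrow> bool" where
  "rel_approx \<epsilon> M Z \<longleftrightarrow> M > 0 \<and> exp (- \<epsilon>) * M \<le> Z \<and> Z \<le> exp \<epsilon> * M"

lemma finite_pairs: "finite (pairs n)"
  by (rule finite_subset[of _ "Pow {1..n}"]) (auto simp: pairs_def)

lemma card_pairs: "card (pairs n) = n choose 2"
  using n_subsets[of "{1..n}" 2] by (simp add: pairs_def)

lemma pmf_gnp:
  assumes "0 \<le> p" "p \<le> 1" "G \<subseteq> pairs n"
  shows "pmf (gnp n p) G = p ^ card G * (1 - p) ^ ((n choose 2) - card G)"
proof -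
  let ?P = "Pi_pmf (pairs n) False (\<lambda>_. bernoulli_pmf p)"
  have fin: "finite G" using assms(3) finite_pairs finite_subset by blast
  have "pmf (gnp n p) G = measure_pmf.prob ?P ((\<lambda>f. {e \<in> pairs n. f e}) -` {G})"
    by (simp add: gnp_def pmf_map)
  also have "\<dots> = measure_pmf.prob ?P {\<lambda>e. e \<in> G}"
  proof (rule measure_prob_cong_0)
    fix f assume f: "f \<in> (\<lambda>f. {e \<in> pairs n. f e}) -` {G} - {\<lambda>e. e \<in> G}"
    then have "\<exists>e. e \<notin> pairs n \<and> f e" using assms(3) by fastforce
    then show "pmf ?P f = 0"
      using finite_pairs by (auto intro: pmf_Pi_outside)
  qed (use assms(3) in auto)
  also have "\<dots> = (\<Prod>e\<in>pairs n. pmf (bernoulli_pmf p) (e \<in> G))"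
    using assms(3) finite_pairs by (subst measure_pmf_single, subst pmf_Pi') auto
  also have "\<dots> = (\<Prod>e\<in>G. pmf (bernoulli_pmf p) (e \<in> G)) *
                  (\<Prod>e\<in>pairs n - G. pmf (bernoulli_pmf p) (e \<in> G))"
    by (subst prod.subset_diff[OF assms(3) finite_pairs]) (rule mult.commute)
  also have "\<dots> = p ^ card G * (1 - p) ^ card (pairs n - G)"
    using assms by simp
  finally show ?thesis
    using fin assms(3) by (simp add: card_Diff_subset card_pairs)
qed

section \<open>Randomized algorithms\<close>

text \<open>
  The machine is a randomized real RAM, programmed in a while language. A state consists of named
  infinite arrays of natural numbers and of real numbers; a scalar variable is cell 0 of an array.
  Each of the following costs one unit of time: an assignment, a test, and the toss of a coin
  (the expressions occurring in a fixed program have bounded size).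

  \<^item> Programs are finite syntactic objects whose only constants are natural numbers, so no
    non-uniform advice can be hidden in a real constant.
  \<^item> Natural number expressions have no multiplication: in time \<open>t\<close> only numbers with
    \<open>O(t + log n)\<close> bits can arise, and the unit cost is polynomially equivalent to counting bit operations.
  \<^item> Reals support the field operations and comparison at unit cost (needed since \<open>p\<close> and
    \<open>\<epsilon>\<close> are arbitrary reals). There is no rounding to integers.
\<close>

type_synonym vname = string

datatype nexp = NConst nat | NVar vname nexp | NAdd nexp nexp | NSub nexp nexp

datatype rexp = RNat nexp | RVar vname nexp | RAdd rexp rexp | RSub rexp rexp
  | RMul rexp rexp | RDiv rexp rexp

datatype bexp = NLess nexp nexp | RLess rexp rexp | BNot bexp | BAnd bexp bexp

datatype com = Skip
  | AssignN vname nexp nexp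
  | AssignR vname nexp rexp
  | Toss vname nexp rexp
  | Seq com com
  | Cond bexp com com
  | While bexp com

type_synonym mem = "(vname \<Rightarrow> nat \<Rightarrow> nat) \<times> (vname \<Rightarrow> nat \<Rightarrow> real)"

primrec nval :: "nexp \<Rightarrow> mem \<Rightarrow> nat" where
  "nval (NConst k) s = k"
| "nval (NVar x i) s = fst s x (nval i s)"
| "nval (NAdd a b) s = nval a s + nval b s"
| "nval (NSub a b) s = nval a s - nval b s"

primrec rval :: "rexp \<Rightarrow> mem \<Rightarrow> real" where
  "rval (RNat a) s = real (nval a s)"
| "rval (RVar x i) s = snd s x (nval i s)"
| "rval (RAdd a b) s = rval a s + rval b s"
| "rval (RSub a b) s = rval a s - rval b s"
| "rval (RMul a b) s = rval a s * rval b s"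
| "rval (RDiv a b) s = rval a s / rval b s"

primrec bval :: "bexp \<Rightarrow> mem \<Rightarrow> bool" where
  "bval (NLess a b) s = (nval a s < nval b s)"
| "bval (RLess a b) s = (rval a s < rval b s)"
| "bval (BNot b) s = (\<not> bval b s)"
| "bval (BAnd b c) s = (bval b s \<and> bval c s)"

definition set_nat :: "vname \<Rightarrow> nat \<Rightarrow> nat \<Rightarrow> mem \<Rightarrow> mem" where
  "set_nat x i v s = ((fst s)(x := (fst s x)(i := v)), snd s)"

definition set_real :: "vname \<Rightarrow> nat \<Rightarrow> real \<Rightarrow> mem \<Rightarrow> mem" where
  "set_real x i v s = (fst s, (snd s)(x := (snd s x)(i := v)))"

text \<open>
  A configuration is a stack of commands still to be executed together with the memory; the machine
  has halted when the stack is empty, and then it stays where it is. \<open>Toss x i r\<close> sets the cell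
  \<open>x[i]\<close> to 1 with probability \<open>r\<close> and to 0 otherwise, independently of the past
  (\<open>bernoulli_pmf\<close> truncates \<open>r\<close> to the interval \<open>[0,1]\<close>).
\<close>

type_synonym config = "com list \<times> mem"

fun mstep :: "config \<Rightarrow> config pmf" where
  "mstep ([], s) = return_pmf ([], s)"
| "mstep (Skip # k, s) = return_pmf (k, s)"
| "mstep (AssignN x i a # k, s) = return_pmf (k, set_nat x (nval i s) (nval a s) s)"
| "mstep (AssignR x i r # k, s) = return_pmf (k, set_real x (nval i s) (rval r s) s)"
| "mstep (Toss x i r # k, s) =
     map_pmf (\<lambda>b. (k, set_nat x (nval i s) (of_bool b) s)) (bernoulli_pmf (rval r s))"
| "mstep (Seq c d # k, s) = return_pmf (c # d # k, s)"
| "mstep (Cond b c d # k, s) = return_pmf ((if bval b s then c else d) # k, s)"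
| "mstep (While b c # k, s) = return_pmf (if bval b s then c # While b c # k else k, s)"

primrec mrun :: "nat \<Rightarrow> config \<Rightarrow> config pmf" where
  "mrun 0 cf = return_pmf cf"
| "mrun (Suc t) cf = bind_pmf (mstep cf) (mrun t)"

text \<open>Started in memory \<open>s\<close>, the program halts surely within time \<open>b\<close>, and the
  law of its final memory is \<open>D\<close>.\<close>

definition halts_with_law :: "com \<Rightarrow> mem \<Rightarrow> real \<Rightarrow> mem pmf \<Rightarrow> bool" where
  "halts_with_law P s b D \<longleftrightarrow>
     (\<exists>t. real t \<le> b \<and> mrun t ([P], s) = map_pmf (\<lambda>s'. ([], s')) D)"

definition input_mem :: "nat \<Rightarrow> real \<Rightarrow> real \<Rightarrow> mem" where
  "input_mem n p \<epsilon> =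
     set_nat ''n'' 0 n (set_real ''p'' 0 p (set_real ''eps'' 0 \<epsilon> (\<lambda>_ _. 0, \<lambda>_ _. 0)))"

definition output_number :: "mem \<Rightarrow> real" where
  "output_number s = snd s ''M'' 0"

text \<open>A graph on \<open>{1..n}\<close> is output as its adjacency matrix (the part above the diagonal),
  the entry \<open>(i,j)\<close> being stored in the cell \<open>n * i + j\<close>.\<close>

definition output_graph :: "nat \<Rightarrow> mem \<Rightarrow> graph" where
  "output_graph n s = {{i, j} | i j. 1 \<le> i \<and> i < j \<and> j \<le> n \<and> fst s ''adj'' (n * i + j) \<noteq> 0}"

end

theory Submission
  imports Defs "HOL-Real_Asymp.Real_Asymp"
begin

text \<open>
  Mixing. Two copies \<open>X\<close>, \<open>Y\<close> of the dynamics are run with the same randomness. Updating a pair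
  makes \<open>X\<close> and \<open>Y\<close> agree on it, unless it closes a triangle with only one of them; such a pair is the
  third side of a path formed by an edge of the symmetric difference and an adjacent edge, so there are at
  most \<open>2 D |X \<Delta> Y|\<close> of them when the degrees are at most \<open>D\<close>. The expected distance contracts as soon as
  \<open>2 p D < 1\<close>. Both copies are dominated, once every pair has been selected, by a stationary copy of the
  unconstrained dynamics, that is by \<open>G(n,p)\<close>, whose degrees are concentrated around \<open>p n\<close>; and
  \<open>2 p (p n) < 1\<close> is the condition \<open>c < 1 / sqrt 2\<close>.

  Algorithms. The argument applies verbatim to triangle-free subgraphs of any host graph \<open>H\<close>, with
  partition function \<open>Z(H) = P(H \<inter> G(n,p) is triangle-free)\<close>. Adding the pairs one at a time,
  \<open>Z(H \<union> {e}) / Z(H) = 1 - p P(e closes a triangle)\<close>, the probability being over a random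
  triangle-free subgraph of \<open>H\<close>. This ratio is at least \<open>1/2\<close> and is estimated by
  sampling; the product of the estimates approximates \<open>Z\<close>. A single program computes the product and ends with a
  sample for the complete host graph, so that it serves for both algorithms.
\<close>

text \<open>The obstacle is the worst start: a triangle-free graph may have degrees near
  \<open>n / 2\<close>, where the distance of two copies need not contract. Waiting until every pair
  has been selected costs order \<open>n^2 ln n\<close> steps, no more than the contraction itself.
  The degree bounds then hold only with high probability; this is harmless, since a step from a bad
  configuration adds at most 1 to the expected distance and the bad events have probability of order
  \<open>n^(-6)\<close>, against order \<open>n^2 ln n\<close> steps. Such estimates say something
  for large \<open>n\<close> only; for the finitely many other \<open>n\<close> a lucky sequence of
  removals merges any two states. The law of the selected pair is left open except for a common mass
  \<open>q\<close> on the pairs of \<open>H\<close>, because the program draws two independent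
  vertices, possibly equal, instead of a uniform pair. The machine can neither multiply naturals nor
  round nor take logarithms: hence \<open>n^3\<close> in place of \<open>n^2 ln n\<close>, and a
  single integer \<open>S\<close>, built by additions, as the length of each run and as the number
  of runs.\<close>

abbreviation expect :: "'a pmf \<Rightarrow> ('a \<Rightarrow> real) \<Rightarrow> real" where
  "expect \<equiv> measure_pmf.expectation"

abbreviation prob :: "'a pmf \<Rightarrow> 'a set \<Rightarrow> real" where
  "prob \<equiv> measure_pmf.prob"

section \<open>Expectations and probabilities under laws with finite support\<close>

lemma expect_bind:
  fixes h :: "'b \<Rightarrow> real"
  assumes "finite (set_pmf M)" "\<And>x. x \<in> set_pmf M \<Longrightarrow> finite (set_pmf (f x))"
  shows "expect (bind_pmf M f) h = expect M (\<lambda>x. expect (f x) h)"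
proof -
  have "expect (bind_pmf M f) h = (\<Sum>a\<in>set_pmf M. pmf M a *\<^sub>R expect (f a) h)"
    by (rule pmf_expectation_bind) (use assms in auto)
  also have "\<dots> = expect M (\<lambda>x. expect (f x) h)"
    by (rule integral_measure_pmf[symmetric]) (use assms in auto)
  finally show ?thesis .
qed

lemma expect_mono:
  fixes f g :: "'a \<Rightarrow> real"
  assumes "finite (set_pmf M)" "\<And>x. x \<in> set_pmf M \<Longrightarrow> f x \<le> g x"
  shows "expect M f \<le> expect M g"
  using assms by (intro integral_mono_AE integrable_measure_pmf_finite) (auto simp: AE_measure_pmf_iff)

lemma expect_cong:
  fixes f g :: "'a \<Rightarrow> real"
  assumes "\<And>x. x \<in> set_pmf M \<Longrightarrow> f x = g x"
  shows "expect M f = expect M g"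
  by (rule integral_cong_AE) (auto simp: AE_measure_pmf_iff assms)

lemma prob_bind:
  assumes "finite (set_pmf M)" "\<And>x. x \<in> set_pmf M \<Longrightarrow> finite (set_pmf (f x))"
  shows "prob (bind_pmf M f) A = expect M (\<lambda>x. prob (f x) A)"
  using expect_bind[OF assms, where h = "indicator A"] by simp

text \<open>One step of a union bound: a first outcome in \<open>B\<close> is charged its full
  probability, any other one at most \<open>k\<close>.\<close>

lemma prob_bind_le:
  assumes "finite (set_pmf M)" "\<And>x. x \<in> set_pmf M \<Longrightarrow> finite (set_pmf (f x))"
    and "\<And>x. x \<in> set_pmf M \<Longrightarrow> x \<notin> B \<Longrightarrow> prob (f x) A \<le> k" "0 \<le> k"
  shows "prob (bind_pmf M f) A \<le> prob M B + k"
proof -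
  have "prob (bind_pmf M f) A = expect M (\<lambda>x. prob (f x) A)" by (rule prob_bind[OF assms(1,2)])
  also have "\<dots> \<le> expect M (\<lambda>x. indicator B x + k)"
  proof (rule expect_mono[OF assms(1)])
    fix x assume x: "x \<in> set_pmf M"
    have "prob (f x) A \<le> 1" by simp
    then show "prob (f x) A \<le> indicator B x + k"
      using assms(3)[OF x] assms(4) by (cases "x \<in> B") (simp_all add: add_increasing2)
  qed
  also have "\<dots> = prob M B + k"
    by (subst Bochner_Integration.integral_add) (auto intro: integrable_measure_pmf_finite assms)
  finally show ?thesis .
qed

section \<open>Chains given by random maps\<close>

text \<open>The randomness \<open>r\<close> is kept apart from the state so that the same draw can
  drive several copies: couplings and dominating chains are again chains of this form, with the same
  \<open>R\<close>.\<close>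

primrec random_map_chain :: "'r pmf \<Rightarrow> ('r \<Rightarrow> 'a \<Rightarrow> 'a) \<Rightarrow> nat \<Rightarrow> 'a \<Rightarrow> 'a pmf" where
  "random_map_chain R f 0 x = return_pmf x"
| "random_map_chain R f (Suc t) x =
     bind_pmf (random_map_chain R f t x) (\<lambda>y. map_pmf (\<lambda>r. f r y) R)"

lemma random_map_chain_add:
  "random_map_chain R f (s + t) x = bind_pmf (random_map_chain R f s x) (random_map_chain R f t)"
  by (induction t) (simp_all add: bind_return_pmf' bind_assoc_pmf)

text \<open>A map that intertwines two families of random maps carries one chain to the other. The
  marginals of the couplings below are read off in this way.\<close>

lemma map_random_map_chain:
  assumes "\<And>r x. r \<in> set_pmf R \<Longrightarrow> h (f r x) = g r (h x)"
  shows "map_pmf h (random_map_chain R f t x) = random_map_chain R g t (h x)"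
proof (induction t)
  case (Suc t)
  have "map_pmf h (random_map_chain R f (Suc t) x) =
        bind_pmf (random_map_chain R f t x) (\<lambda>y. map_pmf (\<lambda>r. h (f r y)) R)"
    by (simp add: map_bind_pmf map_pmf_comp)
  also have "\<dots> = bind_pmf (random_map_chain R f t x) (\<lambda>y. map_pmf (\<lambda>r. g r (h y)) R)"
    by (intro bind_pmf_cong map_pmf_cong refl assms)
  also have "\<dots> = random_map_chain R g (Suc t) (h x)"
    by (simp add: Suc[symmetric] bind_map_pmf)
  finally show ?case .
qed simp

lemma finite_set_random_map_chain:
  assumes "finite (set_pmf R)"
  shows "finite (set_pmf (random_map_chain R f t x))"
  by (induction t) (use assms in auto)

lemma random_map_chain_invariant:
  assumes "\<And>r x. r \<in> set_pmf R \<Longrightarrow> I x \<Longrightarrow> I (f r x)" "I x" "y \<in> set_pmf (random_map_chain R f t x)"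
  shows "I y"
  using assms(3)
proof (induction t arbitrary: y)
  case (Suc t) then show ?case using assms(1) by auto
qed (use assms(2) in auto)

lemma random_map_chain_stationary:
  assumes "bind_pmf \<mu> (\<lambda>x. map_pmf (\<lambda>r. f r x) R) = \<mu>"
  shows "bind_pmf \<mu> (random_map_chain R f t) = \<mu>"
proof (induction t)
  case (Suc t)
  have "random_map_chain R f (Suc t) =
      (\<lambda>x. bind_pmf (random_map_chain R f t x) (\<lambda>x. map_pmf (\<lambda>r. f r x) R))"
    by (rule ext) simp
  then have "bind_pmf \<mu> (random_map_chain R f (Suc t)) =
        bind_pmf (bind_pmf \<mu> (random_map_chain R f t)) (\<lambda>x. map_pmf (\<lambda>r. f r x) R)"
    by (simp add: bind_assoc_pmf)
  then show ?case by (simp only: Suc assms)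
qed (simp add: bind_return_pmf')

definition coupled_map :: "('r \<Rightarrow> 'a \<Rightarrow> 'a) \<Rightarrow> 'r \<Rightarrow> 'a \<times> 'a \<Rightarrow> 'a \<times> 'a" where
  "coupled_map f r xy = (f r (fst xy), f r (snd xy))"

lemma map_fst_coupled:
  "map_pmf fst (random_map_chain R (coupled_map f) t xy) = random_map_chain R f t (fst xy)"
  by (rule map_random_map_chain) (simp add: coupled_map_def)

lemma map_snd_coupled:
  "map_pmf snd (random_map_chain R (coupled_map f) t xy) = random_map_chain R f t (snd xy)"
  by (rule map_random_map_chain) (simp add: coupled_map_def)

definition apart :: "('a \<times> 'a) set" where
  "apart = {xy. fst xy \<noteq> snd xy}"

lemma coupled_coalesced: "prob (random_map_chain R (coupled_map f) t (x, x)) apart = 0"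
proof -
  have "set_pmf (random_map_chain R (coupled_map f) t (x, x)) \<inter> apart = {}"
    using random_map_chain_invariant[where I = "\<lambda>xy. fst xy = snd xy" and R = R and
        f = "coupled_map f" and x = "(x, x)" and t = t]
    by (auto simp: apart_def coupled_map_def)
  then show ?thesis by (simp add: measure_pmf_zero_iff)
qed

definition apart_prob :: "'r pmf \<Rightarrow> ('r \<Rightarrow> 'a \<Rightarrow> 'a) \<Rightarrow> nat \<Rightarrow> 'a \<Rightarrow> 'a \<Rightarrow> real" where
  "apart_prob R f t x y = prob (random_map_chain R (coupled_map f) t (x, y)) apart"

lemma apart_prob_same [simp]: "apart_prob R f t x x = 0"
  by (simp add: apart_prob_def coupled_coalesced)

text \<open>Markov property at time \<open>s\<close>: copies that have met stay together, and the
  others are still apart \<open>t\<close> steps later with probability at most \<open>b\<close>. The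
  set \<open>I\<close> restricts this uniform bound to the legal states.\<close>

lemma apart_prob_add:
  assumes R: "finite (set_pmf R)"
    and I: "\<And>r x. r \<in> set_pmf R \<Longrightarrow> x \<in> I \<Longrightarrow> f r x \<in> I" "x \<in> I" "y \<in> I"
    and b: "\<And>x y. x \<in> I \<Longrightarrow> y \<in> I \<Longrightarrow> apart_prob R f t x y \<le> b"
  shows "apart_prob R f (s + t) x y \<le> apart_prob R f s x y * b"
proof -
  let ?C = "\<lambda>t. random_map_chain R (coupled_map f) t"
  have fin: "finite (set_pmf (?C t z))" for t z by (rule finite_set_random_map_chain[OF R])
  have "apart_prob R f (s + t) x y = expect (?C s (x, y)) (\<lambda>z. prob (?C t z) apart)"
    unfolding apart_prob_def random_map_chain_add by (rule prob_bind) (use fin in auto)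
  also have "\<dots> \<le> expect (?C s (x, y)) (\<lambda>z. indicator apart z * b)"
  proof (rule expect_mono[OF fin])
    fix z assume z: "z \<in> set_pmf (?C s (x, y))"
    have "fst z \<in> I \<and> snd z \<in> I"
      by (rule random_map_chain_invariant[OF _ _ z]) (use I in \<open>auto simp: coupled_map_def\<close>)
    then have 1: "prob (?C t z) apart \<le> b" using b[of "fst z" "snd z"] by (simp add: apart_prob_def)
    show "prob (?C t z) apart \<le> indicator apart z * b"
    proof (cases "z \<in> apart")
      case False
      then have "z = (fst z, fst z)" by (simp add: apart_def prod_eq_iff)
      then have "prob (?C t z) apart = 0" using coupled_coalesced by metis
      then show ?thesis using False by simp
    qed (use 1 in simp)
  qed
  also have "\<dots> = apart_prob R f s x y * b" by (simp add: apart_prob_def)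
  finally show ?thesis .
qed

lemma apart_prob_le_1: "apart_prob R f t x y \<le> 1"
  by (simp add: apart_prob_def)

lemma apart_prob_antimono:
  assumes "finite (set_pmf R)" "s \<le> t"
  shows "apart_prob R f t x y \<le> apart_prob R f s x y"
  using apart_prob_add[OF assms(1), where I = UNIV and f = f and b = 1 and s = s and t = "t - s"
      and x = x and y = y] assms(2)
  by (simp add: apart_prob_le_1)

text \<open>A fixed chance of meeting in each block of \<open>t\<close> steps gives geometric decay.
  It serves to amplify \<open>1 / 8\<close> to \<open>(1 / 8) ^ k\<close> and to exploit the tiny
  chance available for small \<open>n\<close>.\<close>

lemma apart_prob_power:
  assumes R: "finite (set_pmf R)"
    and I: "\<And>r x. r \<in> set_pmf R \<Longrightarrow> x \<in> I \<Longrightarrow> f r x \<in> I" "x \<in> I" "y \<in> I"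
    and b: "\<And>x y. x \<in> I \<Longrightarrow> y \<in> I \<Longrightarrow> apart_prob R f t x y \<le> b"
  shows "apart_prob R f (k * t) x y \<le> b ^ k"
proof (induction k)
  case 0 then show ?case by (simp add: apart_prob_le_1)
next
  case (Suc k)
  have b0: "0 \<le> b" using b[OF I(2) I(2)] by simp
  have "apart_prob R f (k * t + t) x y \<le> apart_prob R f (k * t) x y * b"
    by (rule apart_prob_add[where I = I]) (use assms in auto)
  also have "\<dots> \<le> b ^ k * b" by (rule mult_right_mono[OF Suc b0])
  finally show ?case by (simp add: add.commute mult.commute)
qed

section \<open>Total variation distance\<close>

lemma tv_dist_leI:
  assumes "\<And>A. \<bar>prob P A - prob Q A\<bar> \<le> d"
  shows "tv_dist P Q \<le> d"
  unfolding tv_dist_def by (rule cSUP_least) (use assms in auto)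

lemma prob_diff_le_tv_dist: "\<bar>prob P A - prob Q A\<bar> \<le> tv_dist P Q"
  unfolding tv_dist_def
proof (rule cSUP_upper)
  show "bdd_above (range (\<lambda>A. \<bar>prob P A - prob Q A\<bar>))"
  proof (rule bdd_aboveI2[where M = 1])
    fix A
    have "0 \<le> prob P A" "prob P A \<le> 1" "0 \<le> prob Q A" "prob Q A \<le> 1" by simp_all
    then show "\<bar>prob P A - prob Q A\<bar> \<le> 1" by linarith
  qed
qed simp

text \<open>The coupling inequality: an event can separate the two marginals only through outcomes
  whose coordinates differ.\<close>

lemma coupling_prob_diff:
  "\<bar>prob (map_pmf fst J) A - prob (map_pmf snd J) A\<bar> \<le> prob J apart"
proof -
  have "prob J (fst -` A) \<le> prob J (snd -` A \<union> apart)" "prob J (snd -` A) \<le> prob J (fst -` A \<union> apart)"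
    by (intro measure_pmf.finite_measure_mono; auto simp: apart_def)+
  moreover have "prob J (snd -` A \<union> apart) \<le> prob J (snd -` A) + prob J apart"
    "prob J (fst -` A \<union> apart) \<le> prob J (fst -` A) + prob J apart"
    by (intro measure_subadditive; simp)+
  ultimately show ?thesis by simp
qed

text \<open>The second copy starts from the stationary law and keeps it, so its marginal at time
  \<open>t\<close> is \<open>\<mu>\<close>; averaging over its start leaves the worst case
  \<open>b\<close>.\<close>

lemma tv_dist_stationary_le:
  assumes R: "finite (set_pmf R)" and \<mu>: "finite (set_pmf \<mu>)"
    and stat: "bind_pmf \<mu> (\<lambda>x. map_pmf (\<lambda>r. f r x) R) = \<mu>"
    and b: "\<And>y. y \<in> set_pmf \<mu> \<Longrightarrow> apart_prob R f t x y \<le> b"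
  shows "tv_dist (random_map_chain R f t x) \<mu> \<le> b"
proof (rule tv_dist_leI)
  fix A
  define J where "J = bind_pmf \<mu> (\<lambda>y. random_map_chain R (coupled_map f) t (x, y))"
  have 1: "map_pmf fst J = random_map_chain R f t x"
    by (simp add: J_def map_bind_pmf map_fst_coupled)
  have 2: "map_pmf snd J = \<mu>"
    by (simp add: J_def map_bind_pmf map_snd_coupled random_map_chain_stationary[OF stat])
  have "prob J apart = expect \<mu> (apart_prob R f t x)"
    unfolding J_def apart_prob_def by (rule prob_bind) (use \<mu> finite_set_random_map_chain[OF R] in auto)
  also have "\<dots> \<le> expect \<mu> (\<lambda>_. b)" by (rule expect_mono[OF \<mu> b])
  finally show "\<bar>prob (random_map_chain R f t x) A - prob \<mu> A\<bar> \<le> b"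
    using coupling_prob_diff[of J A] unfolding 1 2 by simp
qed

section \<open>Constrained random subsets and their Glauber dynamics\<close>

text \<open>\<open>gnp\<close> over an arbitrary ground set, since the host graph grows during the
  estimation; \<open>gnp_eq\<close> is the case of all pairs.\<close>

definition random_subset :: "'a set \<Rightarrow> real \<Rightarrow> 'a set pmf" where
  "random_subset H p = map_pmf (\<lambda>f. {e \<in> H. f e}) (Pi_pmf H False (\<lambda>_. bernoulli_pmf p))"

lemma set_random_subset: "set_pmf (random_subset H p) \<subseteq> Pow H"
  by (auto simp: random_subset_def)

lemma finite_set_random_subset: "finite H \<Longrightarrow> finite (set_pmf (random_subset H p))"
  by (rule finite_subset[OF set_random_subset]) simp

lemma pmf_random_subset:
  assumes H: "finite H" and p: "0 \<le> p" "p \<le> 1" and G: "G \<subseteq> H"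
  shows "pmf (random_subset H p) G = p ^ card G * (1 - p) ^ card (H - G)"
proof -
  let ?P = "Pi_pmf H False (\<lambda>_. bernoulli_pmf p)"
  have "pmf (random_subset H p) G = prob ?P ((\<lambda>f. {e \<in> H. f e}) -` {G})"
    by (simp add: random_subset_def pmf_map)
  also have "\<dots> = prob ?P {\<lambda>e. e \<in> G}"
  proof (rule measure_prob_cong_0)
    fix f assume f: "f \<in> (\<lambda>f. {e \<in> H. f e}) -` {G} - {\<lambda>e. e \<in> G}"
    then obtain e where e: "f e \<noteq> (e \<in> G)" by blast
    have fG: "{e \<in> H. f e} = G" using f by simp
    have "e \<notin> H" using e fG by blast
    moreover from this have "f e" using e G by blast
    ultimately have "\<exists>x. x \<notin> H \<and> f x \<noteq> False" by blast
    then show "pmf ?P f = 0" by (rule pmf_Pi_outside[OF H])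
  qed (use G in auto)
  also have "\<dots> = (\<Prod>e\<in>H. pmf (bernoulli_pmf p) (e \<in> G))"
    using G H by (subst measure_pmf_single, subst pmf_Pi') auto
  also have "\<dots> = (\<Prod>e\<in>G. pmf (bernoulli_pmf p) (e \<in> G)) *
                  (\<Prod>e\<in>H - G. pmf (bernoulli_pmf p) (e \<in> G))"
    by (subst prod.subset_diff[OF G H]) (rule mult.commute)
  also have "\<dots> = p ^ card G * (1 - p) ^ card (H - G)"
    using p by simp
  finally show ?thesis .
qed

text \<open>A selection outside \<open>H\<close> leaves the state alone. This covers the pairs
  missing from the host graph and also the singletons that arise when the program draws the same
  vertex twice.\<close>

definition update :: "('a set \<Rightarrow> bool) \<Rightarrow> 'a set \<Rightarrow> 'a \<times> bool \<Rightarrow> 'a set \<Rightarrow> 'a set" where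
  "update Q H eb G = (if fst eb \<notin> H then G
     else if snd eb \<and> Q (insert (fst eb) G) then insert (fst eb) G else G - {fst eb})"

text \<open>Stationarity is proved once for every hereditary constraint and used twice: for
  \<open>triangle_free\<close>, and for the constraint that always holds, whose dynamics is the
  dominating one. \<open>Q {}\<close> makes the conditioning event non-null when
  \<open>p < 1\<close>.\<close>

definition down_closed :: "('a set \<Rightarrow> bool) \<Rightarrow> bool" where
  "down_closed Q \<longleftrightarrow> Q {} \<and> (\<forall>A B. A \<subseteq> B \<longrightarrow> Q B \<longrightarrow> Q A)"

definition constrained :: "('a set \<Rightarrow> bool) \<Rightarrow> 'a set \<Rightarrow> 'a set set" where
  "constrained Q H = {G. G \<subseteq> H \<and> Q G}"

definition gibbs :: "('a set \<Rightarrow> bool) \<Rightarrow> 'a set \<Rightarrow> real \<Rightarrow> 'a set pmf" where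
  "gibbs Q H p = cond_pmf (random_subset H p) (constrained Q H)"

lemma down_closedD: "down_closed Q \<Longrightarrow> Q B \<Longrightarrow> A \<subseteq> B \<Longrightarrow> Q A"
  by (auto simp: down_closed_def)

lemma constrained_subset:
  "down_closed Q \<Longrightarrow> B \<in> constrained Q H \<Longrightarrow> A \<subseteq> B \<Longrightarrow> A \<in> constrained Q H"
  unfolding constrained_def using down_closedD by blast

lemma update_constrained:
  assumes "down_closed Q" "G \<in> constrained Q H"
  shows "update Q H eb G \<in> constrained Q H"
  using assms constrained_subset[OF assms, of "G - {fst eb}"]
  by (auto simp: update_def constrained_def)

lemma prob_constrained_pos:
  assumes "finite H" "0 \<le> p" "p < 1" "down_closed Q"
  shows "0 < prob (random_subset H p) (constrained Q H)"
proof -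
  have "0 < pmf (random_subset H p) {}"
    using assms by (subst pmf_random_subset) auto
  also have "\<dots> \<le> prob (random_subset H p) (constrained Q H)"
    unfolding measure_pmf_single[symmetric]
    by (rule measure_pmf.finite_measure_mono) (use assms in \<open>auto simp: constrained_def down_closed_def\<close>)
  finally show ?thesis .
qed

lemma gibbs_True: "gibbs (\<lambda>_. True) H p = random_subset H p"
proof (rule pmf_eqI)
  fix G
  have n: "set_pmf (random_subset H p) \<inter> constrained (\<lambda>_. True) H \<noteq> {}"
    using set_random_subset[of H p] set_pmf_not_empty[of "random_subset H p"] by (auto simp: constrained_def)
  have 1: "prob (random_subset H p) (constrained (\<lambda>_. True) H) = 1"
    using set_random_subset[of H p] by (auto simp: constrained_def measure_pmf.prob_eq_1 AE_measure_pmf_iff)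
  show "pmf (gibbs (\<lambda>_. True) H p) G = pmf (random_subset H p) G"
    unfolding gibbs_def pmf_cond[OF n] 1 using set_random_subset[of H p]
    by (auto simp: constrained_def set_pmf_iff)
qed

context
  fixes H :: "'a set" and p :: real and Q :: "'a set \<Rightarrow> bool"
  assumes H: "finite H" and p: "0 \<le> p" "p < 1" and Q: "down_closed Q"
begin

lemma gibbs_nonempty: "set_pmf (random_subset H p) \<inter> constrained Q H \<noteq> {}"
  using prob_constrained_pos[OF H p Q] measure_pmf_zero_iff[of "random_subset H p" "constrained Q H"] by auto

lemma set_gibbs: "set_pmf (gibbs Q H p) \<subseteq> constrained Q H"
  by (simp add: gibbs_def set_cond_pmf[OF gibbs_nonempty])

lemma finite_set_gibbs: "finite (set_pmf (gibbs Q H p))"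
  by (rule finite_subset[OF set_gibbs]) (use H in \<open>auto simp: constrained_def\<close>)

lemma pmf_gibbs:
  "pmf (gibbs Q H p) G = (if G \<in> constrained Q H
     then p ^ card G * (1 - p) ^ card (H - G) / prob (random_subset H p) (constrained Q H) else 0)"
  unfolding gibbs_def pmf_cond[OF gibbs_nonempty]
  using pmf_random_subset[OF H p(1)] p by (auto simp: constrained_def)

text \<open>The two weights differ only in the factor for \<open>e\<close>, which is
  \<open>1 - p\<close> against \<open>p\<close>; the normalising constant cancels.\<close>

lemma gibbs_detailed_balance:
  assumes e: "e \<in> H" "e \<notin> G" and I: "insert e G \<in> constrained Q H"
  shows "p * pmf (gibbs Q H p) G = (1 - p) * pmf (gibbs Q H p) (insert e G)"
proof -
  have G: "G \<in> constrained Q H" by (rule constrained_subset[OF Q I]) auto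
  have fin: "finite G" using G H finite_subset by (auto simp: constrained_def)
  have "card (H - G) = Suc (card (H - G - {e}))"
    using card_Suc_Diff1[of "H - G" e] H e by simp
  moreover have "H - G - {e} = H - insert e G" by auto
  ultimately have c: "card (H - G) = Suc (card (H - insert e G))" by simp
  have "card (insert e G) = Suc (card G)" using e fin by simp
  then show ?thesis unfolding pmf_gibbs c using G I by simp
qed

lemma gibbs_single_site_stationary:
  assumes e: "e \<in> H"
  shows "bind_pmf (gibbs Q H p) (\<lambda>G. map_pmf (\<lambda>b. update Q H (e, b) G) (bernoulli_pmf p)) = gibbs Q H p"
proof (rule pmf_eqI)
  fix G'
  let ?\<mu> = "gibbs Q H p"
  let ?K = "\<lambda>G. map_pmf (\<lambda>b. update Q H (e, b) G) (bernoulli_pmf p)"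
  have K: "pmf (?K G) G' = p * of_bool (update Q H (e, True) G = G') + (1 - p) * of_bool (G - {e} = G')" for G
  proof -
    have "?K G = bind_pmf (bernoulli_pmf p) (\<lambda>b. return_pmf (update Q H (e, b) G))"
      by (simp add: map_pmf_def)
    then show ?thesis using p e by (simp add: pmf_bind update_def indicator_def of_bool_def)
  qed
  have up: "update Q H (e, True) X = (if Q (insert e X) then insert e X else X - {e})" for X
    using e by (simp add: update_def)
  \<comment> \<open>An update at \<open>e\<close> alters nothing but \<open>e\<close>, so
    \<open>G'\<close> can be reached from these two graphs only.\<close>
  let ?S = "{G' - {e}, insert e G'}"
  have "pmf (bind_pmf ?\<mu> ?K) G' = expect ?\<mu> (\<lambda>G. pmf (?K G) G')" by (rule pmf_bind)
  also have "\<dots> = (\<Sum>G\<in>?S. pmf ?\<mu> G * pmf (?K G) G')"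
  proof (subst integral_measure_pmf_real[where A = ?S])
    fix G assume "G \<in> set_pmf ?\<mu>" "pmf (?K G) G' \<noteq> 0"
    then have "update Q H (e, True) G = G' \<or> G - {e} = G'" 
      by (cases "update Q H (e, True) G = G'"; cases "G - {e} = G'") (simp_all add: K)
    then have "insert e G = G' \<or> G - {e} = G'" by (simp add: up split: if_splits)
    then show "G \<in> ?S" by auto
  qed (auto simp: mult.commute)
  also have "\<dots> = pmf ?\<mu> (G' - {e}) * pmf (?K (G' - {e})) G' + pmf ?\<mu> (insert e G') * pmf (?K (insert e G')) G'"
    by (subst sum.insert) auto
  also have "\<dots> = pmf ?\<mu> G'"
  proof (cases "e \<in> G'")
    case True
    then have i: "insert e G' = G'" "insert e (G' - {e}) = G'" by auto
    show ?thesis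
    proof (cases "G' \<in> constrained Q H")
      case True': True
      have "p * pmf ?\<mu> (G' - {e}) = (1 - p) * pmf ?\<mu> G'"
        using gibbs_detailed_balance[OF e, of "G' - {e}"] True' i by simp
      moreover have "update Q H (e, True) (G' - {e}) = G'" "update Q H (e, True) G' = G'"
        using True' i by (simp_all add: up constrained_def)
      moreover have "G' - {e} \<noteq> G'" "G' - {e} - {e} \<noteq> G'" using True by auto
      ultimately show ?thesis using True i by (simp add: K algebra_simps)
    next
      case False
      \<comment> \<open>If \<open>G' - {e}\<close> carries mass, the insertion that would lead to
        \<open>G'\<close> is rejected; the mass of \<open>G'\<close> itself is 0.\<close>
      have "\<not> Q G'" if "G' - {e} \<in> constrained Q H"
        using False that e True by (auto simp: constrained_def)
      moreover have "pmf ?\<mu> G' = 0" using False by (simp add: pmf_gibbs)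
      moreover have "G' - {e} \<noteq> G'" "G' - {e} - {e} \<noteq> G'" using True by auto
      ultimately show ?thesis using True i e
        by (auto simp: K up pmf_gibbs)
    qed
  next
    case False
    then have i: "G' - {e} = G'" "insert e G' - {e} = G'" "insert e G' \<noteq> G'" by auto
    show ?thesis
    proof (cases "insert e G' \<in> constrained Q H")
      case True
      have "p * pmf ?\<mu> G' = (1 - p) * pmf ?\<mu> (insert e G')"
        using gibbs_detailed_balance[OF e False True] .
      moreover have "Q (insert e G')" using True by (simp add: constrained_def)
      ultimately show ?thesis using i e by (simp add: K up algebra_simps)
    next
      case F: False
      \<comment> \<open>Here the insertion of \<open>e\<close> into \<open>G'\<close> is rejected,
        so a legal \<open>G'\<close> keeps its mass for both values of the coin.\<close>
      have "pmf ?\<mu> (insert e G') = 0" using F by (simp add: pmf_gibbs)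
      moreover have "\<not> Q (insert e G')" if "G' \<in> constrained Q H"
        using that F e by (auto simp: constrained_def)
      ultimately show ?thesis using i e
        by (cases "G' \<in> constrained Q H") (auto simp: K up pmf_gibbs algebra_simps)
    qed
  qed
  finally show "pmf (bind_pmf ?\<mu> ?K) G' = pmf ?\<mu> G'" .
qed

text \<open>A mixture of kernels that fix a law fixes it too, and for a pair outside
  \<open>H\<close> the kernel is the identity. Hence any selection law will do, in particular the
  uniform one and the one of the program.\<close>

lemma gibbs_stationary:
  "bind_pmf (gibbs Q H p) (\<lambda>G. map_pmf (\<lambda>eb. update Q H eb G) (pair_pmf sel (bernoulli_pmf p))) = gibbs Q H p"
proof -
  let ?\<mu> = "gibbs Q H p"
  have "bind_pmf ?\<mu> (\<lambda>G. map_pmf (\<lambda>eb. update Q H eb G) (pair_pmf sel (bernoulli_pmf p))) =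
      bind_pmf ?\<mu> (\<lambda>G. bind_pmf sel (\<lambda>e. map_pmf (\<lambda>b. update Q H (e, b) G) (bernoulli_pmf p)))"
    by (simp add: pair_pmf_def map_bind_pmf map_pmf_def[symmetric] map_pmf_comp)
  also have "\<dots> = bind_pmf sel (\<lambda>e. bind_pmf ?\<mu> (\<lambda>G. map_pmf (\<lambda>b. update Q H (e, b) G) (bernoulli_pmf p)))"
    by (rule bind_commute_pmf)
  also have "\<dots> = bind_pmf sel (\<lambda>e. ?\<mu>)"
  proof (rule bind_pmf_cong[OF refl])
    fix e
    show "bind_pmf ?\<mu> (\<lambda>G. map_pmf (\<lambda>b. update Q H (e, b) G) (bernoulli_pmf p)) = ?\<mu>"
    proof (cases "e \<in> H")
      case False
      then show ?thesis by (simp add: update_def bind_return_pmf')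
    qed (rule gibbs_single_site_stationary)
  qed
  finally show ?thesis by simp
qed

end

section \<open>Contraction of the triangle-free Glauber dynamics\<close>

lemma down_closed_triangle_free: "down_closed triangle_free"
  unfolding down_closed_def triangle_free_def by blast

text \<open>A triangle that was not there before uses the new edge, so only its third vertex is
  unknown. The program searches for this vertex.\<close>

lemma triangle_free_insert_iff:
  assumes "triangle_free X" "u \<noteq> v"
  shows "triangle_free (insert {u, v} X) \<longleftrightarrow> \<not> (\<exists>w. w \<noteq> u \<and> w \<noteq> v \<and> {u, w} \<in> X \<and> {v, w} \<in> X)"
proof
  assume l: "triangle_free (insert {u, v} X)"
  show "\<not> (\<exists>w. w \<noteq> u \<and> w \<noteq> v \<and> {u, w} \<in> X \<and> {v, w} \<in> X)"
  proof
    assume "\<exists>w. w \<noteq> u \<and> w \<noteq> v \<and> {u, w} \<in> X \<and> {v, w} \<in> X"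
    then obtain w where "w \<noteq> u" "w \<noteq> v" "{u, w} \<in> X" "{v, w} \<in> X" by blast
    then show False using l assms(2) unfolding triangle_free_def by (metis insertCI)
  qed
next
  assume r: "\<not> (\<exists>w. w \<noteq> u \<and> w \<noteq> v \<and> {u, w} \<in> X \<and> {v, w} \<in> X)"
  show "triangle_free (insert {u, v} X)"
    unfolding triangle_free_def
  proof clarify
    fix x y z assume ne: "x \<noteq> y" "y \<noteq> z" "x \<noteq> z"
      and e: "{x, y} \<in> insert {u, v} X" "{y, z} \<in> insert {u, v} X" "{x, z} \<in> insert {u, v} X"
    have "{x, y} = {u, v} \<or> {y, z} = {u, v} \<or> {x, z} = {u, v}"
      using assms(1) e ne unfolding triangle_free_def by blast
    then show False
    proof (elim disjE)
      assume a: "{x, y} = {u, v}"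
      then have "{y, z} \<noteq> {u, v}" "{x, z} \<noteq> {u, v}" using ne by (auto simp: doubleton_eq_iff)
      then have "{y, z} \<in> X" "{x, z} \<in> X" using e by simp_all
      then show False using r a ne by (metis doubleton_eq_iff)
    next
      assume a: "{y, z} = {u, v}"
      then have "{x, y} \<noteq> {u, v}" "{x, z} \<noteq> {u, v}" using ne by (auto simp: doubleton_eq_iff)
      then have "{x, y} \<in> X" "{x, z} \<in> X" using e by simp_all
      then show False using r a ne by (metis doubleton_eq_iff insert_commute)
    next
      assume a: "{x, z} = {u, v}"
      then have "{x, y} \<noteq> {u, v}" "{y, z} \<noteq> {u, v}" using ne by (auto simp: doubleton_eq_iff)
      then have "{x, y} \<in> X" "{y, z} \<in> X" using e by simp_all
      then show False using r a ne by (metis doubleton_eq_iff insert_commute)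
    qed
  qed
qed

lemma pairsE:
  assumes "e \<in> pairs n"
  obtains u v where "e = {u, v}" "u \<noteq> v" "u \<in> {1..n}" "v \<in> {1..n}"
proof -
  from assms have "card e = 2" "e \<subseteq> {1..n}" by (auto simp: pairs_def)
  then obtain u v where "e = {u, v}" "u \<noteq> v" by (auto simp: card_2_iff)
  with \<open>e \<subseteq> {1..n}\<close> that show ?thesis by auto
qed

definition vdeg :: "graph \<Rightarrow> nat \<Rightarrow> nat" where
  "vdeg G v = card {e \<in> G. v \<in> e}"

definition blocked_differently :: "graph \<Rightarrow> graph \<Rightarrow> graph \<Rightarrow> nat set set" where
  "blocked_differently H X Y = {e \<in> H. triangle_free (insert e X) \<noteq> triangle_free (insert e Y)}"

text \<open>A pair which closes a triangle with \<open>X\<close> but not with \<open>Y\<close> is the symmetric difference of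
  an edge of \<open>X - Y\<close> and an adjacent edge of \<open>X\<close>.\<close>

lemma blocked_only_in_one:
  assumes X: "triangle_free X" and Y: "triangle_free Y" and e: "e \<in> pairs n"
    and bl: "\<not> triangle_free (insert e X)" and nb: "triangle_free (insert e Y)"
  shows "\<exists>f g. f \<in> X - Y \<and> g \<in> X \<and> f \<inter> g \<noteq> {} \<and> e = f \<union> g - f \<inter> g"
proof -
  obtain u v where uv: "e = {u, v}" "u \<noteq> v" using e by (rule pairsE)
  obtain w where w: "w \<noteq> u" "w \<noteq> v" "{u, w} \<in> X" "{v, w} \<in> X"
    using bl uv triangle_free_insert_iff[OF X uv(2)] by auto
  have "{u, w} \<notin> Y \<or> {v, w} \<notin> Y"
    using nb uv triangle_free_insert_iff[OF Y uv(2)] w by auto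
  then show ?thesis
  proof
    assume "{u, w} \<notin> Y"
    then show ?thesis using w uv by (intro exI[of _ "{u, w}"] exI[of _ "{v, w}"]) auto
  next
    assume "{v, w} \<notin> Y"
    then show ?thesis using w uv by (intro exI[of _ "{v, w}"] exI[of _ "{u, w}"]) auto
  qed
qed

text \<open>A blocked pair is determined by an edge \<open>f\<close> of the symmetric difference and
  an edge \<open>g\<close> meeting it; \<open>f\<close> has two ends, which gives the factor 2.
  Degrees are measured in a common supergraph \<open>W\<close> because those of \<open>X\<close> and
  \<open>Y\<close> are not controlled directly.\<close>

lemma card_blocked_differently:
  assumes H: "H \<subseteq> pairs n" and X: "X \<in> constrained triangle_free H" and Y: "Y \<in> constrained triangle_free H"
    and W: "X \<subseteq> W" "Y \<subseteq> W" "W \<subseteq> H" and D: "\<And>v. real (vdeg W v) \<le> D"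
  shows "real (card (blocked_differently H X Y)) \<le> 2 * D * card (sym_diff X Y)"
proof -
  have fin: "finite H" using H finite_pairs finite_subset by blast
  have finW: "finite W" using fin W(3) finite_subset by blast
  let ?S = "sym_diff X Y"
  have S: "?S \<subseteq> pairs n" using H X Y by (auto simp: constrained_def)
  then have finS: "finite ?S" using finite_pairs finite_subset by blast
  let ?P = "SIGMA f:?S. \<Union>v\<in>f. {g \<in> W. v \<in> g}"
  let ?h = "\<lambda>(f, g). f \<union> g - f \<inter> g"
  have finf: "finite f" if "f \<in> ?S" for f
  proof -
    have "f \<in> pairs n" using S that by blast
    then show ?thesis by (auto simp: pairs_def intro: finite_subset)
  qed
  have finP: "finite ?P" using finS finW finf by (intro finite_SigmaI finite_UN_I) auto
  have "blocked_differently H X Y \<subseteq> ?h ` ?P"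
  proof
    fix e assume e: "e \<in> blocked_differently H X Y"
    then have en: "e \<in> pairs n" using H by (auto simp: blocked_differently_def)
    have tf: "triangle_free X" "triangle_free Y" using X Y by (auto simp: constrained_def)
    have "\<exists>f g. f \<in> ?S \<and> g \<in> W \<and> f \<inter> g \<noteq> {} \<and> e = f \<union> g - f \<inter> g"
    proof (cases "triangle_free (insert e X)")
      case True
      then have "\<not> triangle_free (insert e Y)" using e by (auto simp: blocked_differently_def)
      from blocked_only_in_one[OF tf(2,1) en this True] show ?thesis using W by blast
    next
      case False
      then have "triangle_free (insert e Y)" using e by (auto simp: blocked_differently_def)
      from blocked_only_in_one[OF tf en False this] show ?thesis using W by blast
    qed
    then obtain f g where fg: "f \<in> ?S" "g \<in> W" "f \<inter> g \<noteq> {}" "e = f \<union> g - f \<inter> g" by blast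
    then have "(f, g) \<in> ?P" by blast
    then show "e \<in> ?h ` ?P" using fg(4) by (intro image_eqI[where x = "(f, g)"]) auto
  qed
  then have "card (blocked_differently H X Y) \<le> card ?P"
    by (rule surj_card_le[OF finP])
  then have "real (card (blocked_differently H X Y)) \<le> real (card ?P)" by simp
  also have "card ?P = (\<Sum>f\<in>?S. card (\<Union>v\<in>f. {g \<in> W. v \<in> g}))"
    using finS finW finf by (intro card_SigmaI) auto
  also have "real \<dots> = (\<Sum>f\<in>?S. real (card (\<Union>v\<in>f. {g \<in> W. v \<in> g})))" by simp
  also have "\<dots> \<le> (\<Sum>f\<in>?S. 2 * D)"
  proof (rule sum_mono)
    fix f assume f: "f \<in> ?S"
    have "card f = 2" using S f by (auto simp: pairs_def)
    have "real (card (\<Union>v\<in>f. {g \<in> W. v \<in> g})) \<le> real (\<Sum>v\<in>f. vdeg W v)"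
      unfolding vdeg_def of_nat_le_iff by (rule card_UN_le[OF finf[OF f]])
    also have "\<dots> = (\<Sum>v\<in>f. real (vdeg W v))" by simp
    also have "\<dots> \<le> (\<Sum>v\<in>f. D)" by (intro sum_mono D)
    also have "\<dots> = 2 * D" using \<open>card f = 2\<close> by simp
    finally show "real (card (\<Union>v\<in>f. {g \<in> W. v \<in> g})) \<le> 2 * D" .
  qed
  also have "\<dots> = 2 * D * card ?S" by simp
  finally show ?thesis .
qed

text \<open>A removal always makes the copies agree at \<open>e\<close>. An insertion does so too
  unless exactly one copy rejects it, and then \<open>e\<close> alone may become a
  disagreement.\<close>

lemma card_sym_diff_update:
  assumes "e \<in> H" "finite X" "finite Y"
  shows "real (card (sym_diff (update triangle_free H (e, b) X) (update triangle_free H (e, b) Y)))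
      \<le> real (card (sym_diff X Y)) - indicator (sym_diff X Y) e
        + of_bool b * (indicator (blocked_differently H X Y) e :: real)"
proof -
  let ?S = "sym_diff X Y" and ?X = "update triangle_free H (e, b) X" and ?Y = "update triangle_free H (e, b) Y"
  have fin: "finite ?S" using assms by simp
  have c: "real (card (?S - {e})) = real (card ?S) - indicator ?S e"
  proof (cases "e \<in> ?S")
    case True
    then have "card ?S = Suc (card (?S - {e}))" using card_Suc_Diff1[OF fin True] by simp
    then show ?thesis using True by (simp only: indicator_simps)
  next
    case False
    then have "?S - {e} = ?S" by blast
    then show ?thesis using False by (simp only: indicator_simps) simp
  qed
  show ?thesis
  proof (cases "b \<and> e \<in> blocked_differently H X Y")
    case True
    have "sym_diff ?X ?Y \<subseteq> insert e (?S - {e})"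
      by (auto simp: update_def split: if_splits)
    then have "card (sym_diff ?X ?Y) \<le> card (insert e (?S - {e}))" using fin by (intro card_mono) auto
    also have "\<dots> \<le> Suc (card (?S - {e}))" by (rule card_insert_le_m1) auto
    finally have "real (card (sym_diff ?X ?Y)) \<le> real (card (?S - {e})) + 1" by linarith
    then show ?thesis using True c by (simp only: indicator_simps) simp
  next
    case False
    have "sym_diff ?X ?Y \<subseteq> ?S - {e}"
      using False assms(1) by (auto simp: update_def blocked_differently_def split: if_splits)
    then have "card (sym_diff ?X ?Y) \<le> card (?S - {e})" using fin by (intro card_mono) auto
    then have "real (card (sym_diff ?X ?Y)) \<le> real (card ?S) - indicator ?S e" using c by linarith
    then show ?thesis by (simp add: add_increasing2)
  qed
qed

section \<open>One step of two coupled copies on a host graph\<close>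

text \<open>The selection law enters through its common mass \<open>q\<close> on the pairs of
  \<open>H\<close>: this is \<open>1 / card (pairs n)\<close> for the Glauber dynamics and
  \<open>2 / n ^ 2\<close> for the program, which can also select singletons.\<close>

locale triangle_free_dynamics =
  fixes n :: nat and H :: graph and p q :: real and sel :: "nat set pmf"
  assumes H: "H \<subseteq> pairs n" and p: "0 \<le> p" "p < 1" and q: "0 \<le> q" "q \<le> 1"
    and sel: "finite (set_pmf sel)" "\<And>e. e \<in> H \<Longrightarrow> pmf sel e = q"
begin

lemma finite_H: "finite H"
  using H finite_pairs finite_subset by blast

definition "rnd = pair_pmf sel (bernoulli_pmf p)"

abbreviation "upd \<equiv> update triangle_free H"

abbreviation "states \<equiv> constrained triangle_free H"

lemma finite_rnd: "finite (set_pmf rnd)"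
  using sel(1) by (simp add: rnd_def)

lemma finite_state: "X \<in> states \<Longrightarrow> finite X"
  using finite_H finite_subset by (auto simp: constrained_def)

lemma prob_sel:
  assumes "A \<subseteq> H"
  shows "prob sel A = q * card A"
proof -
  have fin: "finite A" using assms finite_H finite_subset by blast
  have "prob sel A = (\<Sum>e\<in>A. pmf sel e)" by (rule measure_measure_pmf_finite[OF fin])
  also have "\<dots> = (\<Sum>e\<in>A. q)" by (rule sum.cong) (use assms sel in auto)
  finally show ?thesis by simp
qed

lemma expect_sym_diff_step:
  assumes X: "X \<in> states" and Y: "Y \<in> states"
  shows "expect rnd (\<lambda>r. real (card (sym_diff (upd r X) (upd r Y))))
     \<le> card (sym_diff X Y) - q * card (sym_diff X Y) + p * q * card (blocked_differently H X Y)"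
proof -
  let ?S = "sym_diff X Y" and ?B = "blocked_differently H X Y"
  have int: "integrable (measure_pmf rnd) f" for f :: "nat set \<times> bool \<Rightarrow> real"
    by (rule integrable_measure_pmf_finite[OF finite_rnd])
  have SH: "?S \<subseteq> H" using X Y by (auto simp: constrained_def)
  have BH: "?B \<subseteq> H" by (auto simp: blocked_differently_def)
  have 1: "expect rnd (indicator (?S \<times> UNIV)) = q * card ?S"
  proof -
    have eq: "?S \<times> UNIV = fst -` ?S" by auto
    have "prob (map_pmf fst rnd) ?S = prob rnd (?S \<times> UNIV)"
      unfolding eq by (simp only: measure_map_pmf)
    then show ?thesis by (simp add: rnd_def map_fst_pair_pmf prob_sel[OF SH])
  qed
  have 2: "expect rnd (indicator (?B \<times> {True})) = p * q * card ?B"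
  proof -
    have "expect rnd (indicator (?B \<times> {True})) = prob rnd (?B \<times> {True})" by simp
    also have "\<dots> = prob sel ?B * prob (bernoulli_pmf p) {True}"
      unfolding rnd_def by (rule measure_pmf_prob_product) (use BH finite_H in \<open>auto intro: countable_finite finite_subset\<close>)
    also have "prob (bernoulli_pmf p) {True} = p" using p by (simp add: measure_pmf_single)
    finally show ?thesis by (simp add: prob_sel[OF BH])
  qed
  have "expect rnd (\<lambda>r. real (card (sym_diff (upd r X) (upd r Y)))) \<le>
      expect rnd (\<lambda>r. real (card ?S) - indicator (?S \<times> UNIV) r + indicator (?B \<times> {True}) r)"
  proof (rule expect_mono[OF finite_rnd])
    fix r :: "nat set \<times> bool"
    obtain e b where r: "r = (e, b)" by force
    show "real (card (sym_diff (upd r X) (upd r Y))) \<le>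
        real (card ?S) - indicator (?S \<times> UNIV) r + indicator (?B \<times> {True}) r"
    proof (cases "e \<in> H")
      case True
      have "indicator (?S \<times> UNIV) r = (indicator ?S e :: real)"
        "indicator (?B \<times> {True}) r = (of_bool b * indicator ?B e :: real)"
        by (auto simp: r indicator_def)
      then show ?thesis
        using card_sym_diff_update[OF True finite_state[OF X] finite_state[OF Y], of b] unfolding r
        by simp
    next
      case False
      then have "r \<notin> ?S \<times> UNIV" "r \<notin> ?B \<times> {True}" using SH BH r by auto
      then show ?thesis using False by (simp add: r update_def)
    qed
  qed
  also have "\<dots> = real (card ?S) - q * card ?S + p * q * card ?B"
    using int by (simp add: 1[symmetric] 2[symmetric] del: integral_indicator)
  finally show ?thesis .
qed

text \<open>On the good event a disagreement is repaired with probability \<open>q\<close> and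
  causes at most \<open>2 D\<close> new ones, each with probability \<open>p q\<close>. Otherwise
  the distance still grows by at most 1 in the mean, since one update touches one pair; so a bad
  event costs no more than its probability.\<close>

lemma expect_sym_diff_step_le:
  assumes X: "X \<in> states" and Y: "Y \<in> states"
    and D: "2 * p * D \<le> 1 - \<delta>" "0 \<le> \<delta>" "\<delta> \<le> 1"
    and good: "\<not> bad \<Longrightarrow> X \<subseteq> W \<and> Y \<subseteq> W \<and> W \<subseteq> H \<and> (\<forall>v. real (vdeg W v) \<le> D)"
  shows "expect rnd (\<lambda>r. real (card (sym_diff (upd r X) (upd r Y))))
     \<le> (1 - q * \<delta>) * card (sym_diff X Y) + of_bool bad"
proof -
  let ?d = "real (card (sym_diff X Y))" and ?b = "real (card (blocked_differently H X Y))"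
  note 1 = expect_sym_diff_step[OF X Y]
  show ?thesis
  proof (cases bad)
    case False
    have "?b \<le> 2 * D * ?d"
      using card_blocked_differently[OF H X Y] good[OF False] by blast
    then have "p * q * ?b \<le> p * q * (2 * D * ?d)" using p q by (intro mult_left_mono) auto
    also have "\<dots> = (q * ?d) * (2 * p * D)" by simp
    also have "\<dots> \<le> (q * ?d) * (1 - \<delta>)" using q D by (intro mult_left_mono) auto
    finally show ?thesis using 1 False by (simp add: algebra_simps)
  next
    case True
    have "q * ?b = prob sel (blocked_differently H X Y)"
      by (rule prob_sel[symmetric]) (auto simp: blocked_differently_def)
    then have "q * ?b \<le> 1" by simp
    moreover have "p * (q * ?b) \<le> 1 * (q * ?b)" using p q by (intro mult_right_mono) auto
    moreover have "(q * ?d) * \<delta> \<le> (q * ?d) * 1" using q D by (intro mult_left_mono) auto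
    ultimately show ?thesis using 1 True by (simp add: algebra_simps)
  qed
qed

end

section \<open>Domination by the stationary unconstrained dynamics, and the coalescence
  bounds\<close>

context triangle_free_dynamics
begin

lemma upd_states: "X \<in> states \<Longrightarrow> upd r X \<in> states"
  by (rule update_constrained[OF down_closed_triangle_free])

text \<open>The chain is coupled with the unconstrained dynamics \<open>W\<close>, started from its stationary
  law, and with the set \<open>U\<close> of pairs that were never selected. Since \<open>W\<close> dominates the two
  constrained chains on all the pairs outside \<open>U\<close>, their degrees are those of a random graph at most
  as soon as \<open>U\<close> is empty.\<close>

definition joint_update ::
    "nat set \<times> bool \<Rightarrow> (graph \<times> graph) \<times> graph \<times> graph \<Rightarrow> (graph \<times> graph) \<times> graph \<times> graph" where
  "joint_update r z = (coupled_map upd r (fst z),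
     update (\<lambda>_. True) H r (fst (snd z)), snd (snd z) - {fst r})"

definition joint_law :: "graph \<Rightarrow> graph \<Rightarrow> nat \<Rightarrow> ((graph \<times> graph) \<times> graph \<times> graph) pmf" where
  "joint_law x y t =
     bind_pmf (random_subset H p) (\<lambda>W. random_map_chain rnd joint_update t ((x, y), W, H))"

definition joint_inv :: "(graph \<times> graph) \<times> graph \<times> graph \<Rightarrow> bool" where
  "joint_inv z = (case z of ((X, Y), W, U) \<Rightarrow>
     X \<in> states \<and> Y \<in> states \<and> W \<subseteq> H \<and> U \<subseteq> H \<and> X - U \<subseteq> W \<and> Y - U \<subseteq> W)"

text \<open>Once a pair of \<open>H\<close> is selected it leaves \<open>U\<close>, and
  \<open>W\<close>, which never rejects, then contains it whenever a constrained copy does. A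
  selection outside \<open>H\<close> changes nothing because \<open>U \<subseteq> H\<close>.\<close>

lemma joint_inv_update:
  assumes "joint_inv z"
  shows "joint_inv (joint_update r z)"
proof -
  obtain X Y W U where z: "z = ((X, Y), W, U)" by (metis prod.collapse)
  have i: "X \<in> states" "Y \<in> states" "W \<subseteq> H" "U \<subseteq> H" "X - U \<subseteq> W" "Y - U \<subseteq> W"
    using assms by (auto simp: joint_inv_def z)
  have 1: "upd r X' - (U - {fst r}) \<subseteq> update (\<lambda>_. True) H r W" if "X' - U \<subseteq> W" for X'
    using that i(4) by (auto simp: update_def)
  have 2: "update (\<lambda>_. True) H r W \<subseteq> H" using i(3) by (auto simp: update_def)
  show ?thesis
    using upd_states i(1,2,4) 1[OF i(5)] 1[OF i(6)] 2
    by (auto simp: joint_inv_def z joint_update_def coupled_map_def)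
qed

lemma finite_joint_law: "finite (set_pmf (joint_law x y t))"
  unfolding joint_law_def
  by (simp add: finite_set_random_subset[OF finite_H] finite_set_random_map_chain[OF finite_rnd])

lemma joint_law_inv:
  assumes "x \<in> states" "y \<in> states" "z \<in> set_pmf (joint_law x y t)"
  shows "joint_inv z"
proof -
  obtain W where W: "W \<in> set_pmf (random_subset H p)"
    and z: "z \<in> set_pmf (random_map_chain rnd joint_update t ((x, y), W, H))"
    using assms(3) by (auto simp: joint_law_def)
  have "W \<subseteq> H" using W set_random_subset by blast
  then have "joint_inv ((x, y), W, H)" using assms by (auto simp: joint_inv_def constrained_def)
  with joint_inv_update show ?thesis by (rule random_map_chain_invariant[OF _ _ z])
qed

lemma joint_law_Suc:
  "joint_law x y (Suc t) = bind_pmf (joint_law x y t) (\<lambda>z. map_pmf (\<lambda>r. joint_update r z) rnd)"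
  by (simp add: joint_law_def bind_assoc_pmf)

lemma map_fst_joint_law: "map_pmf fst (joint_law x y t) = random_map_chain rnd (coupled_map upd) t (x, y)"
proof -
  have "map_pmf fst (random_map_chain rnd joint_update t ((x, y), W, H)) =
      random_map_chain rnd (coupled_map upd) t (x, y)" for W
    using map_random_map_chain[where h = fst and f = joint_update and g = "coupled_map upd"
        and R = rnd and x = "((x, y), W, H)"]
    by (simp add: joint_update_def)
  then show ?thesis by (simp add: joint_law_def map_bind_pmf)
qed

text \<open>\<open>W\<close> starts in equilibrium, so at every fixed time its degrees are those of
  a random subgraph of \<open>H\<close>, whatever the starting states \<open>x\<close> and
  \<open>y\<close> are.\<close>

lemma map_W_joint_law: "map_pmf (fst \<circ> snd) (joint_law x y t) = random_subset H p"
proof -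
  let ?f = "update (\<lambda>_. True) H"
  have "map_pmf (fst \<circ> snd) (random_map_chain rnd joint_update t ((x, y), W, H)) =
      random_map_chain rnd ?f t W" for W
    using map_random_map_chain[where h = "fst \<circ> snd" and f = joint_update and g = ?f
        and R = rnd and x = "((x, y), W, H)"]
    by (simp add: joint_update_def)
  then have "map_pmf (fst \<circ> snd) (joint_law x y t) = bind_pmf (random_subset H p) (random_map_chain rnd ?f t)"
    by (simp add: joint_law_def map_bind_pmf)
  also have "\<dots> = random_subset H p"
  proof (rule random_map_chain_stationary)
    have "down_closed (\<lambda>_::graph. True)" by (simp add: down_closed_def)
    from gibbs_stationary[OF finite_H p this, of sel]
    show "bind_pmf (random_subset H p) (\<lambda>x. map_pmf (\<lambda>r. ?f r x) rnd) = random_subset H p"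
      by (simp add: gibbs_True rnd_def)
  qed
  finally show ?thesis .
qed

lemma prob_untouched:
  assumes "e \<in> H"
  shows "prob (joint_law x y t) {z. e \<in> snd (snd z)} = (1 - q) ^ t"
proof (induction t)
  case 0
  have "joint_law x y 0 = map_pmf (\<lambda>W. ((x, y), W, H)) (random_subset H p)"
    by (simp add: joint_law_def map_pmf_def)
  then show ?case using assms by simp
next
  case (Suc t)
  have "prob (joint_law x y (Suc t)) {z. e \<in> snd (snd z)} =
      expect (joint_law x y t) (\<lambda>z. prob (map_pmf (\<lambda>r. joint_update r z) rnd) {z. e \<in> snd (snd z)})"
    unfolding joint_law_Suc by (rule prob_bind) (use finite_joint_law finite_rnd in auto)
  also have "\<dots> = expect (joint_law x y t) (\<lambda>z. (1 - q) * indicator {z. e \<in> snd (snd z)} z)"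
  proof (rule expect_cong)
    fix z :: "(graph \<times> graph) \<times> graph \<times> graph"
    have "prob (map_pmf (\<lambda>r. joint_update r z) rnd) {z. e \<in> snd (snd z)} =
        prob rnd ((\<lambda>r. joint_update r z) -` {z. e \<in> snd (snd z)})" by simp
    also have "(\<lambda>r. joint_update r z) -` {z. e \<in> snd (snd z)} =
        (if e \<in> snd (snd z) then fst -` (- {e}) else {})"
      by (auto simp: joint_update_def)
    also have "prob rnd \<dots> = (if e \<in> snd (snd z) then prob (map_pmf fst rnd) (- {e}) else 0)"
      by simp
    also have "prob (map_pmf fst rnd) (- {e}) = 1 - q"
      using measure_pmf.prob_compl[of "{e}" sel] assms sel(2)
      by (simp add: rnd_def map_fst_pair_pmf Compl_eq_Diff_UNIV measure_pmf_single)
    finally show "prob (map_pmf (\<lambda>r. joint_update r z) rnd) {z. e \<in> snd (snd z)} =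
        (1 - q) * indicator {z. e \<in> snd (snd z)} z" by simp
  qed
  also have "\<dots> = (1 - q) * prob (joint_law x y t) {z. e \<in> snd (snd z)}" by simp
  finally show ?case using Suc by simp
qed

text \<open>The coupon collector's bound, a union over the pairs of \<open>H\<close>.\<close>

lemma prob_some_untouched:
  assumes "x \<in> states" "y \<in> states"
  shows "prob (joint_law x y t) {z. snd (snd z) \<noteq> {}} \<le> card H * (1 - q) ^ t"
proof -
  have "prob (joint_law x y t) {z. snd (snd z) \<noteq> {}} =
      prob (joint_law x y t) (set_pmf (joint_law x y t) \<inter> {z. snd (snd z) \<noteq> {}})"
    by (subst Int_commute, rule measure_Int_set_pmf[symmetric])
  also have "\<dots> \<le> prob (joint_law x y t) (\<Union>e\<in>H. {z. e \<in> snd (snd z)})"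
  proof (rule measure_pmf.finite_measure_mono)
    show "set_pmf (joint_law x y t) \<inter> {z. snd (snd z) \<noteq> {}} \<subseteq> (\<Union>e\<in>H. {z. e \<in> snd (snd z)})"
      using joint_law_inv[OF assms] by (fastforce simp: joint_inv_def split: prod.splits)
  qed simp
  also have "\<dots> \<le> (\<Sum>e\<in>H. prob (joint_law x y t) {z. e \<in> snd (snd z)})"
    by (rule measure_pmf.finite_measure_subadditive_finite[OF finite_H]) simp
  also have "\<dots> = card H * (1 - q) ^ t" by (simp add: prob_untouched)
  finally show ?thesis .
qed

definition high_degree_prob :: "real \<Rightarrow> real" where
  "high_degree_prob D = prob (random_subset H p) {W. \<exists>v. D < real (vdeg W v)}"

abbreviation disagreement :: "(graph \<times> graph) \<times> graph \<times> graph \<Rightarrow> real" where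
  "disagreement z \<equiv> real (card (sym_diff (fst (fst z)) (snd (fst z))))"

text \<open>The bad event of the step is that some pair is still unselected or that \<open>W\<close>
  has a vertex of degree above \<open>D\<close>. Outside it, \<open>W\<close> is the supergraph in
  which the degrees are counted.\<close>

lemma expect_joint_Suc:
  assumes xy: "x \<in> states" "y \<in> states"
    and D: "2 * p * D \<le> 1 - \<delta>" "0 \<le> \<delta>" "\<delta> \<le> 1"
  shows "expect (joint_law x y (Suc t)) disagreement \<le>
    (1 - q * \<delta>) * expect (joint_law x y t) disagreement
    + (card H * (1 - q) ^ t + high_degree_prob D)"
proof -
  let ?d = "\<lambda>z :: (graph \<times> graph) \<times> graph \<times> graph. disagreement z"
  let ?L = "joint_law x y t"
  let ?U = "{z :: (graph \<times> graph) \<times> graph \<times> graph. snd (snd z) \<noteq> {}}"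
  let ?V = "{z :: (graph \<times> graph) \<times> graph \<times> graph. \<exists>v. D < real (vdeg (fst (snd z)) v)}"
  have int: "integrable (measure_pmf ?L) f" for f :: "_ \<Rightarrow> real"
    by (rule integrable_measure_pmf_finite[OF finite_joint_law])
  have "expect (joint_law x y (Suc t)) ?d = expect ?L (\<lambda>z. expect (map_pmf (\<lambda>r. joint_update r z) rnd) ?d)"
    unfolding joint_law_Suc by (rule expect_bind) (use finite_joint_law finite_rnd in auto)
  also have "\<dots> \<le> expect ?L (\<lambda>z. (1 - q * \<delta>) * ?d z + indicator (?U \<union> ?V) z)"
  proof (rule expect_mono[OF finite_joint_law])
    fix z assume "z \<in> set_pmf ?L"
    then have inv: "joint_inv z" by (rule joint_law_inv[OF xy])
    obtain X Y W U where z: "z = ((X, Y), W, U)" by (metis prod.collapse)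
    have i: "X \<in> states" "Y \<in> states" "W \<subseteq> H" "U \<subseteq> H" "X - U \<subseteq> W" "Y - U \<subseteq> W"
      using inv by (auto simp: joint_inv_def z)
    have "expect (map_pmf (\<lambda>r. joint_update r z) rnd) ?d =
        expect rnd (\<lambda>r. real (card (sym_diff (upd r X) (upd r Y))))"
      by (simp add: joint_update_def coupled_map_def z)
    also have "\<dots> \<le> (1 - q * \<delta>) * card (sym_diff X Y) + of_bool (z \<in> ?U \<union> ?V)"
      by (rule expect_sym_diff_step_le[OF i(1,2) D, where W = W])
         (use i(3,5,6) in \<open>auto simp: z not_less\<close>)
    finally show "expect (map_pmf (\<lambda>r. joint_update r z) rnd) ?d \<le>
        (1 - q * \<delta>) * ?d z + indicator (?U \<union> ?V) z"
      by (simp add: z indicator_def of_bool_def)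
  qed
  also have "\<dots> = (1 - q * \<delta>) * expect ?L ?d + prob ?L (?U \<union> ?V)"
    using int by simp
  also have "prob ?L (?U \<union> ?V) \<le> prob ?L ?U + prob ?L ?V"
    by (rule measure_subadditive) auto
  also have "prob ?L ?V = high_degree_prob D"
  proof -
    have "?V = (fst \<circ> snd) -` {W. \<exists>v. D < real (vdeg W v)}" by auto
    then have "prob ?L ?V = prob (map_pmf (fst \<circ> snd) ?L) {W. \<exists>v. D < real (vdeg W v)}"
      by (simp only: measure_map_pmf)
    then show ?thesis by (simp only: map_W_joint_law high_degree_prob_def)
  qed
  also note prob_some_untouched[OF xy, of t]
  finally show ?thesis by simp
qed

text \<open>Markov's inequality for a distance with integer values.\<close>

lemma apart_prob_le_expect:
  assumes "x \<in> states" "y \<in> states"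
  shows "apart_prob rnd upd t x y \<le>
    expect (joint_law x y t) disagreement"
proof -
  have "apart_prob rnd upd t x y = prob (map_pmf fst (joint_law x y t)) apart"
    by (simp only: apart_prob_def map_fst_joint_law)
  also have "\<dots> = expect (joint_law x y t) (indicator (fst -` apart))" by simp
  also have "\<dots> \<le> expect (joint_law x y t) disagreement"
  proof (rule expect_mono[OF finite_joint_law])
    fix z assume "z \<in> set_pmf (joint_law x y t)"
    then have "joint_inv z" by (rule joint_law_inv[OF assms])
    then have fin: "finite (sym_diff (fst (fst z)) (snd (fst z)))"
      using finite_state by (auto simp: joint_inv_def split: prod.splits)
    show "indicator (fst -` apart) z \<le> disagreement z"
    proof (cases "fst (fst z) = snd (fst z)")
      case False
      then have "sym_diff (fst (fst z)) (snd (fst z)) \<noteq> {}" by blast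
      then have "card (sym_diff (fst (fst z)) (snd (fst z))) \<noteq> 0" using fin by (simp only: card_eq_0_iff) simp
      then have "1 \<le> disagreement z" by linarith
      moreover have "indicator (fst -` apart) z \<le> (1 :: real)" by (simp add: indicator_def)
      ultimately show ?thesis by (rule order_trans[rotated])
    qed (simp add: apart_def)
  qed
  finally show ?thesis .
qed

text \<open>Burn-in followed by contraction: after the first \<open>t\<close> steps the distance is
  bounded only by \<open>card H\<close>; in each of the next \<open>s\<close> it contracts, and as
  the factor is at most 1 the additive errors just accumulate.\<close>

lemma apart_prob_bound:
  assumes xy: "x \<in> states" "y \<in> states"
    and D: "2 * p * D \<le> 1 - \<delta>" "0 \<le> \<delta>" "\<delta> \<le> 1"
  shows "apart_prob rnd upd (t + s) x y \<le>
    (1 - q * \<delta>) ^ s * card H + s * (card H * (1 - q) ^ t + high_degree_prob D)"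
proof -
  let ?a = "\<lambda>t. expect (joint_law x y t) disagreement"
  let ?\<beta> = "card H * (1 - q) ^ t + high_degree_prob D"
  have q\<delta>: "0 \<le> 1 - q * \<delta>" "1 - q * \<delta> \<le> 1" using q D mult_le_one[of q \<delta>] by auto
  have "?a (t + s) \<le> (1 - q * \<delta>) ^ s * card H + s * ?\<beta>"
  proof (induction s)
    case 0
    have "?a t \<le> expect (joint_law x y t) (\<lambda>z. real (card H))"
    proof (rule expect_mono[OF finite_joint_law])
      fix z assume "z \<in> set_pmf (joint_law x y t)"
      then have "joint_inv z" by (rule joint_law_inv[OF xy])
      then have "sym_diff (fst (fst z)) (snd (fst z)) \<subseteq> H"
        by (auto simp: joint_inv_def constrained_def split: prod.splits)
      then show "disagreement z \<le> real (card H)"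
        using card_mono[OF finite_H] by simp
    qed
    then show ?case by simp
  next
    case (Suc s)
    have 1: "?a (t + Suc s) \<le> (1 - q * \<delta>) * ?a (t + s) + (card H * (1 - q) ^ (t + s) + high_degree_prob D)"
      using expect_joint_Suc[OF xy D, of "t + s"] by simp
    have 2: "card H * (1 - q) ^ (t + s) \<le> card H * (1 - q) ^ t"
      using q by (intro mult_left_mono power_decreasing) auto
    have 3: "(1 - q * \<delta>) * ?a (t + s) \<le> (1 - q * \<delta>) * ((1 - q * \<delta>) ^ s * card H + s * ?\<beta>)"
      by (rule mult_left_mono[OF Suc q\<delta>(1)])
    have "0 \<le> s * ?\<beta>" using q by (simp add: high_degree_prob_def)
    from mult_right_mono[OF q\<delta>(2) this]
    have 4: "(1 - q * \<delta>) * ((1 - q * \<delta>) ^ s * card H + s * ?\<beta>) \<le> (1 - q * \<delta>) ^ Suc s * card H + s * ?\<beta>"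
      by (simp add: distrib_left)
    have 5: "real (Suc s) * ?\<beta> = s * ?\<beta> + ?\<beta>" by (simp add: distrib_right)
    show ?case unfolding 5 using 1 2 3 4 by linarith
  qed
  then show ?thesis using apart_prob_le_expect[OF xy, of "t + s"] by linarith
qed

text \<open>A lucky run removes the pairs of the symmetric difference one after another; each
  removal has probability \<open>q (1 - p)\<close> and creates no disagreement. The chance is tiny,
  but it does not depend on any degree bound.\<close>

lemma apart_prob_few_steps:
  assumes "x \<in> states" "y \<in> states" "card (sym_diff x y) \<le> k"
  shows "apart_prob rnd upd k x y \<le> 1 - (q * (1 - p)) ^ k"
  using assms
proof (induction k arbitrary: x y)
  case 0
  then have "sym_diff x y = {}" using finite_state by simp
  then have "x = y" by blast
  then show ?case by simp
next
  case (Suc k)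
  let ?a = "q * (1 - p)"
  have a: "0 \<le> ?a" "?a \<le> 1" using p q mult_le_one[of q "1 - p"] by auto
  show ?case
  proof (cases "x = y")
    case True
    then show ?thesis using a power_le_one[OF a] by (simp del: power_Suc)
  next
    case False
    then obtain e where e: "e \<in> sym_diff x y" by blast
    have eH: "e \<in> H" using e Suc.prems by (auto simp: constrained_def)
    let ?C = "random_map_chain rnd (coupled_map upd)"
    have "apart_prob rnd upd (Suc k) x y = prob (bind_pmf (?C 1 (x, y)) (?C k)) apart"
      unfolding apart_prob_def by (subst random_map_chain_add[symmetric]) simp
    also have "\<dots> = expect rnd (\<lambda>r. apart_prob rnd upd k (upd r x) (upd r y))"
      unfolding apart_prob_def
      by (subst prob_bind) (use finite_rnd finite_set_random_map_chain[OF finite_rnd]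
         in \<open>simp_all add: coupled_map_def bind_return_pmf\<close>)
    \<comment> \<open>Every outcome other than the removal of \<open>e\<close> is bounded by
      1.\<close>
    also have "\<dots> \<le> expect rnd (\<lambda>r. 1 - ?a ^ k * indicator {(e, False)} r)"
    proof (rule expect_mono[OF finite_rnd])
      fix r
      show "apart_prob rnd upd k (upd r x) (upd r y) \<le> 1 - ?a ^ k * indicator {(e, False)} r"
      proof (cases "r = (e, False)")
        case True
        have "sym_diff (upd r x) (upd r y) \<subseteq> sym_diff x y - {e}"
          using eH by (auto simp: True update_def)
        then have "card (sym_diff (upd r x) (upd r y)) \<le> card (sym_diff x y - {e})"
          using Suc.prems finite_state by (intro card_mono) auto
        also have "\<dots> \<le> k" using e Suc.prems finite_state by (simp add: card_Diff_singleton del: card_Diff_insert)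
        finally show ?thesis using Suc.IH[OF upd_states upd_states] Suc.prems True by simp
      qed (simp add: apart_prob_le_1)
    qed
    also have "\<dots> = 1 - ?a ^ k * pmf rnd (e, False)"
      by (subst Bochner_Integration.integral_diff)
         (auto simp: measure_pmf_single intro: integrable_measure_pmf_finite finite_rnd)
    also have "pmf rnd (e, False) = ?a" using p sel(2)[OF eH] by (simp add: rnd_def pmf_pair)
    finally show ?thesis by (simp add: mult.commute)
  qed
qed

end

section \<open>Degrees in a random graph\<close>

lemma card_pairs_at_vertex:
  assumes "H \<subseteq> pairs n"
  shows "card {e \<in> H. v \<in> e} \<le> n"
proof -
  have "{e \<in> H. v \<in> e} \<subseteq> (\<lambda>w. {v, w}) ` {1..n}"
  proof
    fix e assume e: "e \<in> {e \<in> H. v \<in> e}"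
    then have "e \<in> pairs n" using assms by blast
    then obtain u w where uw: "e = {u, w}" "u \<noteq> w" "u \<in> {1..n}" "w \<in> {1..n}" by (rule pairsE)
    then have "e = {v, w} \<or> e = {v, u}" using e by auto
    then show "e \<in> (\<lambda>w. {v, w}) ` {1..n}" using uw by blast
  qed
  then have "card {e \<in> H. v \<in> e} \<le> card {1..n}"
    by (rule surj_card_le[rotated]) simp
  then show ?thesis by simp
qed

context triangle_free_dynamics
begin

text \<open>At most \<open>n\<close> independent edges meet \<open>v\<close>;
  \<open>1 + x \<le> exp x\<close> replaces their moment generating function by that of a Poisson
  variable of mean \<open>n p\<close>.\<close>

lemma expect_exp_degree:
  fixes \<theta> :: real
  assumes "0 \<le> \<theta>"
  shows "expect (random_subset H p) (\<lambda>W. exp (\<theta> * vdeg W v)) \<le> exp (n * p * (exp \<theta> - 1))"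
proof -
  let ?g = "\<lambda>e b. if v \<in> e \<and> b then exp \<theta> else 1"
  have pt: "exp (\<theta> * vdeg {e \<in> H. f e} v) = (\<Prod>e\<in>H. ?g e (f e))" for f
  proof -
    have "(\<Prod>e\<in>H. ?g e (f e)) = (\<Prod>e\<in>{e\<in>H. v \<in> e \<and> f e}. exp \<theta>)"
      by (rule prod.inter_filter[OF finite_H, symmetric])
    also have "\<dots> = exp \<theta> ^ card {e\<in>H. v \<in> e \<and> f e}" by simp
    also have "{e\<in>H. v \<in> e \<and> f e} = {e \<in> {e \<in> H. f e}. v \<in> e}" by auto
    finally show ?thesis by (simp add: vdeg_def exp_of_nat_mult[symmetric] mult.commute)
  qed
  have "expect (random_subset H p) (\<lambda>W. exp (\<theta> * vdeg W v)) =
      expect (Pi_pmf H False (\<lambda>_. bernoulli_pmf p)) (\<lambda>f. \<Prod>e\<in>H. ?g e (f e))"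
    by (simp add: random_subset_def pt)
  also have "\<dots> = (\<Prod>e\<in>H. expect (bernoulli_pmf p) (?g e))"
    by (rule expectation_prod_Pi_pmf) (auto intro: finite_H integrable_measure_pmf_finite)
  also have "\<dots> = (\<Prod>e\<in>H. if v \<in> e then 1 + p * (exp \<theta> - 1) else 1)"
    using p by (intro prod.cong) (auto simp: algebra_simps)
  also have "\<dots> = (1 + p * (exp \<theta> - 1)) ^ card {e \<in> H. v \<in> e}"
    using finite_H by (simp add: prod.inter_filter[symmetric])
  also have "\<dots> \<le> exp (p * (exp \<theta> - 1)) ^ card {e \<in> H. v \<in> e}"
    using p assms by (intro power_mono exp_ge_add_one_self) auto
  also have "\<dots> \<le> exp (p * (exp \<theta> - 1)) ^ n"
    using p assms card_pairs_at_vertex[OF H] by (intro power_increasing) auto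
  also have "\<dots> = exp (n * p * (exp \<theta> - 1))" by (simp add: exp_of_nat_mult[symmetric] mult.assoc)
  finally show ?thesis .
qed

text \<open>Chernoff's method at one vertex, then a union over the vertices.\<close>

lemma high_degree_prob_le:
  assumes "0 \<le> \<theta>" "0 \<le> D"
  shows "high_degree_prob D \<le> n * exp (n * p * (exp \<theta> - 1) - \<theta> * D)"
proof -
  let ?M = "random_subset H p"
  have fin: "finite (set_pmf ?M)" by (rule finite_set_random_subset[OF finite_H])
  have one: "prob ?M {W. D < real (vdeg W v)} \<le> exp (n * p * (exp \<theta> - 1) - \<theta> * D)" for v
  proof -
    have "prob ?M {W. D < real (vdeg W v)} = expect ?M (indicator {W. D < real (vdeg W v)})" by simp
    also have "\<dots> \<le> expect ?M (\<lambda>W. exp (- (\<theta> * D)) * exp (\<theta> * vdeg W v))"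
    proof (rule expect_mono[OF fin])
      fix W
      show "indicator {W. D < real (vdeg W v)} W \<le> exp (- (\<theta> * D)) * exp (\<theta> * vdeg W v)"
        using assms mult_left_mono[of D "real (vdeg W v)" \<theta>]
        by (simp add: indicator_def exp_add[symmetric])
    qed
    also have "\<dots> = exp (- (\<theta> * D)) * expect ?M (\<lambda>W. exp (\<theta> * vdeg W v))" by simp
    also have "\<dots> \<le> exp (- (\<theta> * D)) * exp (n * p * (exp \<theta> - 1))"
      using expect_exp_degree[OF assms(1)] by (intro mult_left_mono) auto
    finally show ?thesis by (simp add: exp_add[symmetric])
  qed
  have "high_degree_prob D = prob ?M ({W. \<exists>v. D < real (vdeg W v)} \<inter> set_pmf ?M)"
    unfolding high_degree_prob_def by (rule measure_Int_set_pmf[symmetric])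
  also have "\<dots> \<le> prob ?M (\<Union>v\<in>{1..n}. {W. D < real (vdeg W v)})"
  proof (rule measure_pmf.finite_measure_mono)
    show "{W. \<exists>v. D < real (vdeg W v)} \<inter> set_pmf ?M \<subseteq> (\<Union>v\<in>{1..n}. {W. D < real (vdeg W v)})"
    proof
      fix W assume "W \<in> {W. \<exists>v. D < real (vdeg W v)} \<inter> set_pmf ?M"
      then obtain v where v: "D < real (vdeg W v)" and "W \<subseteq> H"
        using set_random_subset[of H p] by blast
      then have W: "W \<subseteq> pairs n" using H by blast
      \<comment> \<open>A vertex outside \<open>{1..n}\<close> has degree 0, which does not exceed
        \<open>D\<close>; hence \<open>n\<close> terms suffice.\<close>
      have "vdeg W v \<noteq> 0" using v assms(2) by linarith
      then have "{e \<in> W. v \<in> e} \<noteq> {}" unfolding vdeg_def by (metis card.empty)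
      then have "v \<in> {1..n}" using W unfolding pairs_def by blast
      then show "W \<in> (\<Union>v\<in>{1..n}. {W. D < real (vdeg W v)})" using v by blast
    qed
  qed simp
  also have "\<dots> \<le> (\<Sum>v\<in>{1..n}. prob ?M {W. D < real (vdeg W v)})"
    by (rule measure_pmf.finite_measure_subadditive_finite) auto
  also have "\<dots> \<le> (\<Sum>v\<in>{1..n}. exp (n * p * (exp \<theta> - 1) - \<theta> * D))" by (intro sum_mono one)
  finally show ?thesis by simp
qed

lemma card_H_le: "real (card H) \<le> real n ^ 2"
proof -
  have "card H \<le> n choose 2" using card_mono[OF finite_pairs H] by (simp add: card_pairs)
  also have "\<dots> \<le> n * (n - 1)" by (simp add: choose_two)
  also have "\<dots> \<le> n ^ 2" by (simp add: power2_eq_square)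
  finally show ?thesis by (metis of_nat_le_iff of_nat_power)
qed

text \<open>For \<open>n\<close> up to a threshold \<open>m\<close> the bound depends on
  \<open>m\<close> only: a block of \<open>m ^ 2\<close> steps is long enough to remove every
  disagreement, and \<open>p \<le> 1 / 2\<close> gives
  \<open>q (1 - p) \<ge> 1 / m ^ 2\<close>.\<close>

lemma apart_prob_small:
  assumes xy: "x \<in> states" "y \<in> states"
    and qn: "2 / real n ^ 2 \<le> q" and m: "n \<le> m" "2 \<le> n" and p2: "p \<le> 1/2"
  shows "apart_prob rnd upd (j * m ^ 2) x y \<le> (1 - (1 / real m ^ 2) ^ m ^ 2) ^ j"
proof (rule apart_prob_power[where I = states])
  fix x y assume xy: "x \<in> states" "y \<in> states"
  have "sym_diff x y \<subseteq> H" using xy by (auto simp: constrained_def)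
  then have "card (sym_diff x y) \<le> card H" by (rule card_mono[OF finite_H])
  also have "\<dots> \<le> n ^ 2" using card_H_le by (metis of_nat_le_iff of_nat_power)
  also have "\<dots> \<le> m ^ 2" using m by (intro power_mono) auto
  finally have "apart_prob rnd upd (m ^ 2) x y \<le> 1 - (q * (1 - p)) ^ m ^ 2"
    by (rule apart_prob_few_steps[OF xy])
  moreover have "(1 / real m ^ 2) ^ m ^ 2 \<le> (q * (1 - p)) ^ m ^ 2"
  proof (rule power_mono)
    have "real n ^ 2 \<le> real m ^ 2" using m by (intro power_mono) auto
    then have "1 / real m ^ 2 \<le> (2 / real n ^ 2) * (1 / 2)" using m by (simp add: frac_le)
    also have "\<dots> \<le> q * (1 - p)" using qn p2 q by (intro mult_mono) auto
    finally show "1 / real m ^ 2 \<le> q * (1 - p)" .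
  qed simp
  ultimately show "apart_prob rnd upd (m ^ 2) x y \<le> 1 - (1 / real m ^ 2) ^ m ^ 2" by linarith
qed (use finite_rnd upd_states xy in auto)

lemma apart_prob_large:
  fixes c \<delta> \<theta> A :: real
  assumes xy: "x \<in> states" "y \<in> states"
    and qn: "2 / real n ^ 2 \<le> q" and n: "2 \<le> n"
    and c: "1 / 2 \<le> c" "2 * c\<^sup>2 * (1 + 2 * \<theta>) = 1 - \<delta>" "0 \<le> \<theta>" "\<theta> \<le> 1" "0 < \<delta>" "\<delta> \<le> 1"
    and pc: "p \<le> c / sqrt n" and A: "A = 4 / \<delta>" and s: "A * real n ^ 2 * ln n \<le> s" "s \<le> A * real n ^ 2 * ln n + 1"
  shows "apart_prob rnd upd (s + s) x y \<le> real n ^ 2 * exp (- 8 * ln n) +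
    (A * real n ^ 2 * ln n + 1) * (real n ^ 2 * exp (- 8 * ln n) + n * exp (- (c * \<theta>\<^sup>2) * sqrt n))"
proof -
  \<comment> \<open>The mean degree is at most \<open>c sqrt n\<close>, and \<open>D\<close> exceeds
    this by the factor \<open>1 + 2 \<theta>\<close>. The same \<open>\<theta>\<close> is the
    Chernoff parameter: \<open>\<theta> + \<theta>^2 - \<theta> (1 + 2 \<theta>) = -
    \<theta>^2\<close>.\<close>
  define D where "D = (1 + 2 * \<theta>) * c * sqrt n"
  have D0: "0 \<le> D" using c by (simp add: D_def)
  have n0: "0 < sqrt n" "0 < real n" "0 \<le> ln (real n)" using n by auto
  have "2 * p * D \<le> 2 * (c / sqrt n) * D" using pc D0 by (intro mult_right_mono mult_left_mono) auto
  also have "\<dots> = 2 * c\<^sup>2 * (1 + 2 * \<theta>)" using n0 by (simp add: D_def power2_eq_square)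
  also note c(2)
  finally have D: "2 * p * D \<le> 1 - \<delta>" .
  have ex: "n * p * (exp \<theta> - 1) - \<theta> * D \<le> - (c * \<theta>\<^sup>2) * sqrt n"
  proof -
    have "exp \<theta> \<le> 1 + \<theta> + \<theta>\<^sup>2" by (rule exp_bound[OF c(3,4)])
    then have "n * p * (exp \<theta> - 1) \<le> n * p * (\<theta> + \<theta>\<^sup>2)" using p by (intro mult_left_mono) auto
    also have "\<dots> \<le> n * (c / sqrt n) * (\<theta> + \<theta>\<^sup>2)" using pc c by (intro mult_right_mono mult_left_mono) auto
    also have "n * (c / sqrt n) = c * (n / sqrt n)" by simp
    also have "n / sqrt n = sqrt n" using n0 by (intro real_div_sqrt) simp
    finally show ?thesis by (simp add: D_def algebra_simps power2_eq_square)
  qed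
  have "high_degree_prob D \<le> n * exp (n * p * (exp \<theta> - 1) - \<theta> * D)"
    by (rule high_degree_prob_le[OF c(3) D0])
  also have "\<dots> \<le> n * exp (- (c * \<theta>\<^sup>2) * sqrt n)" using ex by (intro mult_left_mono) auto
  finally have hd: "high_degree_prob D \<le> n * exp (- (c * \<theta>\<^sup>2) * sqrt n)" .
  \<comment> \<open>With \<open>q \<ge> 2 / n ^ 2\<close> and \<open>A = 4 / \<delta>\<close>,
    \<open>s\<close> steps make \<open>\<delta> q s\<close> at least \<open>8 ln n\<close>. The
    resulting \<open>n ^ (-8)\<close> beats the factor of order \<open>n ^ 4 ln n\<close> in the
    final bound.\<close>
  have qs: "2 * A * ln n \<le> q * s"
  proof -
    have "2 * A * ln n = (2 / real n ^ 2) * (A * real n ^ 2 * ln n)" using n0 by simp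
    also have "\<dots> \<le> q * s" using qn s(1) q n0 A c by (intro mult_mono) auto
    finally show ?thesis .
  qed
  have pw: "(1 - a) ^ s \<le> exp (- (a * s))" if "0 \<le> a" "a \<le> 1" for a :: real
  proof -
    have "(1 - a) ^ s \<le> exp (- a) ^ s" using that exp_ge_add_one_self[of "- a"] by (intro power_mono) auto
    also have "\<dots> = exp (- (a * s))" by (simp add: exp_of_nat_mult[symmetric] mult.commute)
    finally show ?thesis .
  qed
  have 1: "(1 - q * \<delta>) ^ s \<le> exp (- 8 * ln n)"
  proof -
    have "(1 - q * \<delta>) ^ s \<le> exp (- (q * \<delta> * s))" using q c mult_le_one[of q \<delta>] by (intro pw) auto
    also have "8 * ln n = \<delta> * (2 * A * ln n)" using A c by simp
    have "8 * ln n \<le> \<delta> * (q * s)" using mult_left_mono[OF qs, of \<delta>] A c by simp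
    then have "exp (- (q * \<delta> * s)) \<le> exp (- 8 * ln n)" by (simp add: mult_ac)
    finally show ?thesis .
  qed
  have 2: "(1 - q) ^ s \<le> exp (- 8 * ln n)"
  proof -
    have "4 \<le> A" using c by (simp add: A le_divide_eq)
    then have "8 * ln n \<le> 2 * A * ln n" using n0 by (intro mult_right_mono) auto
    then have "exp (- (q * s)) \<le> exp (- 8 * ln n)" using qs by simp
    then show ?thesis using pw[of q] q by linarith
  qed
  have "apart_prob rnd upd (s + s) x y \<le>
      (1 - q * \<delta>) ^ s * card H + s * (card H * (1 - q) ^ s + high_degree_prob D)"
    by (rule apart_prob_bound[OF xy D]) (use c in auto)
  also have "\<dots> \<le> exp (- 8 * ln n) * real n ^ 2 +
      (A * real n ^ 2 * ln n + 1) * (real n ^ 2 * exp (- 8 * ln n) + n * exp (- (c * \<theta>\<^sup>2) * sqrt n))"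
  proof (intro add_mono mult_mono card_H_le 1 2 s hd)
    show "0 \<le> A * real n ^ 2 * ln n + 1" using A c n0 by simp
    show "0 \<le> real (card H) * (1 - q) ^ s + high_degree_prob D" using q by (simp add: high_degree_prob_def)
  qed (use q in auto)
  finally show ?thesis by (simp add: mult.commute)
qed

end

section \<open>A mixing constant uniform in \<open>n\<close>, \<open>p\<close>, the host graph and
  the selection law\<close>

text \<open>Lets the 1 lost in a rounding be absorbed in the constant in front of
  \<open>n ^ 2 ln n\<close>.\<close>

lemma square_ln_ge_1:
  assumes "2 \<le> n"
  shows "1 \<le> real n ^ 2 * ln n"
proof -
  have "2 ^ 2 \<le> real n ^ 2" using assms by (intro power_mono) auto
  moreover have "ln 2 \<le> ln (real n)" using assms by simp
  moreover have "1 / 2 \<le> ln (2 :: real)" using ln2_ge_two_thirds by linarith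
  ultimately have "4 * (1 / 2) \<le> real n ^ 2 * ln n" by (intro mult_mono) auto
  then show ?thesis by simp
qed

text \<open>The constant comes before all the other data: the estimator applies it to many host
  graphs, and there are two selection laws. The level \<open>1 / 8\<close> lies strictly below the
  \<open>1 / 4\<close> of the mixing time.\<close>

definition mixing_constant :: "real \<Rightarrow> real \<Rightarrow> bool" where
  "mixing_constant c C \<longleftrightarrow> 0 < C \<and> (\<forall>n H p q sel x y t. triangle_free_dynamics n H p q sel \<longrightarrow>
     2 \<le> n \<longrightarrow> p \<le> c * real n powr (-1/2) \<longrightarrow> 2 / real n ^ 2 \<le> q \<longrightarrow>
     x \<in> constrained triangle_free H \<longrightarrow> y \<in> constrained triangle_free H \<longrightarrow> C * real n ^ 2 * ln n \<le> real t \<longrightarrow>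
     apart_prob (triangle_free_dynamics.rnd p sel) (update triangle_free H) t x y \<le> 1 / 8)"

lemma mixing_constantD:
  assumes "mixing_constant c C" "triangle_free_dynamics n H p q sel" "2 \<le> n" "p \<le> c * real n powr (-1/2)"
    "2 / real n ^ 2 \<le> q" "x \<in> constrained triangle_free H" "y \<in> constrained triangle_free H"
    "C * real n ^ 2 * ln n \<le> real t"
  shows "apart_prob (triangle_free_dynamics.rnd p sel) (update triangle_free H) t x y \<le> 1 / 8"
  using assms unfolding mixing_constant_def by blast

theorem triangle_free_mixing:
  fixes c :: real
  assumes c: "c < 1 / sqrt 2"
  obtains C where "mixing_constant c C"
proof -
  \<comment> \<open>\<open>c\<close> may be small or negative; raising it to at least
    \<open>1 / 2\<close> keeps \<open>\<theta>\<close> and \<open>\<delta>\<close> at most 1. Half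
    of the gap \<open>1 - 2 c'^2\<close> is given to the degree margin, the other half is
    \<open>\<delta>\<close>.\<close>
  define c' where "c' = max c (1 / 2)"
  define \<delta> where "\<delta> = 1 / 2 - c'\<^sup>2"
  define \<theta> where "\<theta> = (1 / (2 * c'\<^sup>2) - 1) / 4"
  define A where "A = 4 / \<delta>"
  have c': "1 / 2 \<le> c'" "c \<le> c'" "c' < 1 / sqrt 2"
  proof -
    have "1 / 2 < 1 / sqrt 2" using sqrt2_less_2 by (simp add: field_simps)
    then show "c' < 1 / sqrt 2" using c by (simp add: c'_def)
  qed (auto simp: c'_def)
  have "c'\<^sup>2 < (1 / sqrt 2)\<^sup>2" using c' by (intro power_strict_mono) auto
  then have c2: "c'\<^sup>2 < 1 / 2" by (simp add: power_divide)
  have "(1 / 2)\<^sup>2 \<le> c'\<^sup>2" using c' by (intro power_mono) auto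
  then have c4: "1 / 4 \<le> c'\<^sup>2" by (simp add: power_divide)
  have \<delta>: "0 < \<delta>" "\<delta> \<le> 1" using c2 c4 by (simp_all add: \<delta>_def)
  have "1 < 1 / (2 * c'\<^sup>2)" "1 / (2 * c'\<^sup>2) \<le> 2"
    using c2 c4 c'(1) by (simp_all add: less_divide_eq divide_le_eq)
  then have \<theta>: "0 < \<theta>" "\<theta> \<le> 1" by (simp_all add: \<theta>_def)
  have c\<theta>: "2 * c'\<^sup>2 * (1 + 2 * \<theta>) = 1 - \<delta>"
    using c'(1) by (simp add: \<theta>_def \<delta>_def field_simps)
  have A: "0 < A" using \<delta> by (simp add: A_def)
  define \<kappa> where "\<kappa> = c' * \<theta>\<^sup>2"
  have \<kappa>: "0 < \<kappa>" using c' \<theta> by (simp add: \<kappa>_def)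
  define g where "g = (\<lambda>n::nat. real n ^ 2 * exp (- 8 * ln n) +
    (A * real n ^ 2 * ln n + 1) * (real n ^ 2 * exp (- 8 * ln n) + n * exp (- \<kappa> * sqrt n)))"
  have "g \<longlonglongrightarrow> 0" unfolding g_def using A \<kappa> by real_asymp
  then have "eventually (\<lambda>n. g n < 1 / 8) sequentially" by (rule order_tendstoD) simp
  then obtain m0 where m0: "\<And>n. m0 \<le> n \<Longrightarrow> g n < 1 / 8" unfolding eventually_sequentially by blast
  define m where "m = max m0 2"
  define b where "b = 1 - (1 / real m ^ 2) ^ m ^ 2"
  have b: "0 \<le> b" "b < 1" by (simp_all add: b_def m_def power_le_one)
  then obtain j where j: "b ^ j < 1 / 8" using real_arch_pow_inv[of "1 / 8" b] by auto
  \<comment> \<open>\<open>2 * A + 2\<close> pays for two phases of \<open>s\<close> steps, rounding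
    included, when \<open>n\<close> is at least \<open>m\<close>; \<open>j * m ^ 2\<close> pays for
    all smaller \<open>n\<close>.\<close>
  define C where "C = 2 * A + 2 + j * real m ^ 2"
  show ?thesis
  proof (rule that, unfold mixing_constant_def, intro conjI allI impI)
    show "0 < C" using A by (simp add: C_def add_pos_nonneg)
    fix n H p q sel x y t
    assume dyn: "triangle_free_dynamics n H p q sel" and n: "2 \<le> n" and pc: "p \<le> c * real n powr (-1/2)"
      and qn: "2 / real n ^ 2 \<le> q" and xy: "x \<in> constrained triangle_free H" "y \<in> constrained triangle_free H"
      and t: "C * real n ^ 2 * ln n \<le> real t"
    interpret triangle_free_dynamics n H p q sel by (rule dyn)
    have "real n powr (-1/2) = 1 / sqrt n"
      using n by (simp add: powr_minus powr_half_sqrt inverse_eq_divide)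
    then have pc: "p \<le> c / sqrt n" using pc by simp
    also have "\<dots> \<le> c' / sqrt n" using c' by (intro divide_right_mono) auto
    finally have pc': "p \<le> c' / sqrt n" .
    have nn: "1 \<le> real n ^ 2 * ln n" by (rule square_ln_ge_1[OF n])
    show "apart_prob rnd upd t x y \<le> 1 / 8"
    proof (cases "m \<le> n")
      case True
      define s where "s = nat \<lceil>A * real n ^ 2 * ln n\<rceil>"
      have An: "0 \<le> A * real n ^ 2 * ln n" using A n by simp
      have s: "A * real n ^ 2 * ln n \<le> s" "s \<le> A * real n ^ 2 * ln n + 1"
        using An unfolding s_def by linarith+
      have "real (s + s) \<le> (2 * A) * (real n ^ 2 * ln n) + 2 * (real n ^ 2 * ln n)" using s nn by simp
      also have "\<dots> = (2 * A + 2) * (real n ^ 2 * ln n)" by (simp add: distrib_right)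
      also have "\<dots> \<le> C * (real n ^ 2 * ln n)"
        using nn by (intro mult_right_mono) (auto simp: C_def)
      finally have "s + s \<le> t" using t by (simp add: mult.assoc)
      then have "apart_prob rnd upd t x y \<le> apart_prob rnd upd (s + s) x y"
        by (rule apart_prob_antimono[OF finite_rnd])
      also have "\<dots> \<le> g n"
        unfolding g_def \<kappa>_def
        by (rule apart_prob_large[OF xy qn n c'(1) c\<theta> _ \<theta>(2) \<delta> pc' A_def s]) (use \<theta> in simp)
      also have "\<dots> < 1 / 8" using m0 True by (simp add: m_def)
      finally show ?thesis by simp
    next
      case False
      have "sqrt 2 \<le> sqrt n" using n by simp
      then have "c' / sqrt n \<le> c' / sqrt 2" using c' by (intro divide_left_mono) auto
      also have "\<dots> \<le> (1 / sqrt 2) / sqrt 2" using c' by (intro divide_right_mono) auto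
      also have "\<dots> = 1 / 2" by simp
      finally have p2: "p \<le> 1 / 2" by (rule order_trans[OF pc'])
      have "real (j * m ^ 2) \<le> C" using A by (simp add: C_def)
      moreover have "C * 1 \<le> C * (real n ^ 2 * ln n)"
        using nn A by (intro mult_left_mono) (auto simp: C_def)
      ultimately have "real (j * m ^ 2) \<le> real t" using t by (simp only: mult.assoc mult_1_right)
      then have "j * m ^ 2 \<le> t" by (simp only: of_nat_le_iff)
      then have "apart_prob rnd upd t x y \<le> apart_prob rnd upd (j * m ^ 2) x y"
        by (rule apart_prob_antimono[OF finite_rnd])
      also have "\<dots> \<le> b ^ j"
        unfolding b_def by (rule apart_prob_small[OF xy qn _ n p2]) (use False in simp)
      finally show ?thesis using j by simp
    qed
  qed
qed

section \<open>From coalescence to the mixing time of the Glauber dynamics\<close>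

lemma (in triangle_free_dynamics) tv_dist_gibbs_le:
  assumes "x \<in> states" "\<And>y. y \<in> states \<Longrightarrow> apart_prob rnd upd t x y \<le> b"
  shows "tv_dist (random_map_chain rnd upd t x) (gibbs triangle_free H p) \<le> b"
proof (rule tv_dist_stationary_le[OF finite_rnd])
  note D = finite_H p down_closed_triangle_free
  show "finite (set_pmf (gibbs triangle_free H p))" by (rule finite_set_gibbs[OF D])
  show "bind_pmf (gibbs triangle_free H p) (\<lambda>x. map_pmf (\<lambda>r. upd r x) rnd) = gibbs triangle_free H p"
    unfolding rnd_def by (rule gibbs_stationary[OF D])
  show "apart_prob rnd upd t x y \<le> b" if "y \<in> set_pmf (gibbs triangle_free H p)" for y
    using that set_gibbs[OF D] assms(2) by blast
qed

lemma gnp_eq: "gnp n p = random_subset (pairs n) p"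
  by (simp add: gnp_def random_subset_def)

lemma TF_eq: "TF n = constrained triangle_free (pairs n)"
  by (simp add: TF_def constrained_def)

lemma gnp_TF_eq: "gnp_TF n p = gibbs triangle_free (pairs n) p"
  by (simp add: gnp_TF_def gibbs_def gnp_eq TF_eq)

lemma pairs_nonempty: "2 \<le> n \<Longrightarrow> pairs n \<noteq> {}"
  using card_pairs[of n] zero_less_binomial[of 2 n] by (metis card.empty less_irrefl)

text \<open>\<open>2 \<le> n\<close> makes the uniform law on the pairs genuine, so every selected
  pair lies in the host graph \<open>pairs n\<close>.\<close>

lemma glauber_law_eq:
  assumes "2 \<le> n"
  shows "glauber_law n p x t = random_map_chain (pair_pmf (pmf_of_set (pairs n)) (bernoulli_pmf p))
    (update triangle_free (pairs n)) t x"
proof (induction t)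
  case (Suc t)
  let ?R = "pair_pmf (pmf_of_set (pairs n)) (bernoulli_pmf p)"
  have "glauber_step n p G = map_pmf (\<lambda>r. update triangle_free (pairs n) r G) ?R" for G
  proof -
    have "map_pmf (\<lambda>r. update triangle_free (pairs n) r G) ?R =
      bind_pmf (pmf_of_set (pairs n)) (\<lambda>e. bind_pmf (bernoulli_pmf p)
        (\<lambda>b. return_pmf (update triangle_free (pairs n) (e, b) G)))"
      by (simp add: pair_pmf_def map_pmf_def bind_assoc_pmf bind_return_pmf)
    also have "\<dots> = glauber_step n p G"
      unfolding glauber_step_def
      by (intro bind_pmf_cong refl)
         (use set_pmf_of_set[OF pairs_nonempty[OF assms] finite_pairs] in \<open>simp add: update_def\<close>)
    finally show ?thesis ..
  qed
  then show ?case using Suc by (simp add: fun_eq_iff cong: bind_pmf_cong)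
qed simp

lemma edge_density_less_1:
  assumes "c < 1 / sqrt 2" "p \<le> c * real n powr (-1/2)" "1 \<le> n" "0 \<le> p"
  shows "p < 1"
proof (cases "0 \<le> c")
  case True
  have "real n powr (-1/2) \<le> 1"
    using assms(3) powr_mono[of "-1/2" 0 "real n"] by simp
  then have "c * real n powr (-1/2) \<le> c * 1" using True by (intro mult_left_mono)
  moreover have "1 / sqrt 2 < 1" by simp
  ultimately show ?thesis using assms by linarith
next
  case False
  then have "c * real n powr (-1/2) \<le> 0" by (simp add: mult_nonpos_nonneg)
  then show ?thesis using assms by linarith
qed

text \<open>Both \<open>c\<close> and \<open>1 / sqrt n\<close> are at most
  \<open>1 / sqrt 2\<close>. This keeps every ratio of the product estimator at least
  \<open>1 / 2\<close>.\<close>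

lemma edge_density_le_half:
  assumes "c < 1 / sqrt 2" "p \<le> c * real n powr (-1/2)" "2 \<le> n" "0 \<le> p"
  shows "p \<le> 1 / 2"
proof -
  have n: "real n powr (-1/2) = 1 / sqrt n"
    using assms(3) by (simp add: powr_minus powr_half_sqrt inverse_eq_divide)
  have "c * (1 / sqrt n) \<le> (1 / sqrt 2) * (1 / sqrt n)" using assms by (intro mult_right_mono) auto
  also have "\<dots> \<le> (1 / sqrt 2) * (1 / sqrt 2)"
    using assms(3) by (intro mult_left_mono divide_left_mono) auto
  also have "\<dots> = 1 / 2" by simp
  finally show ?thesis using assms(2) unfolding n by linarith
qed

theorem mixing_time_bound:
  fixes c :: real
  assumes "c < 1 / sqrt 2"
  shows "\<exists>C. \<forall>n p. 2 \<le> n \<longrightarrow> 0 \<le> p \<longrightarrow> p \<le> c * real n powr (-1/2) \<longrightarrow>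
        ereal_of_enat (mixing_time n p) \<le> ereal (C * real n ^ 2 * ln (real n))"
proof -
  obtain C where mc: "mixing_constant c C" using triangle_free_mixing[OF assms] .
  then have C: "0 < C" by (simp add: mixing_constant_def)
  note mix = mixing_constantD[OF mc]
  \<comment> \<open>The 1 added to \<open>C\<close> pays for the ceiling in
    \<open>T\<close>.\<close>
  have "ereal_of_enat (mixing_time n p) \<le> ereal ((C + 1) * real n ^ 2 * ln n)"
    if n: "2 \<le> n" and p0: "0 \<le> p" and pc: "p \<le> c * real n powr (-1/2)" for n p
  proof -
    let ?sel = "pmf_of_set (pairs n)" and ?q = "1 / real (card (pairs n))"
    have ne: "pairs n \<noteq> {}" by (rule pairs_nonempty[OF n])
    have pos: "0 < real (card (pairs n))" using ne finite_pairs by (simp add: card_gt_0_iff)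
    interpret triangle_free_dynamics n "pairs n" p ?q ?sel
    proof
      show "p < 1" using edge_density_less_1[OF assms pc] n p0 by simp
      show "?q \<le> 1" using pos by (simp add: Suc_leI)
    qed (use p0 finite_pairs ne in auto)
    have "2 * real (card (pairs n)) \<le> real n ^ 2"
    proof -
      have "2 * card (pairs n) \<le> n * (n - 1)" by (simp add: card_pairs choose_two)
      also have "\<dots> \<le> n ^ 2" by (simp add: power2_eq_square)
      finally show ?thesis by (metis of_nat_le_iff of_nat_mult of_nat_numeral of_nat_power)
    qed
    then have qn: "2 / real n ^ 2 \<le> ?q" using pos n by (simp add: field_simps)
    define T where "T = nat \<lceil>C * real n ^ 2 * ln n\<rceil>"
    have Cn: "0 \<le> C * real n ^ 2 * ln n" using C n by simp
    have T: "C * real n ^ 2 * ln n \<le> real T" "real T \<le> C * real n ^ 2 * ln n + 1"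
      using Cn unfolding T_def by linarith+
    have "mixing_time n p \<le> enat T"
      unfolding mixing_time_def
    proof (rule SUP_least)
      fix X0 assume X0: "X0 \<in> TF n"
      have "tv_dist (glauber_law n p X0 T) (gnp_TF n p) \<le> 1 / 8"
        unfolding glauber_law_eq[OF n] gnp_TF_eq rnd_def[symmetric]
      proof (rule tv_dist_gibbs_le)
        show "X0 \<in> states" using X0 by (simp add: TF_eq)
        then show "apart_prob rnd upd T X0 y \<le> 1 / 8" if "y \<in> states" for y
          using mix[OF triangle_free_dynamics_axioms n pc qn _ that T(1)] by blast
      qed
      then have "enat T \<in> {enat t |t. tv_dist (glauber_law n p X0 t) (gnp_TF n p) < 1 / 4}" by auto
      then show "Inf {enat t |t. tv_dist (glauber_law n p X0 t) (gnp_TF n p) < 1 / 4} \<le> enat T"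
        by (rule Inf_lower)
    qed
    then have "ereal_of_enat (mixing_time n p) \<le> ereal_of_enat (enat T)"
      by (simp only: ereal_of_enat_le_iff)
    also have "\<dots> = ereal (real T)" by simp
    also have "\<dots> \<le> ereal ((C + 1) * real n ^ 2 * ln n)"
      using T(2) square_ln_ge_1[OF n] by (simp add: algebra_simps)
    finally show ?thesis .
  qed
  then show ?thesis by blast
qed

section \<open>A relational program logic for the randomized machine\<close>

text \<open>Exactly \<open>T\<close> steps can stand for an upper bound on the time because a halted
  configuration stays where it is.\<close>

definition halts_in :: "config \<Rightarrow> nat \<Rightarrow> mem pmf \<Rightarrow> bool" where
  "halts_in cf T D \<longleftrightarrow> mrun T cf = map_pmf (Pair []) D"

lemma mrun_add: "mrun (a + b) cf = bind_pmf (mrun a cf) (mrun b)"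
  by (induction a arbitrary: cf) (simp_all add: bind_return_pmf bind_assoc_pmf cong: bind_pmf_cong)

lemma mrun_halted: "mrun t ([], s) = return_pmf ([], s)"
  by (induction t) (simp_all add: bind_return_pmf)

lemma halts_in_mono:
  assumes "halts_in cf T D" "T \<le> T'"
  shows "halts_in cf T' D"
proof -
  have "mrun (T + (T' - T)) cf = map_pmf (Pair []) D"
    using assms(1) unfolding mrun_add halts_in_def
    by (simp add: bind_map_pmf mrun_halted map_pmf_def[symmetric])
  then show ?thesis using assms(2) by (simp add: halts_in_def)
qed

lemma halts_in_step:
  assumes "\<And>cf'. cf' \<in> set_pmf (mstep cf) \<Longrightarrow> halts_in cf' T (F cf')"
  shows "halts_in cf (Suc T) (bind_pmf (mstep cf) F)"
  using assms by (simp add: halts_in_def map_bind_pmf cong: bind_pmf_cong)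

lemma halts_in_det_step:
  assumes "mstep cf = return_pmf cf'" "halts_in cf' T D"
  shows "halts_in cf (Suc T) D"
  using halts_in_step[of cf T "\<lambda>_. D"] assms by (simp add: bind_return_pmf)

text \<open>\<open>runs c s T D\<close>: started in \<open>s\<close>, the command \<open>c\<close> ends within \<open>T\<close> steps with a memory of law \<open>D\<close>.
  Its branches may end at different times, so this is phrased by means of the halting time
  of an arbitrary continuation.\<close>

definition runs :: "com \<Rightarrow> mem \<Rightarrow> nat \<Rightarrow> mem pmf \<Rightarrow> bool" where
  "runs c s T D \<longleftrightarrow> (\<forall>k T' F. (\<forall>s'\<in>set_pmf D. halts_in (k, s') T' (F s')) \<longrightarrow>
     halts_in (c # k, s) (T + T') (bind_pmf D F))"

lemma runsI:
  assumes "\<And>k T' F. (\<And>s'. s' \<in> set_pmf D \<Longrightarrow> halts_in (k, s') T' (F s')) \<Longrightarrow>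
     halts_in (c # k, s) (T + T') (bind_pmf D F)"
  shows "runs c s T D"
  using assms by (auto simp: runs_def)

lemma runsD:
  assumes "runs c s T D" "\<And>s'. s' \<in> set_pmf D \<Longrightarrow> halts_in (k, s') T' (F s')"
  shows "halts_in (c # k, s) (T + T') (bind_pmf D F)"
  using assms by (auto simp: runs_def)

lemma runs_halts:
  assumes "runs c s T D"
  shows "halts_in ([c], s) T D"
  using runsD[OF assms, of "[]" 0 return_pmf] by (simp add: halts_in_def bind_return_pmf')

text \<open>Makes the final law a function of the memory, from which \<open>sim_bind\<close> builds
  a kernel.\<close>

lemma runs_unique:
  assumes "runs c s T D" "runs c s T D'"
  shows "D = D'"
proof -
  have "map_pmf (Pair ([] :: com list)) D = map_pmf (Pair []) D'"
    using runs_halts[OF assms(1)] runs_halts[OF assms(2)] by (simp add: halts_in_def)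
  then have "map_pmf snd (map_pmf (Pair ([] :: com list)) D) = map_pmf snd (map_pmf (Pair ([] :: com list)) D')"
    by simp
  then show ?thesis by (simp add: map_pmf_comp)
qed

lemma runs_mono:
  assumes "runs c s T D" "T \<le> T'"
  shows "runs c s T' D"
proof (rule runsI)
  fix k T'' F
  assume "\<And>s'. s' \<in> set_pmf D \<Longrightarrow> halts_in (k, s') T'' (F s')"
  then have "halts_in (c # k, s) (T + T'') (bind_pmf D F)" by (rule runsD[OF assms(1)])
  then show "halts_in (c # k, s) (T' + T'') (bind_pmf D F)"
    by (rule halts_in_mono) (use assms(2) in auto)
qed

lemma runs_det_step:
  assumes "\<And>k. mstep (c # k, s) = return_pmf (k, s')"
  shows "runs c s 1 (return_pmf s')"
proof (rule runsI)
  fix k T' F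
  assume "\<And>s''. s'' \<in> set_pmf (return_pmf s') \<Longrightarrow> halts_in (k, s'') T' (F s'')"
  then have "halts_in (k, s') T' (F s')" by simp
  from halts_in_det_step[OF assms this] show "halts_in (c # k, s) (1 + T') (bind_pmf (return_pmf s') F)"
    by (simp add: bind_return_pmf)
qed

lemma runs_Toss:
  "runs (Toss x i r) s 1 (map_pmf (\<lambda>b. set_nat x (nval i s) (of_bool b) s) (bernoulli_pmf (rval r s)))"
proof (rule runsI)
  fix k T' F
  let ?D = "map_pmf (\<lambda>b. set_nat x (nval i s) (of_bool b) s) (bernoulli_pmf (rval r s))"
  assume *: "\<And>s'. s' \<in> set_pmf ?D \<Longrightarrow> halts_in (k, s') T' (F s')"
  have "halts_in (Toss x i r # k, s) (Suc T') (bind_pmf (mstep (Toss x i r # k, s)) (\<lambda>cf. F (snd cf)))"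
  proof (rule halts_in_step)
    fix cf assume "cf \<in> set_pmf (mstep (Toss x i r # k, s))"
    then have "fst cf = k" "snd cf \<in> set_pmf ?D" by auto
    then show "halts_in cf T' (F (snd cf))" using *[of "snd cf"] by (metis prod.collapse)
  qed
  then show "halts_in (Toss x i r # k, s) (1 + T') (bind_pmf ?D F)"
    by (simp add: bind_map_pmf)
qed

lemma runs_Seq:
  assumes "runs c s T1 D" "\<And>s'. s' \<in> set_pmf D \<Longrightarrow> runs d s' T2 (E s')"
  shows "runs (Seq c d) s (T1 + T2 + 1) (bind_pmf D E)"
proof (rule runsI)
  fix k T' F
  assume *: "\<And>s'. s' \<in> set_pmf (bind_pmf D E) \<Longrightarrow> halts_in (k, s') T' (F s')"
  have "halts_in (d # k, s') (T2 + T') (bind_pmf (E s') F)" if "s' \<in> set_pmf D" for s'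
    using that * by (intro runsD[OF assms(2)]) auto
  then have "halts_in (c # d # k, s) (T1 + (T2 + T')) (bind_pmf D (\<lambda>s'. bind_pmf (E s') F))"
    by (rule runsD[OF assms(1)])
  from halts_in_det_step[OF _ this, of "(Seq c d # k, s)"]
  show "halts_in (Seq c d # k, s) (T1 + T2 + 1 + T') (bind_pmf (bind_pmf D E) F)"
    by (simp add: bind_assoc_pmf add.assoc)
qed

lemma runs_jump:
  assumes "\<And>k. mstep (c # k, s) = return_pmf (d # k, s)" "runs d s T D"
  shows "runs c s (T + 1) D"
proof (rule runsI)
  fix k T' F
  assume "\<And>s'. s' \<in> set_pmf D \<Longrightarrow> halts_in (k, s') T' (F s')"
  then have "halts_in (d # k, s) (T + T') (bind_pmf D F)" by (rule runsD[OF assms(2)])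
  from halts_in_det_step[OF assms(1) this]
  show "halts_in (c # k, s) (T + 1 + T') (bind_pmf D F)" by simp
qed

lemma runs_While_True:
  assumes "bval b s" "runs c s T1 D" "\<And>s'. s' \<in> set_pmf D \<Longrightarrow> runs (While b c) s' T2 (E s')"
  shows "runs (While b c) s (T1 + T2 + 1) (bind_pmf D E)"
proof (rule runsI)
  fix k T' F
  assume *: "\<And>s'. s' \<in> set_pmf (bind_pmf D E) \<Longrightarrow> halts_in (k, s') T' (F s')"
  have "halts_in (While b c # k, s') (T2 + T') (bind_pmf (E s') F)" if "s' \<in> set_pmf D" for s'
    using that * by (intro runsD[OF assms(3)]) auto
  then have "halts_in (c # While b c # k, s) (T1 + (T2 + T')) (bind_pmf D (\<lambda>s'. bind_pmf (E s') F))"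
    by (rule runsD[OF assms(2)])
  from halts_in_det_step[OF _ this, of "(While b c # k, s)"] assms(1)
  show "halts_in (While b c # k, s) (T1 + T2 + 1 + T') (bind_pmf (bind_pmf D E) F)"
    by (simp add: bind_assoc_pmf add.assoc)
qed

section \<open>Simulation of abstract laws by programs\<close>

text \<open>The law \<open>D\<close> of the final memory is never written down: it is coupled, along
  \<open>Q\<close>, with a law \<open>M\<close> of mathematical objects such as graphs and counts,
  and the probabilistic analysis speaks of \<open>M\<close>.\<close>

definition sim :: "com \<Rightarrow> mem \<Rightarrow> nat \<Rightarrow> 'a pmf \<Rightarrow> (mem \<Rightarrow> 'a \<Rightarrow> bool) \<Rightarrow> bool" where
  "sim c s T M Q \<longleftrightarrow> (\<exists>D. runs c s T D \<and> rel_pmf Q D M)"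

abbreviation dsim :: "com \<Rightarrow> mem \<Rightarrow> nat \<Rightarrow> (mem \<Rightarrow> bool) \<Rightarrow> bool" where
  "dsim c s T Q \<equiv> sim c s T (return_pmf ()) (\<lambda>s' _. Q s')"

lemma sim_mono:
  assumes "sim c s T M Q" "T \<le> T'" "\<And>s' a. a \<in> set_pmf M \<Longrightarrow> Q s' a \<Longrightarrow> Q' s' a"
  shows "sim c s T' M Q'"
proof -
  obtain D where D: "runs c s T D" "rel_pmf Q D M" using assms(1) by (auto simp: sim_def)
  have "rel_pmf Q' D M" by (rule pmf.rel_mono_strong[OF D(2)]) (rule assms(3))
  then show ?thesis using runs_mono[OF D(1) assms(2)] by (auto simp: sim_def)
qed

lemma sim_return:
  assumes "dsim c s T (\<lambda>s'. Q s' a)"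
  shows "sim c s T (return_pmf a) Q"
  using assms by (simp add: sim_def rel_pmf_return_pmf2)

lemma sim_det_step:
  assumes "\<And>k. mstep (c # k, s) = return_pmf (k, s')" "Q s' a"
  shows "sim c s 1 (return_pmf a) Q"
  unfolding sim_def using runs_det_step[OF assms(1)] assms(2)
  by (intro exI[of _ "return_pmf s'"]) simp

lemma sim_Skip: "Q s a \<Longrightarrow> sim Skip s 1 (return_pmf a) Q"
  by (rule sim_det_step) simp_all

lemma dsim_Skip:
  assumes "Q s" "1 \<le> T"
  shows "dsim Skip s T Q"
  by (rule sim_mono[OF sim_Skip[where Q = "\<lambda>s _. Q s"]]) (use assms in auto)

lemma sim_AssignN: "Q (set_nat x (nval i s) (nval r s) s) a \<Longrightarrow> sim (AssignN x i r) s 1 (return_pmf a) Q"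
  by (rule sim_det_step) simp_all

lemma sim_AssignR: "Q (set_real x (nval i s) (rval r s) s) a \<Longrightarrow> sim (AssignR x i r) s 1 (return_pmf a) Q"
  by (rule sim_det_step) simp_all

lemma sim_Toss:
  "sim (Toss x i r) s 1 (bernoulli_pmf (rval r s)) (\<lambda>s' b. s' = set_nat x (nval i s) (of_bool b) s)"
  unfolding sim_def
  by (intro exI conjI, rule runs_Toss) (simp add: pmf.rel_map pmf.rel_refl)

text \<open>One memory may be related to several abstract values, each of which yields a law for
  \<open>d\<close>. By \<open>runs_unique\<close> these laws coincide, so a single kernel
  \<open>E\<close> serves all of them.\<close>

lemma sim_bind:
  assumes "rel_pmf Q1 D M" "\<And>s' a. Q1 s' a \<Longrightarrow> sim d s' T2 (M' a) Q2"
  shows "\<exists>E. (\<forall>s'\<in>set_pmf D. runs d s' T2 (E s')) \<and> rel_pmf Q2 (bind_pmf D E) (bind_pmf M M')"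
proof -
  define E where "E = (\<lambda>s'. THE D'. runs d s' T2 D')"
  have E: "D' = E s'" if "runs d s' T2 D'" for s' D'
    unfolding E_def using that runs_unique by (metis the_equality)
  have "runs d s' T2 (E s')" if s': "s' \<in> set_pmf D" for s'
  proof -
    obtain a where "Q1 s' a" using rel_pmf_imp_rel_set[OF assms(1)] s' by (auto simp: rel_set_def)
    then show ?thesis using assms(2) E unfolding sim_def by metis
  qed
  moreover have "rel_pmf Q2 (bind_pmf D E) (bind_pmf M M')"
    by (rule rel_pmf_bindI[OF assms(1)]) (use assms(2) E in \<open>metis sim_def\<close>)
  ultimately show ?thesis by blast
qed

lemma sim_Seq:
  assumes "sim c s T1 M Q1" "\<And>s' a. Q1 s' a \<Longrightarrow> sim d s' T2 (M' a) Q2"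
  shows "sim (Seq c d) s (T1 + T2 + 1) (bind_pmf M M') Q2"
proof -
  obtain D where D: "runs c s T1 D" "rel_pmf Q1 D M" using assms(1) by (auto simp: sim_def)
  have "\<exists>E. (\<forall>s'\<in>set_pmf D. runs d s' T2 (E s')) \<and> rel_pmf Q2 (bind_pmf D E) (bind_pmf M M')"
    by (rule sim_bind[OF D(2)]) (rule assms(2))
  then obtain E where E: "\<forall>s'\<in>set_pmf D. runs d s' T2 (E s')" "rel_pmf Q2 (bind_pmf D E) (bind_pmf M M')"
    by blast
  have "runs (Seq c d) s (T1 + T2 + 1) (bind_pmf D E)" by (rule runs_Seq[OF D(1)]) (use E in blast)
  with E(2) show ?thesis unfolding sim_def by blast
qed

lemma sim_Seq_det:
  assumes "dsim c s T1 Q1" "\<And>s'. Q1 s' \<Longrightarrow> sim d s' T2 M Q2"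
  shows "sim (Seq c d) s (T1 + T2 + 1) M Q2"
  using sim_Seq[OF assms(1), where M' = "\<lambda>_. M"] assms(2) by (simp add: bind_return_pmf)

lemma sim_Seq_return:
  assumes "sim c s T1 M Q1" "\<And>s' a. Q1 s' a \<Longrightarrow> dsim d s' T2 (\<lambda>s''. Q2 s'' (f a))"
  shows "sim (Seq c d) s (T1 + T2 + 1) (map_pmf f M) Q2"
  unfolding map_pmf_def using assms by (blast intro: sim_Seq sim_return)

lemma sim_Cond:
  assumes "bval b s \<Longrightarrow> sim c s T M Q" "\<not> bval b s \<Longrightarrow> sim d s T M Q"
  shows "sim (Cond b c d) s (T + 1) M Q"
proof -
  have "sim (if bval b s then c else d) s T M Q" using assms by simp
  then obtain D where D: "runs (if bval b s then c else d) s T D" "rel_pmf Q D M"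
    by (auto simp: sim_def)
  show ?thesis unfolding sim_def
    by (intro exI[of _ D] conjI runs_jump[OF _ D(1)] D(2)) simp
qed

text \<open>The abstract shadow of a counted loop. The body receives the counter \<open>k\<close>,
  since the host graph of a ratio depends on the position in the loop.\<close>

primrec iterM :: "(nat \<Rightarrow> 'a \<Rightarrow> 'a pmf) \<Rightarrow> nat \<Rightarrow> nat \<Rightarrow> 'a \<Rightarrow> 'a pmf" where
  "iterM f 0 k a = return_pmf a"
| "iterM f (Suc m) k a = bind_pmf (f k a) (iterM f m (Suc k))"

lemma iterM_Suc_right: "iterM f (Suc m) k a = bind_pmf (iterM f m k a) (f (k + m))"
proof (induction m arbitrary: k a)
  case (Suc m)
  have "iterM f (Suc m) (Suc k) = (\<lambda>x. bind_pmf (iterM f m (Suc k) x) (f (Suc k + m)))"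
    by (rule ext, rule Suc)
  then have "iterM f (Suc (Suc m)) k a = bind_pmf (f k a) (\<lambda>x. bind_pmf (iterM f m (Suc k) x) (f (Suc k + m)))"
    by (subst iterM.simps(2)) simp
  then show ?case by (simp add: bind_assoc_pmf)
next
  case 0
  have "iterM f 0 (Suc k) = return_pmf" by (rule ext) simp
  then show ?case by (simp add: bind_return_pmf bind_return_pmf')
qed

lemma iterM_return: "iterM (\<lambda>_. return_pmf) m k a = return_pmf a"
  by (induction m arbitrary: k) (simp_all add: bind_return_pmf)

lemma sim_While:
  assumes body: "\<And>k s a. k0 \<le> k \<Longrightarrow> k < m \<Longrightarrow> I k s a \<Longrightarrow> bval b s \<and> sim c s T (f k a) (I (Suc k))"
    and exit: "\<And>s a. I m s a \<Longrightarrow> \<not> bval b s"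
    and "I k0 s a" "k0 + j = m"
  shows "sim (While b c) s (j * (T + 1) + 1) (iterM f j k0 a) (I m)"
  using assms
proof (induction j arbitrary: k0 s a)
  case 0
  then have "I m s a" "\<not> bval b s" by simp_all
  then have "sim (While b c) s 1 (return_pmf a) (I m)" by (intro sim_det_step) simp_all
  then show ?case by simp
next
  case (Suc j)
  have bv: "bval b s" and bd: "sim c s T (f k0 a) (I (Suc k0))"
    using Suc.prems(1)[of k0 s a] Suc.prems(3,4) by auto
  obtain D where D: "runs c s T D" "rel_pmf (I (Suc k0)) D (f k0 a)" using bd by (auto simp: sim_def)
  have "sim (While b c) s' (j * (T + 1) + 1) (iterM f j (Suc k0) a') (I m)" if "I (Suc k0) s' a'" for s' a'
  proof (rule Suc.IH)
    show "bval b s \<and> sim c s T (f k a) (I (Suc k))" if "Suc k0 \<le> k" "k < m" "I k s a" for k s a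
      by (rule Suc.prems(1)) (use that in auto)
    show "\<not> bval b s" if "I m s a" for s a by (rule Suc.prems(2)[OF that])
  qed (use that Suc.prems(4) in auto)
  then have "\<exists>E. (\<forall>s'\<in>set_pmf D. runs (While b c) s' (j * (T + 1) + 1) (E s')) \<and>
      rel_pmf (I m) (bind_pmf D E) (bind_pmf (f k0 a) (iterM f j (Suc k0)))"
    by (rule sim_bind[OF D(2)])
  then obtain E where E: "\<forall>s'\<in>set_pmf D. runs (While b c) s' (j * (T + 1) + 1) (E s')"
      "rel_pmf (I m) (bind_pmf D E) (bind_pmf (f k0 a) (iterM f j (Suc k0)))" by blast
  have "runs (While b c) s (T + (j * (T + 1) + 1) + 1) (bind_pmf D E)"
    by (rule runs_While_True[OF bv D(1)]) (use E(1) in blast)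
  then show ?case using E(2) unfolding sim_def by (auto simp: algebra_simps)
qed

lemma fst_set_nat: "fst (set_nat x i v s) = (fst s)(x := (fst s x)(i := v))"
  by (simp add: set_nat_def)

lemma snd_set_nat: "snd (set_nat x i v s) = snd s"
  by (simp add: set_nat_def)

lemma fst_set_real: "fst (set_real x i v s) = fst s"
  by (simp add: set_real_def)

lemma snd_set_real: "snd (set_real x i v s) = (snd s)(x := (snd s x)(i := v))"
  by (simp add: set_real_def)

lemmas mem_simps = fst_set_nat snd_set_nat fst_set_real snd_set_real

abbreviation nv :: "vname \<Rightarrow> nexp" where
  "nv x \<equiv> NVar x (NConst 0)"

abbreviation rv :: "vname \<Rightarrow> rexp" where
  "rv x \<equiv> RVar x (NConst 0)"

abbreviation set_var :: "vname \<Rightarrow> nexp \<Rightarrow> com" where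
  "set_var x e \<equiv> AssignN x (NConst 0) e"

abbreviation nonzero :: "nexp \<Rightarrow> bexp" where
  "nonzero e \<equiv> NLess (NConst 0) e"

definition For :: "vname \<Rightarrow> nexp \<Rightarrow> com \<Rightarrow> com" where
  "For x ub c = Seq (set_var x (NConst 1))
     (While (NLess (nv x) (NAdd ub (NConst 1))) (Seq c (set_var x (NAdd (nv x) (NConst 1)))))"

text \<open>A round costs 3 more than the body: the test, the sequencing and the increment. The
  other 3 are the initial assignment, its sequencing and the failing test. The body has to establish
  the invariant for the memory after the increment.\<close>

lemma sim_For:
  assumes "I 1 (set_nat x 0 1 s) a"
    and counter: "\<And>k s a. I k s a \<Longrightarrow> fst s x 0 = k \<and> nval ub s = m"
    and body: "\<And>k s a. 1 \<le> k \<Longrightarrow> k \<le> m \<Longrightarrow> I k s a \<Longrightarrow>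
      sim c s T (f k a) (\<lambda>s' a'. fst s' x 0 = k \<and> I (Suc k) (set_nat x 0 (Suc k) s') a')"
  shows "sim (For x ub c) s (m * (T + 3) + 3) (iterM f m 1 a) (I (Suc m))"
proof -
  have "sim (While (NLess (nv x) (NAdd ub (NConst 1))) (Seq c (set_var x (NAdd (nv x) (NConst 1)))))
      (set_nat x 0 1 s) (m * ((T + 2) + 1) + 1) (iterM f m 1 a) (I (Suc m))"
  proof (rule sim_While)
    fix k s a assume k: "1 \<le> k" "k < Suc m" "I k s a"
    have "sim (Seq c (set_var x (NAdd (nv x) (NConst 1)))) s (T + 1 + 1) (bind_pmf (f k a) return_pmf) (I (Suc k))"
    proof (rule sim_Seq)
      show "sim c s T (f k a) (\<lambda>s' a'. fst s' x 0 = k \<and> I (Suc k) (set_nat x 0 (Suc k) s') a')"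
        by (rule body) (use k in auto)
      fix s' a' assume "fst s' x 0 = k \<and> I (Suc k) (set_nat x 0 (Suc k) s') a'"
      then show "sim (set_var x (NAdd (nv x) (NConst 1))) s' 1 (return_pmf a') (I (Suc k))"
        by (intro sim_AssignN) simp
    qed
    then show "bval (NLess (nv x) (NAdd ub (NConst 1))) s \<and>
        sim (Seq c (set_var x (NAdd (nv x) (NConst 1)))) s (T + 2) (f k a) (I (Suc k))"
      using counter[OF k(3)] k by (simp add: bind_return_pmf')
  next
    fix s a assume "I (Suc m) s a"
    from counter[OF this] show "\<not> bval (NLess (nv x) (NAdd ub (NConst 1))) s" by simp
  qed (use assms in auto)
  then have "sim (For x ub c) s (1 + (m * ((T + 2) + 1) + 1) + 1) (iterM f m 1 a) (I (Suc m))"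
    unfolding For_def
    by (intro sim_Seq_det[where ?Q1.0 = "\<lambda>s'. s' = set_nat x 0 1 s"] sim_AssignN) auto
  then show ?thesis by (rule sim_mono) (auto simp: algebra_simps)
qed

lemma dsim_For:
  assumes "I 1 (set_nat x 0 1 s)"
    and "\<And>k s. I k s \<Longrightarrow> fst s x 0 = k \<and> nval ub s = m"
    and "\<And>k s. 1 \<le> k \<Longrightarrow> k \<le> m \<Longrightarrow> I k s \<Longrightarrow>
      dsim c s T (\<lambda>s'. fst s' x 0 = k \<and> I (Suc k) (set_nat x 0 (Suc k) s'))"
  shows "dsim (For x ub c) s (m * (T + 3) + 3) (I (Suc m))"
  using sim_For[where I = "\<lambda>k s _. I k s" and f = "\<lambda>_. return_pmf" and a = "()" and T = T and s = s and m = m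
      and x = x and ub = ub and c = c] assms
  by (simp add: iterM_return)

section \<open>The sampling program\<close>

text \<open>Frame condition: \<open>V\<close> lists the names that may change, for the arrays of
  both sorts.\<close>

definition same :: "vname set \<Rightarrow> mem \<Rightarrow> mem \<Rightarrow> bool" where
  "same V s s' \<longleftrightarrow> (\<forall>y. y \<notin> V \<longrightarrow> fst s' y = fst s y \<and> snd s' y = snd s y)"

lemma same_refl [simp]: "same V s s"
  by (simp add: same_def)

lemma same_trans: "same V s s' \<Longrightarrow> same V s' s'' \<Longrightarrow> same V s s''"
  by (simp add: same_def)

lemma same_mono: "same V s s' \<Longrightarrow> V \<subseteq> U \<Longrightarrow> same U s s'"
  by (auto simp: same_def)

lemma same_set_nat [simp]: "x \<in> V \<Longrightarrow> same V s (set_nat x i v s') \<longleftrightarrow> same V s s'"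
  by (auto simp: same_def mem_simps)

lemma same_set_real [simp]: "x \<in> V \<Longrightarrow> same V s (set_real x i v s') \<longleftrightarrow> same V s s'"
  by (auto simp: same_def mem_simps)

lemma same_fst: "same V s s' \<Longrightarrow> y \<notin> V \<Longrightarrow> fst s' y = fst s y"
  by (simp add: same_def)

lemma same_snd: "same V s s' \<Longrightarrow> y \<notin> V \<Longrightarrow> snd s' y = snd s y"
  by (simp add: same_def)

text \<open>Expressions cannot multiply naturals, so the products \<open>n * i\<close> that address
  the cells of a matrix are kept in the table \<open>''mul''\<close>.\<close>

definition core :: "nat \<Rightarrow> real \<Rightarrow> nat \<Rightarrow> mem \<Rightarrow> bool" where
  "core n p S s \<longleftrightarrow> fst s ''n'' 0 = n \<and> snd s ''p'' 0 = p \<and> fst s ''S'' 0 = S \<and>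
     (\<forall>i\<le>n. fst s ''mul'' i = n * i)"

lemma core_same: "core n p S s \<Longrightarrow> same V s s' \<Longrightarrow> {''n'', ''p'', ''S'', ''mul''} \<inter> V = {} \<Longrightarrow> core n p S s'"
  by (auto simp: core_def same_def)

text \<open>Both triangles of the matrix are kept, so a look-up need not know which vertex is
  smaller.\<close>

definition represents :: "nat \<Rightarrow> (nat \<Rightarrow> nat) \<Rightarrow> graph \<Rightarrow> bool" where
  "represents n A G \<longleftrightarrow> (\<forall>i\<in>{1..n}. \<forall>j\<in>{1..n}. A (n * i + j) \<noteq> 0 \<longleftrightarrow> {i, j} \<in> G)"

text \<open>Columns run over \<open>{1..n}\<close>, so division with remainder applies after a shift
  by one.\<close>

lemma cell_inject:
  fixes n i j i' j' :: nat
  assumes "n * i + j = n * i' + j'" "j \<in> {1..n}" "j' \<in> {1..n}"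
  shows "i = i' \<and> j = j'"
proof -
  have *: "(n * i + j - 1) div n = i" "(n * i + j - 1) mod n = j - 1" if "j \<in> {1..n}" for i j
  proof -
    have "n * i + j - 1 = n * i + (j - 1)" "j - 1 < n" using that by auto
    then show "(n * i + j - 1) div n = i" "(n * i + j - 1) mod n = j - 1" by simp_all
  qed
  have "i = i'" "j - 1 = j' - 1" using *[OF assms(2), of i] *[OF assms(3), of i'] assms(1) by simp_all
  then show ?thesis using assms(2,3) by auto
qed

lemma represents_update:
  assumes "represents n A G" "a \<in> {1..n}" "b \<in> {1..n}"
  shows "represents n ((A(n * a + b := v))(n * b + a := v)) (if v \<noteq> 0 then insert {a, b} G else G - {{a, b}})"
  unfolding represents_def
proof (intro ballI)
  fix i j assume ij: "i \<in> {1..n}" "j \<in> {1..n}"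
  have 1: "n * i + j = n * a + b \<longleftrightarrow> i = a \<and> j = b" "n * i + j = n * b + a \<longleftrightarrow> i = b \<and> j = a"
    using cell_inject[of n i j a b] cell_inject[of n i j b a] ij assms by auto
  have 2: "{i, j} = {a, b} \<longleftrightarrow> i = a \<and> j = b \<or> i = b \<and> j = a" by (auto simp: doubleton_eq_iff)
  have 3: "A (n * i + j) \<noteq> 0 \<longleftrightarrow> {i, j} \<in> G" using assms(1) ij by (simp add: represents_def)
  show "((A(n * a + b := v))(n * b + a := v)) (n * i + j) \<noteq> 0 \<longleftrightarrow>
      {i, j} \<in> (if v \<noteq> 0 then insert {a, b} G else G - {{a, b}})"
    using 1 2 3 by auto
qed

lemma output_graph_represents:
  assumes "represents n (fst s ''adj'') G" "G \<subseteq> pairs n"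
  shows "output_graph n s = G"
proof (intro equalityI subsetI)
  fix e assume "e \<in> output_graph n s"
  then obtain i j where "e = {i, j}" "1 \<le> i" "i < j" "j \<le> n" "fst s ''adj'' (n * i + j) \<noteq> 0"
    by (auto simp: output_graph_def)
  then show "e \<in> G" using assms(1) by (simp add: represents_def)
next
  fix e assume e: "e \<in> G"
  then have "e \<in> pairs n" using assms(2) by blast
  then obtain u v where uv: "e = {u, v}" "u \<noteq> v" "u \<in> {1..n}" "v \<in> {1..n}" by (rule pairsE)
  have "e = {min u v, max u v}" "min u v < max u v" "min u v \<in> {1..n}" "max u v \<in> {1..n}"
    using uv by (auto simp: min_def max_def)
  moreover from this have "fst s ''adj'' (n * min u v + max u v) \<noteq> 0"
    using assms(1) e by (simp add: represents_def)
  ultimately show "e \<in> output_graph n s" unfolding output_graph_def by fastforce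
qed

definition cell :: "vname \<Rightarrow> vname \<Rightarrow> nexp" where
  "cell u v = NAdd (NVar ''mul'' (nv u)) (nv v)"

lemma nval_cell:
  assumes "core n p S s" "fst s u 0 \<le> n"
  shows "nval (cell u v) s = n * fst s u 0 + fst s v 0"
  using assms by (simp add: cell_def core_def)

text \<open>Reservoir sampling: the \<open>k\<close>-th vertex replaces the current one with probability \<open>1/k\<close>.\<close>

definition pick_com :: "vname \<Rightarrow> com" where
  "pick_com x = For ''k'' (nv ''n'')
     (Seq (Toss ''c'' (NConst 0) (RDiv (RNat (NConst 1)) (RNat (nv ''k''))))
       (Cond (nonzero (nv ''c'')) (set_var x (nv ''k'')) Skip))"

text \<open>A value uniform among \<open>K - 1\<close> vertices survives the toss at
  \<open>K\<close> with probability \<open>1 - 1 / K\<close>, which leaves mass \<open>1 / K\<close>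
  on each. The toss at 1 is certain to succeed, so the initial \<open>a\<close> is
  forgotten.\<close>

lemma reservoir_uniform:
  "iterM (\<lambda>k a. bind_pmf (bernoulli_pmf (1 / real k)) (\<lambda>b. return_pmf (if b then k else a))) (Suc m) 1 a =
     pmf_of_set {1..Suc m}"
proof (induction m)
  case 0
  have "bernoulli_pmf 1 = return_pmf True"
    by (rule pmf_eqI) (auto simp: indicator_def split: if_splits)
  then show ?case by (simp add: bind_return_pmf pmf_of_set_singleton)
next
  case (Suc m)
  let ?f = "\<lambda>k a. bind_pmf (bernoulli_pmf (1 / real k)) (\<lambda>b. return_pmf (if b then k else a :: nat))"
  have "iterM ?f (Suc (Suc m)) 1 a = bind_pmf (pmf_of_set {1..Suc m}) (?f (Suc (Suc m)))"
    by (subst iterM_Suc_right) (simp only: Suc add_Suc_right plus_1_eq_Suc)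
  also have "\<dots> = pmf_of_set {1..Suc (Suc m)}"
  proof (rule pmf_eqI)
    fix i
    let ?K = "Suc (Suc m)"
    have K: "pmf (?f ?K a) i = 1 / real ?K * of_bool (i = ?K) + (1 - 1 / real ?K) * of_bool (i = a)" for a
      by (auto simp: pmf_bind indicator_def)
    have "pmf (bind_pmf (pmf_of_set {1..Suc m}) (?f ?K)) i =
        (\<Sum>a\<in>{1..Suc m}. pmf (?f ?K a) i) / real (Suc m)"
      by (subst pmf_bind_pmf_of_set) auto
    also have "(\<Sum>a\<in>{1..Suc m}. pmf (?f ?K a) i) =
        real (Suc m) / real ?K * of_bool (i = ?K) + (1 - 1 / real ?K) * of_bool (i \<in> {1..Suc m})"
      unfolding K by (simp add: sum.distrib sum_distrib_left[symmetric] of_bool_def sum.delta del: of_nat_Suc sum.cl_ivl_Suc)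
    also have "\<dots> / real (Suc m) = (of_bool (i = ?K) + of_bool (i \<in> {1..Suc m})) / real ?K"
    proof -
      have "1 - 1 / real ?K = real (Suc m) / real ?K" by (simp add: field_simps)
      moreover have "(a / c * x + a / c * y) / a = (x + y) / c" if "a \<noteq> 0" for a c x y :: real
        using that by (simp add: add_divide_distrib)
      ultimately show ?thesis by (simp only:)
    qed
    also have "\<dots> = pmf (pmf_of_set {1..?K}) i"
      by (auto simp: indicator_def)
    finally show "pmf (bind_pmf (pmf_of_set {1..Suc m}) (?f ?K)) i = pmf (pmf_of_set {1..?K}) i" .
  qed
  finally show ?case .
qed

lemma sim_pick:
  assumes "1 \<le> n" "fst s ''n'' 0 = n" "x \<notin> {''n'', ''k'', ''c''}"
  shows "sim (pick_com x) s (7 * n + 3) (pmf_of_set {1..n})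
    (\<lambda>s' a. a \<in> {1..n} \<and> fst s' x 0 = a \<and> same {''k'', ''c'', x} s s')"
proof -
  have nx: "''n'' \<noteq> x" using assms(3) by blast
  obtain m where m: "n = Suc m" using assms(1) by (cases n) auto
  let ?f = "\<lambda>k a. bind_pmf (bernoulli_pmf (1 / real k)) (\<lambda>b. return_pmf (if b then k else a :: nat))"
  let ?I = "\<lambda>k s' a. fst s' ''k'' 0 = k \<and> fst s' x 0 = a \<and> same {''k'', ''c'', x} s s'"
  have "sim (pick_com x) s (n * ((1 + (1 + 1) + 1) + 3) + 3) (iterM ?f n 1 (fst s x 0)) (?I (Suc n))"
    unfolding pick_com_def
  proof (rule sim_For)
    show "?I 1 (set_nat ''k'' 0 1 s) (fst s x 0)" using assms(3) by (simp add: mem_simps)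
  next
    fix k s' a assume I: "?I k s' a"
    have "fst s' ''n'' = fst s ''n''" using same_fst[of "{''k'', ''c'', x}" s s' "''n''"] I nx by simp
    then show "fst s' ''k'' 0 = k \<and> nval (nv ''n'') s' = n" using I assms(2) by simp
  next
    fix k s' a assume k: "1 \<le> k" "k \<le> n" and I: "?I k s' a"
    show "sim (Seq (Toss ''c'' (NConst 0) (RDiv (RNat (NConst 1)) (RNat (nv ''k''))))
        (Cond (nonzero (nv ''c'')) (set_var x (nv ''k'')) Skip)) s' (1 + (1 + 1) + 1) (?f k a)
        (\<lambda>s' a. fst s' ''k'' 0 = k \<and> ?I (Suc k) (set_nat ''k'' 0 (Suc k) s') a)"
    proof (rule sim_Seq)
      show "sim (Toss ''c'' (NConst 0) (RDiv (RNat (NConst 1)) (RNat (nv ''k'')))) s' 1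
          (bernoulli_pmf (1 / real k)) (\<lambda>s'' b. s'' = set_nat ''c'' 0 (of_bool b) s')"
        using sim_Toss[of "''c''" "NConst 0" "RDiv (RNat (NConst 1)) (RNat (nv ''k''))" s'] I by simp
    next
      fix s'' b assume s'': "s'' = set_nat ''c'' 0 (of_bool b) s'"
      show "sim (Cond (nonzero (nv ''c'')) (set_var x (nv ''k'')) Skip) s'' (1 + 1)
          (return_pmf (if b then k else a))
          (\<lambda>s' a. fst s' ''k'' 0 = k \<and> ?I (Suc k) (set_nat ''k'' 0 (Suc k) s') a)"
        by (intro sim_Cond sim_AssignN sim_Skip) (use I s'' assms(3) in \<open>auto simp: mem_simps\<close>)
    qed
  qed
  then have "sim (pick_com x) s (n * ((1 + (1 + 1) + 1) + 3) + 3) (pmf_of_set {1..n}) (?I (Suc n))"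
    unfolding m reservoir_uniform .
  then show ?thesis by (rule sim_mono) (use assms(1) in auto)
qed

section \<open>One update of the dynamics by the program, and a full sample\<close>

definition closes_com :: "vname \<Rightarrow> vname \<Rightarrow> com" where
  "closes_com u v = Seq (set_var ''t'' (NConst 0)) (For ''w'' (nv ''n'')
     (Cond (BAnd (nonzero (NVar ''adj'' (cell u ''w''))) (nonzero (NVar ''adj'' (cell v ''w''))))
       (set_var ''t'' (NConst 1)) Skip))"

lemma dsim_closes:
  assumes core: "core n p S s" and adj: "represents n (fst s ''adj'') G"
    and ab: "fst s u 0 = a" "fst s v 0 = b" "a \<in> {1..n}" "b \<in> {1..n}"
    and uv: "u \<notin> {''t'', ''w''}" "v \<notin> {''t'', ''w''}"
  shows "dsim (closes_com u v) s (5 * n + 5)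
    (\<lambda>s'. fst s' ''t'' 0 = of_bool (\<exists>w\<in>{1..n}. {a, w} \<in> G \<and> {b, w} \<in> G) \<and> same {''t'', ''w''} s s')"
proof -
  let ?s = "set_nat ''t'' 0 0 s"
  let ?I = "\<lambda>k s'. fst s' ''w'' 0 = k \<and>
    fst s' ''t'' 0 = of_bool (\<exists>w\<in>{1..<k}. {a, w} \<in> G \<and> {b, w} \<in> G) \<and> same {''t'', ''w''} s s'"
  have "dsim (For ''w'' (nv ''n'')
     (Cond (BAnd (nonzero (NVar ''adj'' (cell u ''w''))) (nonzero (NVar ''adj'' (cell v ''w''))))
       (set_var ''t'' (NConst 1)) Skip)) ?s (n * ((1 + 1) + 3) + 3) (?I (Suc n))"
  proof (rule dsim_For)
    show "?I 1 (set_nat ''w'' 0 1 ?s)" by (simp add: mem_simps)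
  next
    fix k s' assume I: "?I k s'"
    have "fst s' ''n'' = fst s ''n''" using same_fst[of "{''t'', ''w''}" s s' "''n''"] I by simp
    then show "fst s' ''w'' 0 = k \<and> nval (nv ''n'') s' = n" using I core by (simp add: core_def)
  next
    fix k s' assume k: "1 \<le> k" "k \<le> n" and I: "?I k s'"
    have same: "same {''t'', ''w''} s s'" using I by simp
    have core': "core n p S s'" by (rule core_same[OF core same]) simp
    have adj': "fst s' ''adj'' = fst s ''adj''" using same by (simp add: same_fst)
    have uv': "fst s' u 0 = a" "fst s' v 0 = b" using same_fst[OF same] uv ab by auto
    have cells: "nval (cell u ''w'') s' = n * a + k" "nval (cell v ''w'') s' = n * b + k"
      using nval_cell[OF core'] uv' ab I by simp_all
    have bv: "bval (BAnd (nonzero (NVar ''adj'' (cell u ''w''))) (nonzero (NVar ''adj'' (cell v ''w'')))) s'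
        \<longleftrightarrow> {a, k} \<in> G \<and> {b, k} \<in> G"
      using adj ab k by (simp add: cells adj' represents_def)
    have st: "{1..<Suc k} = insert k {1..<k}" using k by auto
    show "dsim (Cond (BAnd (nonzero (NVar ''adj'' (cell u ''w''))) (nonzero (NVar ''adj'' (cell v ''w''))))
       (set_var ''t'' (NConst 1)) Skip) s' (1 + 1)
       (\<lambda>s'. fst s' ''w'' 0 = k \<and> ?I (Suc k) (set_nat ''w'' 0 (Suc k) s'))"
    proof (intro sim_Cond sim_AssignN sim_Skip, unfold bv)
      assume "{a, k} \<in> G \<and> {b, k} \<in> G"
      then show "fst (set_nat ''t'' (nval (NConst 0) s') (nval (NConst 1) s') s') ''w'' 0 = k \<and>
          ?I (Suc k) (set_nat ''w'' 0 (Suc k) (set_nat ''t'' (nval (NConst 0) s') (nval (NConst 1) s') s'))"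
        using I unfolding st by (simp add: mem_simps)
    next
      assume "\<not> ({a, k} \<in> G \<and> {b, k} \<in> G)"
      then show "fst s' ''w'' 0 = k \<and> ?I (Suc k) (set_nat ''w'' 0 (Suc k) s')"
        using I unfolding st by (simp add: mem_simps)
    qed
  qed
  then have "dsim (closes_com u v) s (1 + (n * ((1 + 1) + 3) + 3) + 1) (?I (Suc n))"
    unfolding closes_com_def
    by (intro sim_Seq_det[where ?Q1.0 = "\<lambda>s'. s' = ?s"] sim_AssignN) auto
  then show ?thesis by (rule sim_mono) (auto simp: atLeastLessThanSuc_atLeastAtMost)
qed

definition write_com :: "vname \<Rightarrow> vname \<Rightarrow> vname \<Rightarrow> nat \<Rightarrow> com" where
  "write_com arr u v b = Seq (AssignN arr (cell u v) (NConst b)) (AssignN arr (cell v u) (NConst b))"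

lemma dsim_write:
  assumes core: "core n p S s" and rep: "represents n (fst s arr) G"
    and ab: "fst s u 0 = i" "fst s v 0 = j" "i \<in> {1..n}" "j \<in> {1..n}"
    and arr: "arr \<notin> {''n'', ''p'', ''S'', ''mul'', u, v}"
  shows "dsim (write_com arr u v b) s 3
    (\<lambda>s'. represents n (fst s' arr) (if b \<noteq> 0 then insert {i, j} G else G - {{i, j}}) \<and> same {arr} s s')"
proof -
  let ?s = "set_nat arr (n * i + j) b s"
  have 1: "nval (cell u v) s = n * i + j" using nval_cell[OF core] ab by simp
  have "core n p S ?s" by (rule core_same[OF core, where V = "{arr}"]) (use arr in auto)
  moreover have uv: "fst ?s u = fst s u" "fst ?s v = fst s v" using arr by (auto simp: mem_simps)
  ultimately have 2: "nval (cell v u) ?s = n * j + i" using nval_cell[of n p S ?s v u] ab by simp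
  have "dsim (write_com arr u v b) s (1 + 1 + 1)
    (\<lambda>s'. represents n (fst s' arr) (if b \<noteq> 0 then insert {i, j} G else G - {{i, j}}) \<and> same {arr} s s')"
    unfolding write_com_def
    by (rule sim_Seq_det[where ?Q1.0 = "\<lambda>s'. s' = ?s"], rule sim_AssignN, simp add: 1,
        rule sim_AssignN) (use represents_update[OF rep ab(3,4), of b] 2 in \<open>simp add: mem_simps\<close>)
  then show ?thesis by (rule sim_mono) auto
qed

definition glauber_com :: com where
  "glauber_com = Seq (pick_com ''u'') (Seq (pick_com ''v'') (Seq (closes_com ''u'' ''v'')
     (Seq (Toss ''b'' (NConst 0) (rv ''p''))
       (Cond (nonzero (NVar ''host'' (cell ''u'' ''v'')))
         (Cond (BAnd (nonzero (nv ''b'')) (BNot (nonzero (nv ''t''))))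
           (write_com ''adj'' ''u'' ''v'' 1) (write_com ''adj'' ''u'' ''v'' 0)) Skip))))"

text \<open>Equal vertices give a singleton, which lies in no host graph, so that step is idle.
  Redrawing until they differ would have no sure bound on the time.\<close>

definition random_pair :: "nat \<Rightarrow> nat set pmf" where
  "random_pair n = bind_pmf (pmf_of_set {1..n}) (\<lambda>u. map_pmf (\<lambda>v. {u, v}) (pmf_of_set {1..n}))"

definition random_update :: "nat \<Rightarrow> real \<Rightarrow> (nat set \<times> bool) pmf" where
  "random_update n p = pair_pmf (random_pair n) (bernoulli_pmf p)"

abbreviation "glauber_vars \<equiv> {''k'', ''c'', ''u'', ''v'', ''w'', ''t'', ''b'', ''adj''}"

text \<open>Edges of \<open>G\<close> have two elements, both in \<open>{1..n}\<close>, so the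
  search over all \<open>w\<close> cannot succeed at \<open>a\<close> or \<open>b\<close> and misses
  no vertex.\<close>

lemma closes_iff:
  assumes "H \<subseteq> pairs n" "G \<in> constrained triangle_free H" "{a, b} \<in> pairs n"
  shows "(\<exists>w\<in>{1..n}. {a, w} \<in> G \<and> {b, w} \<in> G) \<longleftrightarrow> \<not> triangle_free (insert {a, b} G)"
proof -
  have G: "triangle_free G" "G \<subseteq> pairs n" using assms by (auto simp: constrained_def)
  have ne: "a \<noteq> b" using assms(3) by (auto simp: pairs_def)
  have "w \<noteq> a \<and> w \<noteq> b \<and> w \<in> {1..n}" if "{a, w} \<in> G" "{b, w} \<in> G" for w
    using that G(2) by (auto simp: pairs_def)
  then show ?thesis unfolding triangle_free_insert_iff[OF G(1) ne] by blast
qed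

lemma sim_glauber:
  assumes n: "1 \<le> n" and core: "core n p S s" and host: "represents n (fst s ''host'') H"
    and adj: "represents n (fst s ''adj'') G"
    and H: "H \<subseteq> pairs n" and G: "G \<in> constrained triangle_free H"
  shows "sim glauber_com s (19 * n + 21)
    (map_pmf (\<lambda>r. update triangle_free H r G) (random_update n p))
    (\<lambda>s' G'. G' \<in> constrained triangle_free H \<and> represents n (fst s' ''adj'') G' \<and> same glauber_vars s s')"
    (is "sim _ _ _ _ ?Q")
proof -
  let ?U = "pmf_of_set {1..n}"
  let ?accept = "BAnd (nonzero (nv ''b'')) (BNot (nonzero (nv ''t'')))"
  let ?in_host = "nonzero (NVar ''host'' (cell ''u'' ''v''))"
  let ?write = "Cond ?accept (write_com ''adj'' ''u'' ''v'' 1) (write_com ''adj'' ''u'' ''v'' 0)"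
  let ?resample = "Seq (Toss ''b'' (NConst 0) (rv ''p'')) (Cond ?in_host ?write Skip)"
  let ?G' = "\<lambda>u v b. update triangle_free H ({u, v}, b) G"
  let ?L = "\<lambda>u v. bind_pmf (bernoulli_pmf p) (\<lambda>b. return_pmf (?G' u v b))"
  have eq: "map_pmf (\<lambda>r. update triangle_free H r G) (random_update n p) =
      bind_pmf ?U (\<lambda>u. bind_pmf ?U (\<lambda>v. ?L u v))"
    by (simp add: random_update_def random_pair_def pair_pmf_def map_pmf_def bind_assoc_pmf bind_return_pmf)
  have "sim glauber_com s ((7 * n + 3) + ((7 * n + 3) + ((5 * n + 5) + (1 + ((3 + 1) + 1) + 1) + 1) + 1) + 1)
    (bind_pmf ?U (\<lambda>u. bind_pmf ?U (\<lambda>v. ?L u v))) ?Q"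
    unfolding glauber_com_def
  proof (rule sim_Seq)
    show "sim (pick_com ''u'') s (7 * n + 3) ?U
        (\<lambda>s' a. a \<in> {1..n} \<and> fst s' ''u'' 0 = a \<and> same {''k'', ''c'', ''u''} s s')"
      by (rule sim_pick) (use n core in \<open>auto simp: core_def\<close>)
  next
    fix s1 u assume s1: "u \<in> {1..n} \<and> fst s1 ''u'' 0 = u \<and> same {''k'', ''c'', ''u''} s s1"
    have core1: "core n p S s1" by (rule core_same[OF core, of "{''k'', ''c'', ''u''}"]) (use s1 in auto)
    show "sim (Seq (pick_com ''v'') (Seq (closes_com ''u'' ''v'')
     (?resample)))
       s1 ((7 * n + 3) + ((5 * n + 5) + (1 + ((3 + 1) + 1) + 1) + 1) + 1)
      (bind_pmf ?U (\<lambda>v. ?L u v)) ?Q"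
    proof (rule sim_Seq)
      show "sim (pick_com ''v'') s1 (7 * n + 3) ?U
          (\<lambda>s' a. a \<in> {1..n} \<and> fst s' ''v'' 0 = a \<and> same {''k'', ''c'', ''v''} s1 s')"
        by (rule sim_pick) (use n core1 in \<open>auto simp: core_def\<close>)
    next
      fix s2 v assume s2: "v \<in> {1..n} \<and> fst s2 ''v'' 0 = v \<and> same {''k'', ''c'', ''v''} s1 s2"
      have same2: "same {''k'', ''c'', ''u'', ''v''} s s2"
        using s1 s2 by (simp add: same_def)
      have core2: "core n p S s2" by (rule core_same[OF core same2]) simp
      have adj2: "represents n (fst s2 ''adj'') G" using adj same2 by (simp add: same_fst)
      have u2: "fst s2 ''u'' 0 = u" using s1 s2 by (simp add: same_def)
      show "sim (Seq (closes_com ''u'' ''v'')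
        (?resample))
         s2 ((5 * n + 5) + (1 + ((3 + 1) + 1) + 1) + 1)
        (?L u v) ?Q"
      proof (rule sim_Seq_det)
        show "dsim (closes_com ''u'' ''v'') s2 (5 * n + 5)
           (\<lambda>s'. fst s' ''t'' 0 = of_bool (\<exists>w\<in>{1..n}. {u, w} \<in> G \<and> {v, w} \<in> G) \<and> same {''t'', ''w''} s2 s')"
          by (rule dsim_closes[OF core2 adj2 u2]) (use s1 s2 in auto)
      next
        fix s3 assume s3: "fst s3 ''t'' 0 = of_bool (\<exists>w\<in>{1..n}. {u, w} \<in> G \<and> {v, w} \<in> G) \<and> same {''t'', ''w''} s2 s3"
        show "sim (?resample)
         s3 (1 + ((3 + 1) + 1) + 1)
        (?L u v) ?Q"
        proof (rule sim_Seq)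
          have "snd s3 ''p'' 0 = p" using s3 core2 by (simp add: same_def core_def)
          then show "sim (Toss ''b'' (NConst 0) (rv ''p'')) s3 1 (bernoulli_pmf p)
              (\<lambda>s' b. s' = set_nat ''b'' 0 (of_bool b) s3)"
            using sim_Toss[of "''b''" "NConst 0" "rv ''p''" s3] by simp
        next
          fix s4 b assume s4: "s4 = set_nat ''b'' 0 (of_bool b) s3"
          have same4: "same {''k'', ''c'', ''u'', ''v'', ''t'', ''w'', ''b''} s s4"
            using same2 s3 by (simp add: s4 same_def mem_simps)
          have core4: "core n p S s4" by (rule core_same[OF core same4]) simp
          have adj4: "represents n (fst s4 ''adj'') G" using adj same4 by (simp add: same_fst)
          have u4: "fst s4 ''u'' 0 = u" "fst s4 ''v'' 0 = v"
            using u2 s2 s3 by (simp_all add: s4 mem_simps same_def)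
          have uv: "u \<in> {1..n}" "v \<in> {1..n}" using s1 s2 by auto
          have "fst s4 ''host'' = fst s ''host''" using same4 by (simp add: same_fst)
          then have host4: "bval ?in_host s4 \<longleftrightarrow> {u, v} \<in> H"
            using nval_cell[OF core4, of "''u''" "''v''"] u4 uv host by (simp add: represents_def)
          \<comment> \<open>For \<open>u = v\<close> the flag \<open>t\<close> says nothing about
            triangles, but then the singleton is not in \<open>H\<close> and the outer test discards
            it.\<close>
          have b4: "bval ?accept s4 \<longleftrightarrow>
              b \<and> triangle_free (insert {u, v} G)" if "{u, v} \<in> H"
            using s3 closes_iff[OF H G] that H by (simp add: s4 mem_simps subset_iff)
          have st: "?G' u v b \<in> constrained triangle_free H"
            by (rule update_constrained[OF down_closed_triangle_free G])
          have wr: "dsim (write_com ''adj'' ''u'' ''v'' x) s4 3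
              (\<lambda>s'. represents n (fst s' ''adj'') (if x \<noteq> 0 then insert {u, v} G else G - {{u, v}}) \<and> same {''adj''} s4 s')" for x
            by (rule dsim_write[OF core4 adj4 u4 uv]) simp
          have wr': "dsim (write_com ''adj'' ''u'' ''v'' x) s4 3 (\<lambda>s'. ?Q s' (?G' u v b))"
            if "?G' u v b = (if x \<noteq> 0 then insert {u, v} G else G - {{u, v}})" for x
          proof (rule sim_mono[OF wr order_refl])
            fix s' assume *: "represents n (fst s' ''adj'') (if x \<noteq> 0 then insert {u, v} G else G - {{u, v}}) \<and> same {''adj''} s4 s'"
            have "same glauber_vars s s'"
              by (rule same_trans[OF same_mono[OF same4] same_mono]) (use * in auto)
            then show "?Q s' (?G' u v b)" using that st * by simp
          qed
          show "sim (Cond ?in_host ?write Skip)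
             s4 ((3 + 1) + 1) (return_pmf (?G' u v b)) ?Q"
          proof (rule sim_return, intro sim_Cond)
            assume a: "bval ?in_host s4"
              "bval ?accept s4"
            show "dsim (write_com ''adj'' ''u'' ''v'' 1) s4 3 (\<lambda>s'. ?Q s' (?G' u v b))"
              by (rule wr') (use a host4 b4 in \<open>simp add: update_def\<close>)
          next
            assume a: "bval ?in_host s4"
              "\<not> bval ?accept s4"
            have "{u, v} \<in> H" "\<not> (b \<and> triangle_free (insert {u, v} G))" using a host4 b4 by blast+
            then have "?G' u v b = G - {{u, v}}" unfolding update_def by auto
            then show "dsim (write_com ''adj'' ''u'' ''v'' 0) s4 3 (\<lambda>s'. ?Q s' (?G' u v b))"
              by (intro wr') simp
          next
            assume "\<not> bval ?in_host s4"
            then have "?G' u v b = G" using host4 by (simp add: update_def)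
            then have "?Q s4 (?G' u v b)"
              using G adj4 same_mono[OF same4] by simp
            then show "dsim Skip s4 (3 + 1) (\<lambda>s'. ?Q s' (?G' u v b))"
              by (rule dsim_Skip[where Q = "\<lambda>s'. ?Q s' (?G' u v b)"]) simp
          qed
        qed
      qed
    qed
  qed
  then show ?thesis unfolding eq by (rule sim_mono) auto
qed

lemma iterM_random_map_chain:
  "iterM (\<lambda>_ x. map_pmf (\<lambda>r. f r x) R) t k x = random_map_chain R f t x"
proof (induction t)
  case (Suc t)
  show ?case unfolding iterM_Suc_right Suc random_map_chain.simps ..
qed simp

definition triangle_free_sample :: "nat \<Rightarrow> real \<Rightarrow> graph \<Rightarrow> nat \<Rightarrow> graph pmf" where
  "triangle_free_sample n p H t = random_map_chain (random_update n p) (update triangle_free H) t {}"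

text \<open>The loop bound evaluates to \<open>n * n + n\<close>, the largest cell in use. Clearing
  up to it restarts the chain from the empty graph, so that successive samples are
  independent.\<close>

definition sample_com :: com where
  "sample_com = Seq (For ''z'' (NAdd (NVar ''mul'' (nv ''n'')) (nv ''n'')) (AssignN ''adj'' (nv ''z'') (NConst 0)))
     (For ''r'' (nv ''S'') glauber_com)"

abbreviation "sample_vars \<equiv> {''z'', ''r''} \<union> glauber_vars"

definition sample_time :: "nat \<Rightarrow> nat \<Rightarrow> nat" where
  "sample_time n S = 4 * (n * n + n) + S * (19 * n + 24) + 7"

lemma sim_sample:
  assumes n: "1 \<le> n" and core: "core n p S s" and host: "represents n (fst s ''host'') H" and H: "H \<subseteq> pairs n"
  shows "sim sample_com s (sample_time n S) (triangle_free_sample n p H S)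
    (\<lambda>s' G. G \<in> constrained triangle_free H \<and> represents n (fst s' ''adj'') G \<and> same sample_vars s s')"
proof -
  let ?I = "\<lambda>k s'. fst s' ''z'' 0 = k \<and> same {''z'', ''adj''} s s' \<and> (\<forall>c. 1 \<le> c \<longrightarrow> c < k \<longrightarrow> fst s' ''adj'' c = 0)"
  let ?J = "\<lambda>k s' G. fst s' ''r'' 0 = k \<and> G \<in> constrained triangle_free H \<and>
    represents n (fst s' ''adj'') G \<and> same sample_vars s s'"
  let ?step = "\<lambda>G. map_pmf (\<lambda>r. update triangle_free H r G) (random_update n p)"
  have clear: "dsim (For ''z'' (NAdd (NVar ''mul'' (nv ''n'')) (nv ''n'')) (AssignN ''adj'' (nv ''z'') (NConst 0)))
      s ((n * n + n) * (1 + 3) + 3) (?I (Suc (n * n + n)))"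
  proof (rule dsim_For)
    show "?I 1 (set_nat ''z'' 0 1 s)" by (simp add: mem_simps)
  next
    fix k s' assume I: "?I k s'"
    then have "core n p S s'" by (intro core_same[OF core, of "{''z'', ''adj''}"]) auto
    then show "fst s' ''z'' 0 = k \<and> nval (NAdd (NVar ''mul'' (nv ''n'')) (nv ''n'')) s' = n * n + n"
      using I by (simp add: core_def)
  next
    fix k s' assume k: "1 \<le> k" "k \<le> n * n + n" and I: "?I k s'"
    show "dsim (AssignN ''adj'' (nv ''z'') (NConst 0)) s' 1
        (\<lambda>s'. fst s' ''z'' 0 = k \<and> ?I (Suc k) (set_nat ''z'' 0 (Suc k) s'))"
      by (rule sim_AssignN) (use I in \<open>auto simp: mem_simps less_Suc_eq\<close>)
  qed
  have "sim sample_com s (((n * n + n) * (1 + 3) + 3) + (S * ((19 * n + 21) + 3) + 3) + 1)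
      (iterM (\<lambda>_. ?step) S 1 {}) (?J (Suc S))"
    unfolding sample_com_def
  proof (rule sim_Seq_det[OF clear])
    fix s1 assume s1: "?I (Suc (n * n + n)) s1"
    have same1: "same sample_vars s s1" by (rule same_mono[of "{''z'', ''adj''}"]) (use s1 in auto)
    have adj1: "represents n (fst s1 ''adj'') {}"
    proof -
      have "fst s1 ''adj'' (n * i + j) = 0" if "i \<in> {1..n}" "j \<in> {1..n}" for i j
      proof -
        have "n * i + j \<le> n * n + n" by (rule add_mono) (use that in auto)
        then have "1 \<le> n * i + j" "n * i + j < Suc (n * n + n)" using that by auto
        then show ?thesis using s1 by blast
      qed
      then show ?thesis by (simp add: represents_def)
    qed
    show "sim (For ''r'' (nv ''S'') glauber_com) s1 (S * ((19 * n + 21) + 3) + 3)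
        (iterM (\<lambda>_. ?step) S 1 {}) (?J (Suc S))"
    proof (rule sim_For)
      have "{} \<in> constrained triangle_free H" by (simp add: constrained_def triangle_free_def)
      then show "?J 1 (set_nat ''r'' 0 1 s1) {}" using adj1 same1 by (simp add: mem_simps)
    next
      fix k s' G assume J: "?J k s' G"
      have "core n p S s'" by (rule core_same[OF core, of sample_vars]) (use J in auto)
      then show "fst s' ''r'' 0 = k \<and> nval (nv ''S'') s' = S" using J by (simp add: core_def)
    next
      fix k s' G assume J: "?J k s' G"
      have same': "same sample_vars s s'" using J by blast
      have core': "core n p S s'" by (rule core_same[OF core same']) simp
      have "fst s' ''host'' = fst s ''host''" by (rule same_fst[OF same']) simp
      then have host': "represents n (fst s' ''host'') H" using host by simp
      show "sim glauber_com s' (19 * n + 21) (?step G)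
          (\<lambda>s' G'. fst s' ''r'' 0 = k \<and> ?J (Suc k) (set_nat ''r'' 0 (Suc k) s') G')"
      proof (rule sim_mono[OF sim_glauber[OF n core' host' _ H]])
        show "represents n (fst s' ''adj'') G" "G \<in> constrained triangle_free H" using J by auto
        fix s'' G'
        assume *: "G' \<in> constrained triangle_free H \<and> represents n (fst s'' ''adj'') G' \<and> same glauber_vars s' s''"
        have "fst s'' ''r'' = fst s' ''r''" by (rule same_fst[of glauber_vars]) (use * in auto)
        moreover have "same sample_vars s s''"
          by (rule same_trans[OF same' same_mono[of glauber_vars]]) (use * in auto)
        ultimately show "fst s'' ''r'' 0 = k \<and> ?J (Suc k) (set_nat ''r'' 0 (Suc k) s'') G'"
          using * J by (simp add: mem_simps)
      qed simp
    qed
  qed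
  then have "sim sample_com s (((n * n + n) * (1 + 3) + 3) + (S * ((19 * n + 21) + 3) + 3) + 1)
      (triangle_free_sample n p H S) (?J (Suc S))"
    unfolding iterM_random_map_chain triangle_free_sample_def .
  then show ?thesis by (rule sim_mono) (auto simp: sample_time_def)
qed

section \<open>Estimating one ratio of partition functions\<close>

definition closure_count :: "nat \<Rightarrow> real \<Rightarrow> graph \<Rightarrow> nat \<Rightarrow> nat set \<Rightarrow> nat \<Rightarrow> nat pmf" where
  "closure_count n p H S e m = iterM (\<lambda>_ c. map_pmf (\<lambda>G. c + of_bool (\<not> triangle_free (insert e G)))
     (triangle_free_sample n p H S)) m 1 0"

text \<open>\<open>S\<close> is both the length of each run and the number of runs, so the program
  has a single parameter to compute.\<close>

definition ratio_com :: com where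
  "ratio_com = Seq (set_var ''cnt'' (NConst 0)) (Seq
     (For ''a'' (nv ''S'') (Seq sample_com (Seq (closes_com ''i'' ''j'') (set_var ''cnt'' (NAdd (nv ''cnt'') (nv ''t''))))))
     (AssignR ''M'' (NConst 0) (RMul (rv ''M'') (RSub (RNat (NConst 1))
       (RMul (rv ''p'') (RDiv (RNat (nv ''cnt'')) (RNat (nv ''S''))))))))"

abbreviation "ratio_vars \<equiv> {''cnt'', ''a'', ''M''} \<union> sample_vars"

definition ratio_time :: "nat \<Rightarrow> nat \<Rightarrow> nat" where
  "ratio_time n S = S * (sample_time n S + 5 * n + 11) + 7"

lemma sim_ratio:
  assumes n: "1 \<le> n" and core: "core n p S s" and host: "represents n (fst s ''host'') H" and H: "H \<subseteq> pairs n"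
    and ij: "fst s ''i'' 0 = i" "fst s ''j'' 0 = j" "1 \<le> i" "i < j" "j \<le> n" and x: "snd s ''M'' 0 = x"
  shows "sim ratio_com s (ratio_time n S)
    (map_pmf (\<lambda>c. x * (1 - p * (real c / real S))) (closure_count n p H S {i, j} S))
    (\<lambda>s' y. snd s' ''M'' 0 = y \<and> same ratio_vars s s')"
proof -
  let ?V = "{''cnt'', ''a''} \<union> sample_vars"
  let ?I = "\<lambda>k s' c. fst s' ''a'' 0 = k \<and> fst s' ''cnt'' 0 = c \<and> same ?V s s'"
  let ?test = "Seq (closes_com ''i'' ''j'') (set_var ''cnt'' (NAdd (nv ''cnt'') (nv ''t'')))"
  let ?body = "Seq sample_com ?test"
  let ?loop = "For ''a'' (nv ''S'') ?body"
  let ?mult = "AssignR ''M'' (NConst 0) (RMul (rv ''M'') (RSub (RNat (NConst 1))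
    (RMul (rv ''p'') (RDiv (RNat (nv ''cnt'')) (RNat (nv ''S''))))))"
  let ?L = "map_pmf (\<lambda>c. x * (1 - p * (real c / real S))) (closure_count n p H S {i, j} S)"
  let ?Q = "\<lambda>s' y. snd s' ''M'' 0 = y \<and> same ratio_vars s s'"
  let ?J = "\<lambda>k c G s'. fst s' ''a'' 0 = k \<and> ?I (Suc k) (set_nat ''a'' 0 (Suc k) s') (c + of_bool (\<not> triangle_free (insert {i, j} G)))"
  let ?T = "S * ((sample_time n S + ((5 * n + 5) + 1 + 1) + 1) + 3) + 3"
  let ?f = "\<lambda>c. map_pmf (\<lambda>G. c + of_bool (\<not> triangle_free (insert {i, j} G))) (triangle_free_sample n p H S)"
  have ijp: "{i, j} \<in> pairs n" using ij by (auto simp: pairs_def)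
  have loop: "sim (?loop)
      s1 ?T (closure_count n p H S {i, j} S) (?I (Suc S))"
    if s1: "s1 = set_nat ''cnt'' 0 0 s" for s1
    unfolding closure_count_def
  proof (rule sim_For)
    show "?I 1 (set_nat ''a'' 0 1 s1) 0" by (simp add: s1 mem_simps)
  next
    fix k s' c assume I: "?I k s' c"
    have "core n p S s'" by (rule core_same[OF core, of ?V]) (use I in auto)
    then show "fst s' ''a'' 0 = k \<and> nval (nv ''S'') s' = S" using I by (simp add: core_def)
  next
    fix k s' c assume I: "?I k s' c"
    have same': "same ?V s s'" using I by blast
    have core': "core n p S s'" by (rule core_same[OF core same']) simp
    have "fst s' ''host'' = fst s ''host''" by (rule same_fst[OF same']) simp
    then have host': "represents n (fst s' ''host'') H" using host by simp
    show "sim (?body) s'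
        (sample_time n S + ((5 * n + 5) + 1 + 1) + 1) (?f c)
        (\<lambda>s' c. fst s' ''a'' 0 = k \<and> ?I (Suc k) (set_nat ''a'' 0 (Suc k) s') c)"
    proof (rule sim_Seq_return[OF sim_sample[OF n core' host' H]])
      fix s2 G
      assume s2: "G \<in> constrained triangle_free H \<and> represents n (fst s2 ''adj'') G \<and> same sample_vars s' s2"
      have same2: "same sample_vars s' s2" using s2 by blast
      have core2: "core n p S s2" by (rule core_same[OF core' same2]) simp
      have ij2: "fst s2 ''i'' 0 = i" "fst s2 ''j'' 0 = j"
        using ij same_fst[OF same', of "''i''"] same_fst[OF same2, of "''i''"]
          same_fst[OF same', of "''j''"] same_fst[OF same2, of "''j''"] by simp_all
      have cnt2: "fst s2 ''cnt'' 0 = c" "fst s2 ''a'' 0 = k"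
        using I same_fst[OF same2, of "''cnt''"] same_fst[OF same2, of "''a''"] by simp_all
      show "dsim (?test) s2 ((5 * n + 5) + 1 + 1)
          (?J k c G)"
      proof (rule sim_Seq_det)
        show "dsim (closes_com ''i'' ''j'') s2 (5 * n + 5)
           (\<lambda>s'. fst s' ''t'' 0 = of_bool (\<exists>w\<in>{1..n}. {i, w} \<in> G \<and> {j, w} \<in> G) \<and> same {''t'', ''w''} s2 s')"
          by (rule dsim_closes[OF core2 _ ij2]) (use s2 ij in auto)
      next
        fix s3 assume s3: "fst s3 ''t'' 0 = of_bool (\<exists>w\<in>{1..n}. {i, w} \<in> G \<and> {j, w} \<in> G) \<and> same {''t'', ''w''} s2 s3"
        have same3: "same {''t'', ''w''} s2 s3" using s3 by blast
        have t: "fst s3 ''t'' 0 = of_bool (\<not> triangle_free (insert {i, j} G))"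
          using s3 closes_iff[OF H _ ijp, of G] s2 by simp
        have cnt3: "fst s3 ''cnt'' 0 = c" "fst s3 ''a'' 0 = k"
          using cnt2 same_fst[OF same3, of "''cnt''"] same_fst[OF same3, of "''a''"] by simp_all
        have "same ?V s s3"
          by (rule same_trans[OF same' same_trans[OF same_mono[OF same2] same_mono[OF same3]]]) auto
        then show "dsim (set_var ''cnt'' (NAdd (nv ''cnt'') (nv ''t''))) s3 1
            (?J k c G)"
          by (intro sim_AssignN) (use t cnt3 in \<open>simp add: mem_simps\<close>)
      qed
    qed
  qed
  have "sim ratio_com s (1 + (?T + 1 + 1) + 1)
    ?L ?Q"
    unfolding ratio_com_def
  proof (rule sim_Seq_det)
    show "dsim (set_var ''cnt'' (NConst 0)) s 1 (\<lambda>s'. s' = set_nat ''cnt'' 0 0 s)"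
      by (rule sim_AssignN) simp
  next
    fix s1 assume s1: "s1 = set_nat ''cnt'' 0 0 s"
    show "sim (Seq (?loop)
     (?mult)) s1
      (?T + 1 + 1)
      ?L ?Q"
    proof (rule sim_Seq_return[OF loop[OF s1]])
      fix s2 c assume I: "?I (Suc S) s2 c"
      have same2: "same ?V s s2" using I by blast
      have core2: "core n p S s2" by (rule core_same[OF core same2]) simp
      have M2: "snd s2 ''M'' 0 = x" using x same_snd[OF same2, of "''M''"] by simp
      have "same ratio_vars s s2" by (rule same_mono[OF same2]) auto
      then show "dsim (?mult) s2 1
         (\<lambda>s'. snd s' ''M'' 0 = x * (1 - p * (real c / real S)) \<and> same ratio_vars s s')"
        by (intro sim_AssignR) (use I M2 core2 in \<open>simp add: mem_simps core_def\<close>)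
    qed
  qed
  then show ?thesis by (rule sim_mono) (auto simp: ratio_time_def)
qed

section \<open>The telescoping product over all pairs\<close>

text \<open>The host graph at stage \<open>(i, j)\<close>. The order is that of two nested loops, so
  the end of one row is the start of the next.\<close>

definition pairs_before :: "nat \<Rightarrow> nat \<Rightarrow> nat \<Rightarrow> graph" where
  "pairs_before n i j = {{a, b} |a b. 1 \<le> a \<and> a < b \<and> b \<le> n \<and> (a < i \<or> a = i \<and> b < j)}"

lemma pairs_before_subset: "pairs_before n i j \<subseteq> pairs n"
  by (auto simp: pairs_before_def pairs_def)

lemma pairs_before_start: "pairs_before n 1 1 = {}"
  by (auto simp: pairs_before_def)

lemma pairs_before_Suc:
  assumes "1 \<le> i" "j \<le> n"
  shows "pairs_before n i (Suc j) = (if i < j then insert {i, j} (pairs_before n i j) else pairs_before n i j)"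
  using assms unfolding pairs_before_def by (auto simp: less_Suc_eq)

lemma pairs_before_row: "pairs_before n i (Suc n) = pairs_before n (Suc i) 1"
  unfolding pairs_before_def by (intro Collect_cong ex_cong1) (auto simp: less_Suc_eq)

lemma pairs_before_end: "pairs_before n (Suc n) 1 = pairs n"
proof (intro equalityI subsetI)
  fix e assume "e \<in> pairs n"
  then obtain u v where uv: "e = {u, v}" "u \<noteq> v" "u \<in> {1..n}" "v \<in> {1..n}" by (rule pairsE)
  have "e = {min u v, max u v}" "min u v < max u v" "1 \<le> min u v" "max u v \<le> n"
    using uv by (auto simp: min_def max_def)
  then show "e \<in> pairs_before n (Suc n) 1" unfolding pairs_before_def by fastforce
qed (use pairs_before_subset in auto)

lemma pair_notin_before: "i < j \<Longrightarrow> {i, j} \<notin> pairs_before n i j"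
  by (auto simp: pairs_before_def doubleton_eq_iff)

definition ratio_law :: "nat \<Rightarrow> real \<Rightarrow> nat \<Rightarrow> nat \<Rightarrow> nat \<Rightarrow> real \<Rightarrow> real pmf" where
  "ratio_law n p S i j x = (if i < j
     then map_pmf (\<lambda>c. x * (1 - p * (real c / real S))) (closure_count n p (pairs_before n i j) S {i, j} S)
     else return_pmf x)"

definition product_law :: "nat \<Rightarrow> real \<Rightarrow> nat \<Rightarrow> real pmf" where
  "product_law n p S = iterM (\<lambda>i. iterM (ratio_law n p S i) n 1) n 1 1"

definition pair_com :: com where
  "pair_com = Cond (NLess (nv ''i'') (nv ''j'')) (Seq ratio_com (write_com ''host'' ''i'' ''j'' 1)) Skip"

definition product_com :: com where
  "product_com = For ''i'' (nv ''n'') (For ''j'' (nv ''n'') pair_com)"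

abbreviation "product_vars \<equiv> {''i'', ''j'', ''host''} \<union> ratio_vars"

definition product_inv :: "nat \<Rightarrow> mem \<Rightarrow> nat \<Rightarrow> nat \<Rightarrow> mem \<Rightarrow> real \<Rightarrow> bool" where
  "product_inv n s i j s' x \<longleftrightarrow> fst s' ''i'' 0 = i \<and> snd s' ''M'' 0 = x \<and>
     represents n (fst s' ''host'') (pairs_before n i j) \<and> same product_vars s s'"

lemma product_inv_core:
  assumes "core n p S s" "product_inv n s i j s' x"
  shows "core n p S s'"
  by (rule core_same[OF assms(1), of product_vars]) (use assms(2) in \<open>auto simp: product_inv_def\<close>)

lemma sim_pair:
  assumes n: "1 \<le> n" and core: "core n p S s" and inv: "product_inv n s i j s' x"
    and ij: "1 \<le> i" "1 \<le> j" "j \<le> n" "fst s' ''j'' 0 = j"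
  shows "sim pair_com s' (ratio_time n S + 5) (ratio_law n p S i j x)
    (\<lambda>s'' y. fst s'' ''j'' 0 = j \<and> product_inv n s i (Suc j) s'' y)"
proof -
  have core': "core n p S s'" by (rule product_inv_core[OF core inv])
  have i': "fst s' ''i'' 0 = i" and M': "snd s' ''M'' 0 = x"
    and host': "represents n (fst s' ''host'') (pairs_before n i j)" and same': "same product_vars s s'"
    using inv by (auto simp: product_inv_def)
  let ?Q = "\<lambda>s'' y. fst s'' ''j'' 0 = j \<and> product_inv n s i (Suc j) s'' y"
  show ?thesis
  proof (cases "i < j")
    case True
    have "sim (Seq ratio_com (write_com ''host'' ''i'' ''j'' 1)) s' (ratio_time n S + 3 + 1)
        (map_pmf id (map_pmf (\<lambda>c. x * (1 - p * (real c / real S))) (closure_count n p (pairs_before n i j) S {i, j} S))) ?Q"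
    proof (rule sim_Seq_return[OF sim_ratio[OF n core' host' pairs_before_subset i' ij(4,1) True ij(3) M']])
      fix s2 y assume s2: "snd s2 ''M'' 0 = y \<and> same ratio_vars s' s2"
      have same2: "same ratio_vars s' s2" using s2 by blast
      have core2: "core n p S s2" by (rule core_same[OF core' same2]) simp
      have host2: "represents n (fst s2 ''host'') (pairs_before n i j)"
        using host' same_fst[OF same2, of "''host''"] by simp
      have ij2: "fst s2 ''i'' 0 = i" "fst s2 ''j'' 0 = j"
        using i' ij(4) same_fst[OF same2, of "''i''"] same_fst[OF same2, of "''j''"] by simp_all
      have "dsim (write_com ''host'' ''i'' ''j'' 1) s2 3
         (\<lambda>s'. represents n (fst s' ''host'') (if (1::nat) \<noteq> 0 then insert {i, j} (pairs_before n i j)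
             else pairs_before n i j - {{i, j}}) \<and> same {''host''} s2 s')"
        by (rule dsim_write[OF core2 host2 ij2]) (use ij True in auto)
      then show "dsim (write_com ''host'' ''i'' ''j'' 1) s2 3 (\<lambda>s''. ?Q s'' (id y))"
      proof (rule sim_mono[OF _ order_refl])
        fix s3 assume s3: "represents n (fst s3 ''host'') (if (1::nat) \<noteq> 0 then insert {i, j} (pairs_before n i j)
             else pairs_before n i j - {{i, j}}) \<and> same {''host''} s2 s3"
        have same3: "same {''host''} s2 s3" using s3 by blast
        have "same product_vars s s3"
          by (rule same_trans[OF same' same_trans[OF same_mono[OF same2] same_mono[OF same3]]]) auto
        moreover have "fst s3 ''i'' 0 = i" "fst s3 ''j'' 0 = j" "snd s3 ''M'' 0 = y"
          using s2 ij2 same_fst[OF same3, of "''i''"] same_fst[OF same3, of "''j''"]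
            same_snd[OF same3, of "''M''"] by simp_all
        ultimately show "?Q s3 (id y)"
          using s3 True ij by (simp add: product_inv_def pairs_before_Suc)
      qed
    qed
    moreover have "map_pmf id (map_pmf (\<lambda>c. x * (1 - p * (real c / real S)))
        (closure_count n p (pairs_before n i j) S {i, j} S)) = ratio_law n p S i j x"
      using True by (simp add: ratio_law_def pmf.map_id)
    ultimately have "sim (Seq ratio_com (write_com ''host'' ''i'' ''j'' 1)) s' (ratio_time n S + 3 + 1)
        (ratio_law n p S i j x) ?Q" by (simp only:)
    then have "sim (Seq ratio_com (write_com ''host'' ''i'' ''j'' 1)) s' (ratio_time n S + 4) (ratio_law n p S i j x) ?Q"
      by (rule sim_mono) simp_all
    then have "sim pair_com s' (ratio_time n S + 4 + 1) (ratio_law n p S i j x) ?Q"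
      unfolding pair_com_def by (rule sim_Cond) (use True i' ij in simp)
    then show ?thesis by (rule sim_mono) simp_all
  next
    case False
    then have "?Q s' x" using inv ij by (simp add: product_inv_def pairs_before_Suc)
    then have "dsim Skip s' (ratio_time n S + 4) (\<lambda>s'. ?Q s' x)"
      by (rule dsim_Skip[where Q = "\<lambda>s'. ?Q s' x"]) simp
    then have "sim Skip s' (ratio_time n S + 4) (return_pmf x) ?Q" by (rule sim_return)
    then have "sim pair_com s' (ratio_time n S + 4 + 1) (return_pmf x) ?Q"
      unfolding pair_com_def by (rule sim_Cond[rotated]) (use False i' ij in simp)
    moreover have "ratio_law n p S i j x = return_pmf x" using False by (simp add: ratio_law_def)
    ultimately have "sim pair_com s' (ratio_time n S + 4 + 1) (ratio_law n p S i j x) ?Q" by (simp only:)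
    then show ?thesis by (rule sim_mono) simp_all
  qed
qed

definition product_time :: "nat \<Rightarrow> nat \<Rightarrow> nat" where
  "product_time n S = n * (n * (ratio_time n S + 8) + 6) + 3"

lemma sim_product:
  assumes n: "1 \<le> n" and core: "core n p S s" and host: "fst s ''host'' = (\<lambda>_. 0)" and M: "snd s ''M'' 0 = 1"
  shows "sim product_com s (product_time n S) (product_law n p S)
    (\<lambda>s' x. snd s' ''M'' 0 = x \<and> represents n (fst s' ''host'') (pairs n) \<and> core n p S s')"
proof -
  have "sim product_com s (n * ((n * ((ratio_time n S + 5) + 3) + 3) + 3) + 3) (product_law n p S)
      (product_inv n s (Suc n) 1)"
    unfolding product_com_def product_law_def
  proof (rule sim_For)
    have "represents n (fst s ''host'') (pairs_before n 1 1)"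
      unfolding pairs_before_start by (simp add: represents_def host)
    then show "product_inv n s 1 1 (set_nat ''i'' 0 1 s) 1"
      using M by (simp add: product_inv_def mem_simps)
  next
    fix i s' x assume inv: "product_inv n s i 1 s' x"
    show "fst s' ''i'' 0 = i \<and> nval (nv ''n'') s' = n"
      using product_inv_core[OF core inv] inv by (simp add: product_inv_def core_def)
  next
    fix i s' x assume i: "1 \<le> i" "i \<le> n" and inv: "product_inv n s i 1 s' x"
    have "sim (For ''j'' (nv ''n'') pair_com) s' (n * ((ratio_time n S + 5) + 3) + 3) (iterM (ratio_law n p S i) n 1 x)
      ((\<lambda>j s' x. fst s' ''j'' 0 = j \<and> product_inv n s i j s' x) (Suc n))"
    proof (rule sim_For)
      show "fst (set_nat ''j'' 0 1 s') ''j'' 0 = 1 \<and> product_inv n s i 1 (set_nat ''j'' 0 1 s') x"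
        using inv by (simp add: product_inv_def mem_simps)
    next
      fix j s2 y assume J: "fst s2 ''j'' 0 = j \<and> product_inv n s i j s2 y"
      then have "core n p S s2" using product_inv_core[OF core] by blast
      then show "fst s2 ''j'' 0 = j \<and> nval (nv ''n'') s2 = n" using J by (simp add: core_def)
    next
      fix j s2 y assume j: "1 \<le> j" "j \<le> n" and J: "fst s2 ''j'' 0 = j \<and> product_inv n s i j s2 y"
      have "sim pair_com s2 (ratio_time n S + 5) (ratio_law n p S i j y)
          (\<lambda>s'' y. fst s'' ''j'' 0 = j \<and> product_inv n s i (Suc j) s'' y)"
        by (rule sim_pair[OF n core]) (use i j J in auto)
      then show "sim pair_com s2 (ratio_time n S + 5) (ratio_law n p S i j y)
          (\<lambda>s'' y. fst s'' ''j'' 0 = j \<and> fst (set_nat ''j'' 0 (Suc j) s'') ''j'' 0 = Suc j \<and>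
             product_inv n s i (Suc j) (set_nat ''j'' 0 (Suc j) s'') y)"
        by (rule sim_mono) (simp_all add: product_inv_def mem_simps)
    qed
    then show "sim (For ''j'' (nv ''n'') pair_com) s' (n * ((ratio_time n S + 5) + 3) + 3) (iterM (ratio_law n p S i) n 1 x)
      (\<lambda>s' x. fst s' ''i'' 0 = i \<and> product_inv n s (Suc i) 1 (set_nat ''i'' 0 (Suc i) s') x)"
      by (rule sim_mono) (simp_all add: product_inv_def mem_simps pairs_before_row)
  qed
  then show ?thesis
  proof (rule sim_mono)
    show "n * ((n * ((ratio_time n S + 5) + 3) + 3) + 3) + 3 \<le> product_time n S"
      by (simp add: product_time_def algebra_simps)
    fix s' x assume inv: "product_inv n s (Suc n) 1 s' x"
    then show "snd s' ''M'' 0 = x \<and> represents n (fst s' ''host'') (pairs n) \<and> core n p S s'"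
      using product_inv_core[OF core inv] by (simp only: product_inv_def pairs_before_end)
  qed
qed

section \<open>Initialization: the multiplication table and the parameter \<open>S\<close>\<close>

definition mul_com :: com where
  "mul_com = For ''i'' (nv ''n'')
     (AssignN ''mul'' (nv ''i'') (NAdd (NVar ''mul'' (NSub (nv ''i'') (NConst 1))) (nv ''n'')))"

text \<open>Reals cannot be rounded to integers, so the ceiling of \<open>1 / \<epsilon>\<close> is
  found by counting up, in time linear in \<open>1 / \<epsilon>\<close>, which the polynomial bound
  permits.\<close>

definition inverse_eps_com :: com where
  "inverse_eps_com = While (RLess (RMul (RNat (nv ''K'')) (rv ''eps'')) (RNat (NConst 1)))
     (set_var ''K'' (NAdd (nv ''K'') (NConst 1)))"

text \<open>Multiplies \<open>S\<close> by \<open>B\<close> through repeated addition. The number of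
  additions depends on \<open>B\<close> alone, so a round stays cheap however large \<open>S\<close>
  has become.\<close>

definition times_com :: com where
  "times_com = Seq (set_var ''y'' (NConst 0)) (Seq
     (For ''k'' (nv ''B'') (set_var ''y'' (NAdd (nv ''y'') (nv ''S'')))) (set_var ''S'' (nv ''y'')))"

primrec power_com :: "nat \<Rightarrow> com" where
  "power_com 0 = Skip"
| "power_com (Suc d) = Seq times_com (power_com d)"

text \<open>\<open>m\<close> and \<open>d\<close> are literals of the program: they may depend on
  \<open>c\<close> but not on the input.\<close>

definition init_com :: "nat \<Rightarrow> nat \<Rightarrow> com" where
  "init_com m d = Seq mul_com (Seq inverse_eps_com (Seq (set_var ''B'' (NAdd (nv ''n'') (nv ''K'')))
     (Seq (set_var ''S'' (NConst m)) (Seq (power_com d) (AssignR ''M'' (NConst 0) (RNat (NConst 1)))))))"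

lemma dsim_mul:
  assumes "fst s ''n'' 0 = n" "fst s ''mul'' 0 = 0"
  shows "dsim mul_com s (4 * n + 3) (\<lambda>s'. (\<forall>i\<le>n. fst s' ''mul'' i = n * i) \<and> same {''i'', ''mul''} s s')"
proof -
  let ?I = "\<lambda>k s'. fst s' ''i'' 0 = k \<and> (\<forall>i<k. fst s' ''mul'' i = n * i) \<and> same {''i'', ''mul''} s s'"
  have "dsim mul_com s (n * (1 + 3) + 3) (?I (Suc n))"
    unfolding mul_com_def
  proof (rule dsim_For)
    show "?I 1 (set_nat ''i'' 0 1 s)" using assms by (simp add: mem_simps)
  next
    fix k s' assume I: "?I k s'"
    then show "fst s' ''i'' 0 = k \<and> nval (nv ''n'') s' = n"
      using assms(1) same_fst[of "{''i'', ''mul''}" s s' "''n''"] by simp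
  next
    fix k s' assume k: "1 \<le> k" "k \<le> n" and I: "?I k s'"
    have n: "fst s' ''n'' 0 = n" using I assms(1) same_fst[of "{''i'', ''mul''}" s s' "''n''"] by simp
    have "fst s' ''mul'' (k - 1) = n * (k - 1)" using I k by simp
    also have "\<dots> + n = n * k" using k by (simp add: diff_mult_distrib2)
    finally have v: "nval (NAdd (NVar ''mul'' (NSub (nv ''i'') (NConst 1))) (nv ''n'')) s' = n * k"
      using I n k by (simp add: diff_mult_distrib2)
    show "dsim (AssignN ''mul'' (nv ''i'') (NAdd (NVar ''mul'' (NSub (nv ''i'') (NConst 1))) (nv ''n''))) s' 1
        (\<lambda>s'. fst s' ''i'' 0 = k \<and> ?I (Suc k) (set_nat ''i'' 0 (Suc k) s'))"
      by (rule sim_AssignN, unfold v) (use I in \<open>simp add: mem_simps less_Suc_eq\<close>)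
  qed
  then show ?thesis by (rule sim_mono) (auto simp: less_Suc_eq_le)
qed

lemma dsim_inverse_eps:
  assumes "fst s ''K'' 0 = 0" "snd s ''eps'' 0 = \<epsilon>" "0 < \<epsilon>"
  shows "dsim inverse_eps_com s (2 * nat \<lceil>1 / \<epsilon>\<rceil> + 1)
    (\<lambda>s'. fst s' ''K'' 0 = nat \<lceil>1 / \<epsilon>\<rceil> \<and> same {''K''} s s')"
proof -
  let ?I = "\<lambda>k s' (_::unit). fst s' ''K'' 0 = k \<and> same {''K''} s s'"
  have "sim inverse_eps_com s (nat \<lceil>1 / \<epsilon>\<rceil> * (1 + 1) + 1) (iterM (\<lambda>_. return_pmf) (nat \<lceil>1 / \<epsilon>\<rceil>) 0 ()) (?I (nat \<lceil>1 / \<epsilon>\<rceil>))"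
    unfolding inverse_eps_com_def
  proof (rule sim_While)
    fix k s' and a :: unit assume k: "0 \<le> k" "k < nat \<lceil>1 / \<epsilon>\<rceil>" and I: "?I k s' a"
    have eps: "snd s' ''eps'' 0 = \<epsilon>" using I assms(2) same_snd[of "{''K''}" s s' "''eps''"] by simp
    have "real k < 1 / \<epsilon>" using k(2) by linarith
    then have lt: "real k * \<epsilon> < 1" using assms(3) by (simp add: field_simps)
    have "sim (set_var ''K'' (NAdd (nv ''K'') (NConst 1))) s' 1 (return_pmf a) (?I (Suc k))"
      by (rule sim_AssignN) (use I in \<open>simp add: mem_simps\<close>)
    then show "bval (RLess (RMul (RNat (nv ''K'')) (rv ''eps'')) (RNat (NConst 1))) s' \<and>
        sim (set_var ''K'' (NAdd (nv ''K'') (NConst 1))) s' 1 (return_pmf a) (?I (Suc k))"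
      using I eps lt by simp
  next
    fix s' and a :: unit assume I: "?I (nat \<lceil>1 / \<epsilon>\<rceil>) s' a"
    have eps: "snd s' ''eps'' 0 = \<epsilon>" using I assms(2) same_snd[of "{''K''}" s s' "''eps''"] by simp
    have "1 / \<epsilon> \<le> real (nat \<lceil>1 / \<epsilon>\<rceil>)" by linarith
    then have "1 \<le> real (nat \<lceil>1 / \<epsilon>\<rceil>) * \<epsilon>" by (simp only: pos_divide_le_eq[OF assms(3)])
    then show "\<not> bval (RLess (RMul (RNat (nv ''K'')) (rv ''eps'')) (RNat (NConst 1))) s'"
      using I eps by simp
  qed (use assms(1) in simp_all)
  then have "dsim inverse_eps_com s (nat \<lceil>1 / \<epsilon>\<rceil> * (1 + 1) + 1) (\<lambda>s'. ?I (nat \<lceil>1 / \<epsilon>\<rceil>) s' ())"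
    by (simp only: iterM_return)
  then show ?thesis by (rule sim_mono) simp_all
qed

lemma dsim_times:
  assumes "fst s ''B'' 0 = b" "fst s ''S'' 0 = v"
  shows "dsim times_com s (4 * b + 7) (\<lambda>s'. fst s' ''S'' 0 = v * b \<and> same {''k'', ''y'', ''S''} s s')"
proof -
  let ?s = "set_nat ''y'' 0 0 s"
  let ?I = "\<lambda>k s'. fst s' ''k'' 0 = k \<and> fst s' ''y'' 0 = v * (k - 1) \<and> same {''k'', ''y''} s s'"
  have loop: "dsim (For ''k'' (nv ''B'') (set_var ''y'' (NAdd (nv ''y'') (nv ''S'')))) ?s (b * (1 + 3) + 3) (?I (Suc b))"
  proof (rule dsim_For)
    show "?I 1 (set_nat ''k'' 0 1 ?s)" by (simp add: mem_simps)
  next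
    fix k s' assume I: "?I k s'"
    then show "fst s' ''k'' 0 = k \<and> nval (nv ''B'') s' = b"
      using assms(1) same_fst[of "{''k'', ''y''}" s s' "''B''"] by simp
  next
    fix k s' assume k: "1 \<le> k" "k \<le> b" and I: "?I k s'"
    have S: "fst s' ''S'' 0 = v" using I assms(2) same_fst[of "{''k'', ''y''}" s s' "''S''"] by simp
    have "v * (k - 1) + v = v * k" using k by (simp add: diff_mult_distrib2)
    then have v: "nval (NAdd (nv ''y'') (nv ''S'')) s' = v * k" using I S by simp
    show "dsim (set_var ''y'' (NAdd (nv ''y'') (nv ''S''))) s' 1
        (\<lambda>s'. fst s' ''k'' 0 = k \<and> ?I (Suc k) (set_nat ''k'' 0 (Suc k) s'))"
      by (rule sim_AssignN, unfold v) (use I in \<open>simp add: mem_simps\<close>)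
  qed
  have "dsim times_com s (1 + ((b * (1 + 3) + 3) + 1 + 1) + 1)
      (\<lambda>s'. fst s' ''S'' 0 = v * b \<and> same {''k'', ''y'', ''S''} s s')"
    unfolding times_com_def
  proof (rule sim_Seq_det)
    show "dsim (set_var ''y'' (NConst 0)) s 1 (\<lambda>s'. s' = ?s)" by (rule sim_AssignN) simp
    fix s1 assume s1: "s1 = ?s"
    show "dsim (Seq (For ''k'' (nv ''B'') (set_var ''y'' (NAdd (nv ''y'') (nv ''S'')))) (set_var ''S'' (nv ''y'')))
       s1 ((b * (1 + 3) + 3) + 1 + 1) (\<lambda>s'. fst s' ''S'' 0 = v * b \<and> same {''k'', ''y'', ''S''} s s')"
      unfolding s1
    proof (rule sim_Seq_det[OF loop])
      fix s2 assume I: "?I (Suc b) s2"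
      have "same {''k'', ''y'', ''S''} s s2" by (rule same_mono[of "{''k'', ''y''}"]) (use I in auto)
      then show "dsim (set_var ''S'' (nv ''y'')) s2 1 (\<lambda>s'. fst s' ''S'' 0 = v * b \<and> same {''k'', ''y'', ''S''} s s')"
        by (intro sim_AssignN) (use I in \<open>simp add: mem_simps\<close>)
    qed
  qed
  then show ?thesis by (rule sim_mono) simp_all
qed

lemma dsim_power:
  assumes "fst s ''B'' 0 = b" "fst s ''S'' 0 = v"
  shows "dsim (power_com d) s (d * (4 * b + 8) + 1)
    (\<lambda>s'. fst s' ''S'' 0 = v * b ^ d \<and> same {''k'', ''y'', ''S''} s s')"
  using assms
proof (induction d arbitrary: s v)
  case 0
  show ?case unfolding power_com.simps
    by (rule dsim_Skip) (use 0 in simp_all)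
next
  case (Suc d)
  have "dsim (power_com (Suc d)) s ((4 * b + 7) + (d * (4 * b + 8) + 1) + 1)
    (\<lambda>s'. fst s' ''S'' 0 = v * b ^ Suc d \<and> same {''k'', ''y'', ''S''} s s')"
    unfolding power_com.simps
  proof (rule sim_Seq_det[OF dsim_times[OF Suc.prems]])
    fix s1 assume s1: "fst s1 ''S'' 0 = v * b \<and> same {''k'', ''y'', ''S''} s s1"
    have same1: "same {''k'', ''y'', ''S''} s s1" using s1 by blast
    have "dsim (power_com d) s1 (d * (4 * b + 8) + 1)
      (\<lambda>s'. fst s' ''S'' 0 = (v * b) * b ^ d \<and> same {''k'', ''y'', ''S''} s1 s')"
      by (rule Suc.IH) (use s1 Suc.prems same_fst[OF same1, of "''B''"] in simp_all)
    then show "dsim (power_com d) s1 (d * (4 * b + 8) + 1)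
      (\<lambda>s'. fst s' ''S'' 0 = v * b ^ Suc d \<and> same {''k'', ''y'', ''S''} s s')"
      by (rule sim_mono) (use same_trans[OF same1] in \<open>simp_all add: mult.assoc\<close>)
  qed
  then show ?case by (rule sim_mono) simp_all
qed

definition steps :: "nat \<Rightarrow> nat \<Rightarrow> nat \<Rightarrow> real \<Rightarrow> nat" where
  "steps m d n \<epsilon> = m * (n + nat \<lceil>1 / \<epsilon>\<rceil>) ^ d"

definition init_time :: "nat \<Rightarrow> nat \<Rightarrow> real \<Rightarrow> nat" where
  "init_time d n \<epsilon> = 4 * n + 2 * nat \<lceil>1 / \<epsilon>\<rceil> + d * (4 * (n + nat \<lceil>1 / \<epsilon>\<rceil>) + 8) + 13"

lemma dsim_init:
  assumes "0 < \<epsilon>"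
  shows "dsim (init_com m d) (input_mem n p \<epsilon>) (init_time d n \<epsilon>)
    (\<lambda>s. core n p (steps m d n \<epsilon>) s \<and> snd s ''M'' 0 = 1 \<and> fst s ''host'' = (\<lambda>_. 0))"
proof -
  let ?s = "input_mem n p \<epsilon>" and ?K = "nat \<lceil>1 / \<epsilon>\<rceil>"
  let ?Q = "\<lambda>s. core n p (steps m d n \<epsilon>) s \<and> snd s ''M'' 0 = 1 \<and> fst s ''host'' = (\<lambda>_. 0)"
  let ?one = "AssignR ''M'' (NConst 0) (RNat (NConst 1))"
  let ?pow = "Seq (power_com d) ?one"
  let ?set_S = "Seq (set_var ''S'' (NConst m)) ?pow"
  let ?set_B = "Seq (set_var ''B'' (NAdd (nv ''n'') (nv ''K''))) ?set_S"
  let ?T = "d * (4 * (n + ?K) + 8) + 1"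
  let ?V1 = "{''i'', ''mul''}" let ?V2 = "insert ''K'' ?V1" let ?V3 = "insert ''B'' ?V2" let ?V4 = "insert ''S'' ?V3"
  let ?V5 = "{''k'', ''y''} \<union> ?V4"
  have s: "fst ?s ''n'' 0 = n" "fst ?s ''mul'' 0 = 0" "fst ?s ''K'' 0 = 0" "snd ?s ''eps'' 0 = \<epsilon>"
    "snd ?s ''p'' 0 = p" "fst ?s ''host'' = (\<lambda>_. 0)"
    by (simp_all add: input_mem_def mem_simps)
  let ?mul = "\<lambda>s'. \<forall>i\<le>n. fst s' ''mul'' i = n * i"
  have "dsim (init_com m d) ?s
    ((4 * n + 3) + ((2 * ?K + 1) + (1 + (1 + (?T + 1 + 1) + 1) + 1) + 1) + 1)
    ?Q"
    unfolding init_com_def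
  proof (rule sim_Seq_det[OF dsim_mul[OF s(1,2)]])
    fix s1 assume s1: "?mul s1 \<and> same ?V1 ?s s1"
    have same1: "same ?V1 ?s s1" using s1 by blast
    have K1: "fst s1 ''K'' 0 = 0" "snd s1 ''eps'' 0 = \<epsilon>"
      using s same_fst[OF same1, of "''K''"] same_snd[OF same1, of "''eps''"] by simp_all
    show "dsim (Seq inverse_eps_com (?set_B)) s1
      ((2 * ?K + 1) + (1 + (1 + (?T + 1 + 1) + 1) + 1) + 1)
      ?Q"
    proof (rule sim_Seq_det[OF dsim_inverse_eps[OF K1 assms]])
      fix s2 assume s2: "fst s2 ''K'' 0 = ?K \<and> same {''K''} s1 s2"
      have same12: "same {''K''} s1 s2" using s2 by blast
      have same2: "same ?V2 ?s s2"
        by (rule same_trans[OF same_mono[OF same1] same_mono[OF same12]]) auto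
      have n2: "fst s2 ''n'' 0 = n" using s same_fst[OF same2, of "''n''"] by simp
      have mul2: "?mul s2" using s1 same_fst[OF same12, of "''mul''"] by simp
      let ?s3 = "set_nat ''B'' 0 (n + ?K) s2" let ?s4 = "set_nat ''S'' 0 m ?s3"
      have same3: "same ?V3 ?s ?s3" using same_mono[OF same2, of ?V3] by auto
      have same4: "same ?V4 ?s ?s4" using same_mono[OF same3, of ?V4] by auto
      have 4: "fst ?s4 ''B'' 0 = n + ?K" "fst ?s4 ''S'' 0 = m" "?mul ?s4" using mul2 by (simp_all add: mem_simps)
      show "dsim (?set_B) s2
        (1 + (1 + (?T + 1 + 1) + 1) + 1)
        ?Q"
      proof (rule sim_Seq_det)
        show "dsim (set_var ''B'' (NAdd (nv ''n'') (nv ''K''))) s2 1 (\<lambda>s'. s' = ?s3)"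
          by (rule sim_AssignN) (use s2 n2 in simp)
        fix s3 assume s3: "s3 = ?s3"
        show "dsim (?set_S) s3
          (1 + (?T + 1 + 1) + 1)
          ?Q"
        proof (rule sim_Seq_det)
          show "dsim (set_var ''S'' (NConst m)) s3 1 (\<lambda>s'. s' = ?s4)"
            by (rule sim_AssignN) (simp add: s3)
          fix s4 assume s4: "s4 = ?s4"
          show "dsim (?pow) s4
            (?T + 1 + 1)
            ?Q"
            unfolding s4
          proof (rule sim_Seq_det[OF dsim_power[OF 4(1,2)]])
            fix s5 assume s5: "fst s5 ''S'' 0 = m * (n + ?K) ^ d \<and> same {''k'', ''y'', ''S''} ?s4 s5"
            have same45: "same {''k'', ''y'', ''S''} ?s4 s5" using s5 by blast
            have same5: "same ?V5 ?s s5"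
              by (rule same_trans[OF same_mono[OF same4] same_mono[OF same45]]) auto
            have "fst s5 ''n'' 0 = n" "snd s5 ''p'' 0 = p" "fst s5 ''host'' = (\<lambda>_. 0)" "?mul s5"
              using s 4(3) same_fst[OF same5, of "''n''"] same_snd[OF same5, of "''p''"]
                same_fst[OF same5, of "''host''"] same_fst[OF same45, of "''mul''"] by simp_all
            then show "dsim (?one) s5 1
              ?Q"
              by (intro sim_AssignR) (use s5 in \<open>simp add: mem_simps core_def steps_def\<close>)
          qed
        qed
      qed
    qed
  qed
  then show ?thesis by (rule sim_mono) (simp_all add: init_time_def)
qed

section \<open>The whole program and the law of its output\<close>

definition main_com :: "nat \<Rightarrow> nat \<Rightarrow> com" where
  "main_com m d = Seq (init_com m d) (Seq product_com sample_com)"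

definition main_time :: "nat \<Rightarrow> nat \<Rightarrow> nat \<Rightarrow> real \<Rightarrow> nat" where
  "main_time m d n \<epsilon> = init_time d n \<epsilon> + product_time n (steps m d n \<epsilon>) + sample_time n (steps m d n \<epsilon>) + 2"

definition main_law :: "nat \<Rightarrow> nat \<Rightarrow> nat \<Rightarrow> real \<Rightarrow> real \<Rightarrow> (real \<times> graph) pmf" where
  "main_law m d n p \<epsilon> = bind_pmf (product_law n p (steps m d n \<epsilon>))
     (\<lambda>x. map_pmf (Pair x) (triangle_free_sample n p (pairs n) (steps m d n \<epsilon>)))"

lemma sim_main:
  assumes "1 \<le> n" "0 < \<epsilon>"
  shows "sim (main_com m d) (input_mem n p \<epsilon>) (main_time m d n \<epsilon>) (main_law m d n p \<epsilon>)
    (\<lambda>s' (x, G). output_number s' = x \<and> output_graph n s' = G)"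
proof -
  let ?S = "steps m d n \<epsilon>"
  have "sim (main_com m d) (input_mem n p \<epsilon>)
      (init_time d n \<epsilon> + (product_time n ?S + sample_time n ?S + 1) + 1) (main_law m d n p \<epsilon>)
      (\<lambda>s' (x, G). output_number s' = x \<and> output_graph n s' = G)"
    unfolding main_com_def
  proof (rule sim_Seq_det[OF dsim_init[OF assms(2)]])
    fix s assume s: "core n p ?S s \<and> snd s ''M'' 0 = 1 \<and> fst s ''host'' = (\<lambda>_. 0)"
    have c: "core n p ?S s" "fst s ''host'' = (\<lambda>_. 0)" "snd s ''M'' 0 = 1" using s by auto
    show "sim (Seq product_com sample_com) s (product_time n ?S + sample_time n ?S + 1) (main_law m d n p \<epsilon>)
      (\<lambda>s' (x, G). output_number s' = x \<and> output_graph n s' = G)"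
      unfolding main_law_def
    proof (rule sim_Seq[OF sim_product[OF assms(1) c]])
      fix s1 x assume s1: "snd s1 ''M'' 0 = x \<and> represents n (fst s1 ''host'') (pairs n) \<and> core n p ?S s1"
      have c1: "core n p ?S s1" "represents n (fst s1 ''host'') (pairs n)" using s1 by auto
      obtain D where D: "runs sample_com s1 (sample_time n ?S) D"
        "rel_pmf (\<lambda>s' G. G \<in> constrained triangle_free (pairs n) \<and> represents n (fst s' ''adj'') G \<and> same sample_vars s1 s')
           D (triangle_free_sample n p (pairs n) ?S)"
        using sim_sample[OF assms(1) c1 order_refl] unfolding sim_def by blast
      have "rel_pmf (\<lambda>s' (x, G). output_number s' = x \<and> output_graph n s' = G) D
          (map_pmf (Pair x) (triangle_free_sample n p (pairs n) ?S))"
        unfolding pmf.rel_map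
      proof (rule pmf.rel_mono_strong[OF D(2)])
        fix s' G assume *: "G \<in> constrained triangle_free (pairs n) \<and> represents n (fst s' ''adj'') G \<and> same sample_vars s1 s'"
        \<comment> \<open>Drawing the final sample leaves \<open>''M''\<close> alone, so the product
          is still there at the end.\<close>
        have "snd s' ''M'' = snd s1 ''M''" by (rule same_snd[of sample_vars]) (use * in auto)
        then have "output_number s' = x" using s1 by (simp add: output_number_def)
        moreover have "output_graph n s' = G"
          by (rule output_graph_represents) (use * in \<open>auto simp: constrained_def\<close>)
        ultimately show "case (x, G) of (x, G) \<Rightarrow> output_number s' = x \<and> output_graph n s' = G" by simp
      qed
      then show "sim sample_com s1 (sample_time n ?S) (map_pmf (Pair x) (triangle_free_sample n p (pairs n) ?S))
         (\<lambda>s' (x, G). output_number s' = x \<and> output_graph n s' = G)"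
        using D(1) by (auto simp: sim_def)
    qed
  qed
  then show ?thesis by (rule sim_mono) (simp_all add: main_time_def)
qed

text \<open>A coupling along the graph of a function amounts to an equality between the image law
  and the abstract law.\<close>

lemma main_halts:
  assumes "1 \<le> n" "0 < \<epsilon>"
  obtains D where "halts_in ([main_com m d], input_mem n p \<epsilon>) (main_time m d n \<epsilon>) D"
    "map_pmf (\<lambda>s. (output_number s, output_graph n s)) D = main_law m d n p \<epsilon>"
proof -
  obtain D where D: "runs (main_com m d) (input_mem n p \<epsilon>) (main_time m d n \<epsilon>) D"
    "rel_pmf (\<lambda>s' (x, G). output_number s' = x \<and> output_graph n s' = G) D (main_law m d n p \<epsilon>)"
    using sim_main[OF assms] unfolding sim_def by blast
  have "rel_pmf (=) (map_pmf (\<lambda>s. (output_number s, output_graph n s)) D) (main_law m d n p \<epsilon>)"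
    unfolding pmf.rel_map by (rule pmf.rel_mono_strong[OF D(2)]) auto
  then have "map_pmf (\<lambda>s. (output_number s, output_graph n s)) D = main_law m d n p \<epsilon>"
    by (simp add: pmf.rel_eq)
  then show ?thesis using that runs_halts[OF D(1)] by blast
qed

section \<open>Accuracy of the sampler\<close>

lemma set_random_pair: "set_pmf (random_pair n) \<subseteq> (\<lambda>(u, v). {u, v}) ` ({1..n} \<times> {1..n})" if "1 \<le> n"
  using that by (auto simp: random_pair_def set_pmf_of_set)

text \<open>Two of the \<open>n ^ 2\<close> ordered choices of vertices give
  \<open>e\<close>.\<close>

lemma pmf_random_pair:
  assumes "e \<in> pairs n"
  shows "pmf (random_pair n) e = 2 / real n ^ 2"
proof -
  obtain a b where ab: "e = {a, b}" "a \<noteq> b" "a \<in> {1..n}" "b \<in> {1..n}" using assms by (rule pairsE)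
  then have n: "1 \<le> n" by auto
  have inner: "pmf (map_pmf (\<lambda>v. {u, v}) (pmf_of_set {1..n})) e = (of_bool (u = a) + of_bool (u = b)) / real n"
    if "u \<in> {1..n}" for u
  proof -
    have "pmf (map_pmf (\<lambda>v. {u, v}) (pmf_of_set {1..n})) e = real (card ({1..n} \<inter> {v. {u, v} = e})) / real n"
      using n by (simp add: pmf_map vimage_def measure_pmf_of_set)
    also have "{1..n} \<inter> {v. {u, v} = e} = (if u = a then {b} else if u = b then {a} else {})"
      using ab by (auto simp: doubleton_eq_iff)
    finally show ?thesis using ab(2) by simp
  qed
  have "pmf (random_pair n) e = (\<Sum>u\<in>{1..n}. (of_bool (u = a) + of_bool (u = b)) / real n) / real n"
    unfolding random_pair_def using n inner by (subst pmf_bind_pmf_of_set) auto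
  also have "(\<Sum>u\<in>{1..n}. (of_bool (u = a) + of_bool (u = b)) / real n) = 2 / real n"
    using ab by (simp add: sum_divide_distrib[symmetric] sum.distrib of_bool_def sum.delta)
  finally show ?thesis by (simp add: power2_eq_square)
qed

lemma triangle_free_dynamics_random_pair:
  assumes "2 \<le> n" "H \<subseteq> pairs n" "0 \<le> p" "p < 1"
  shows "triangle_free_dynamics n H p (2 / real n ^ 2) (random_pair n)"
proof
  have "2 / real n ^ 2 \<le> 2 / 2 ^ 2" using assms(1) by (intro divide_left_mono power_mono) auto
  then show "2 / real n ^ 2 \<le> 1" by simp
  show "finite (set_pmf (random_pair n))"
    by (rule finite_subset[OF set_random_pair]) (use assms in auto)
qed (use assms pmf_random_pair in auto)

lemma rnd_random_pair:
  assumes "triangle_free_dynamics n H p q (random_pair n)"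
  shows "triangle_free_dynamics.rnd p (random_pair n) = random_update n p"
  using triangle_free_dynamics.rnd_def[OF assms] by (simp add: random_update_def)

lemma empty_constrained: "{} \<in> constrained triangle_free H"
  by (simp add: constrained_def triangle_free_def)

lemma set_triangle_free_sample: "set_pmf (triangle_free_sample n p H t) \<subseteq> constrained triangle_free H"
proof
  fix G assume "G \<in> set_pmf (triangle_free_sample n p H t)"
  then show "G \<in> constrained triangle_free H"
    unfolding triangle_free_sample_def
    by (rule random_map_chain_invariant[rotated 2])
       (use update_constrained[OF down_closed_triangle_free] empty_constrained in auto)
qed

text \<open>The block length has a power of \<open>n\<close> in place of \<open>n ^ 2 ln n\<close>,
  as the program cannot compute logarithms. The number \<open>k\<close> of blocks is free because
  the target error shrinks with \<open>\<epsilon>\<close>.\<close>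

definition mixes :: "real \<Rightarrow> real \<Rightarrow> bool" where
  "mixes c C \<longleftrightarrow> (\<forall>n H p k t. 1 \<le> n \<longrightarrow> H \<subseteq> pairs n \<longrightarrow> 0 \<le> p \<longrightarrow> p \<le> c * real n powr (-1/2) \<longrightarrow>
     real k * (C * real n ^ 3) \<le> real t \<longrightarrow>
     tv_dist (triangle_free_sample n p H t) (gibbs triangle_free H p) \<le> (1 / 8) ^ k)"

lemma mixes_exists:
  assumes c: "c < 1 / sqrt 2"
  shows "\<exists>C>0. mixes c C"
proof -
  obtain C where mc: "mixing_constant c C" using triangle_free_mixing[OF c] .
  then have C: "0 < C" by (simp add: mixing_constant_def)
  note mix = mixing_constantD[OF mc]
  have "tv_dist (triangle_free_sample n p H t) (gibbs triangle_free H p) \<le> (1 / 8) ^ k"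
    if n: "1 \<le> n" and H: "H \<subseteq> pairs n" and p: "0 \<le> p" and pc: "p \<le> c * real n powr (-1/2)"
      and t: "real k * ((C + 1) * real n ^ 3) \<le> real t" for n H p k t
  proof -
    have p1: "p < 1" by (rule edge_density_less_1[OF c pc n p])
    show ?thesis
    proof (cases "2 \<le> n")
      case True
      interpret dyn: triangle_free_dynamics n H p "2 / real n ^ 2" "random_pair n"
        by (rule triangle_free_dynamics_random_pair[OF True H p p1])
      define T where "T = nat \<lceil>C * real n ^ 2 * ln n\<rceil>"
      have Cn: "0 \<le> C * real n ^ 2 * ln n" using C True by simp
      have T: "C * real n ^ 2 * ln n \<le> real T" "real T \<le> C * real n ^ 2 * ln n + 1"
        using Cn unfolding T_def by linarith+
      \<comment> \<open>\<open>ln n \<le> n\<close> trades the logarithm for a power, and the 1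
        added to \<open>C\<close> pays for the ceiling.\<close>
      have "ln (real n) \<le> real n" using ln_le_minus_one[of "real n"] True by simp
      then have "C * real n ^ 2 * ln n \<le> C * real n ^ 2 * real n" using C by (intro mult_left_mono) auto
      moreover have "1 \<le> real n ^ 3" using True by (intro one_le_power) auto
      ultimately have "real T \<le> (C + 1) * real n ^ 3"
        using T(2) by (simp add: algebra_simps power2_eq_square power3_eq_cube)
      then have "real k * real T \<le> real k * ((C + 1) * real n ^ 3)" by (intro mult_left_mono) auto
      then have "real (k * T) \<le> real t" using t by simp
      then have kT: "k * T \<le> t" by (simp only: of_nat_le_iff)
      have "apart_prob dyn.rnd dyn.upd t {} y \<le> (1 / 8) ^ k" if y: "y \<in> dyn.states" for y
      proof -
        have "apart_prob dyn.rnd dyn.upd t {} y \<le> apart_prob dyn.rnd dyn.upd (k * T) {} y"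
          by (rule apart_prob_antimono[OF dyn.finite_rnd kT])
        also have "\<dots> \<le> (1 / 8) ^ k"
          by (rule apart_prob_power[OF dyn.finite_rnd, where I = dyn.states])
             (use mix[OF dyn.triangle_free_dynamics_axioms True pc order_refl _ _ T(1)]
               dyn.upd_states empty_constrained y in auto)
        finally show ?thesis .
      qed
      then show ?thesis
        using dyn.tv_dist_gibbs_le[OF empty_constrained, of t "(1 / 8) ^ k"]
        by (simp only: rnd_random_pair[OF dyn.triangle_free_dynamics_axioms] triangle_free_sample_def)
    next
      \<comment> \<open>For \<open>n = 1\<close> there are no pairs and there is one state; on the
        empty host graph the mass \<open>q = 0\<close> satisfies the locale vacuously.\<close>
      case False
      then have "pairs n = {}" using n card_pairs[of n] finite_pairs[of n] by (simp add: binomial_eq_0)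
      then have H0: "H = {}" using H by simp
      interpret dyn: triangle_free_dynamics n H p 0 "random_pair n"
      proof
        show "finite (set_pmf (random_pair n))"
          by (rule finite_subset[OF set_random_pair[OF n]]) simp
      qed (use H0 p p1 in auto)
      have "apart_prob dyn.rnd dyn.upd t {} y \<le> (1 / 8) ^ k" if "y \<in> dyn.states" for y
        using that H0 by (simp add: constrained_def)
      then show ?thesis
        using dyn.tv_dist_gibbs_le[OF empty_constrained, of t "(1 / 8) ^ k"]
        by (simp only: rnd_random_pair[OF dyn.triangle_free_dynamics_axioms] triangle_free_sample_def)
    qed
  qed
  then have "mixes c (C + 1)" unfolding mixes_def by blast
  then show ?thesis using C by (intro exI[of _ "C + 1"]) simp
qed

section \<open>The product estimator\<close>

definition partition_fun :: "real \<Rightarrow> graph \<Rightarrow> real" where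
  "partition_fun p H = prob (random_subset H p) (constrained triangle_free H)"

lemma random_subset_insert:
  assumes "finite H" "e \<notin> H"
  shows "random_subset (insert e H) p = bind_pmf (bernoulli_pmf p)
    (\<lambda>b. map_pmf (\<lambda>G. if b then insert e G else G) (random_subset H p))"
proof -
  have *: "{x \<in> insert e H. (f(e := b)) x} = (if b then insert e {x \<in> H. f x} else {x \<in> H. f x})" for f b
    using assms(2) by auto
  show ?thesis
    unfolding random_subset_def Pi_pmf_insert'[OF assms]
    by (simp only: map_pmf_def bind_assoc_pmf bind_return_pmf *)
qed

lemma prob_cond_pmf:
  assumes "set_pmf M \<inter> S \<noteq> {}"
  shows "prob (cond_pmf M S) A * prob M S = prob M (S \<inter> A)"
proof -
  have "prob M S \<noteq> 0" using assms by (simp add: measure_pmf_zero_iff)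
  moreover have "prob (cond_pmf M S) A = prob M (S \<inter> A) / prob M S"
    unfolding cond_pmf.rep_eq[OF assms] by (rule measure_uniform_measure) (use \<open>prob M S \<noteq> 0\<close> in \<open>simp_all add: measure_pmf.emeasure_eq_measure\<close>)
  ultimately show ?thesis by simp
qed

text \<open>Decide \<open>e\<close> last. If it is absent, the condition is that of
  \<open>H\<close>; if it is present, the rest must be triangle-free and also form no triangle with
  \<open>e\<close>. Dividing by the probability of the former condition turns the correction into a
  Gibbs probability.\<close>

lemma partition_fun_insert:
  assumes H: "finite H" "e \<notin> H" and p: "0 \<le> p" "p < 1"
  shows "partition_fun p (insert e H) =
    partition_fun p H * (1 - p * prob (gibbs triangle_free H p) {G. \<not> triangle_free (insert e G)})"
proof -
  let ?M = "random_subset H p"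
  let ?B = "{G. \<not> triangle_free (insert e G)}"
  have fin: "finite (set_pmf ?M)" by (rule finite_set_random_subset[OF H(1)])
  have sub: "G \<subseteq> H" if "G \<in> set_pmf ?M" for G using that set_random_subset by blast
  have T: "prob (map_pmf (insert e) ?M) (constrained triangle_free (insert e H)) = prob ?M (constrained triangle_free H - ?B)"
  proof -
    have "prob (map_pmf (insert e) ?M) (constrained triangle_free (insert e H)) =
        prob ?M (insert e -` constrained triangle_free (insert e H))" by simp
    also have "\<dots> = prob ?M (constrained triangle_free H - ?B)"
    proof (rule measure_prob_cong_0)
      fix G assume G: "G \<in> insert e -` constrained triangle_free (insert e H) - (constrained triangle_free H - ?B)"
      have "triangle_free G" if "triangle_free (insert e G)"
        using down_closedD[OF down_closed_triangle_free that] by blast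
      then have "\<not> G \<subseteq> H" using G by (auto simp: constrained_def)
      then show "pmf ?M G = 0" using sub by (auto simp: set_pmf_iff)
    qed (auto simp: constrained_def)
    finally show ?thesis .
  qed
  have F: "prob ?M (constrained triangle_free (insert e H)) = partition_fun p H"
    unfolding partition_fun_def
  proof (rule measure_prob_cong_0)
    fix G assume G: "G \<in> constrained triangle_free (insert e H) - constrained triangle_free H"
    then have "\<not> G \<subseteq> H" by (auto simp: constrained_def)
    then show "pmf ?M G = 0" using sub by (auto simp: set_pmf_iff)
  qed (auto simp: constrained_def)
  have "partition_fun p (insert e H) = expect (bernoulli_pmf p)
      (\<lambda>b. prob (map_pmf (\<lambda>G. if b then insert e G else G) ?M) (constrained triangle_free (insert e H)))"
    unfolding partition_fun_def random_subset_insert[OF H] by (rule prob_bind) (use fin in auto)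
  also have "\<dots> = p * prob (map_pmf (insert e) ?M) (constrained triangle_free (insert e H)) +
      (1 - p) * prob ?M (constrained triangle_free (insert e H))"
    using p by (simp add: map_pmf_ident del: measure_map_pmf)
  also have "\<dots> = p * prob ?M (constrained triangle_free H - ?B) + (1 - p) * partition_fun p H"
    by (simp only: T F)
  also have "prob ?M (constrained triangle_free H - ?B) = partition_fun p H - prob ?M (constrained triangle_free H \<inter> ?B)"
    unfolding partition_fun_def by (subst measure_pmf.finite_measure_Diff'[symmetric]) (auto simp: Diff_Int_distrib)
  also have "prob ?M (constrained triangle_free H \<inter> ?B) = prob (gibbs triangle_free H p) ?B * partition_fun p H"
    unfolding partition_fun_def gibbs_def
    by (rule prob_cond_pmf[symmetric, OF gibbs_nonempty[OF H(1) p down_closed_triangle_free]])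
  finally show ?thesis by (simp add: algebra_simps)
qed

lemma partition_fun_empty: "partition_fun p {} = 1"
proof -
  have "random_subset {} p = return_pmf ({} :: graph)" by (simp add: random_subset_def)
  then show ?thesis by (simp add: partition_fun_def empty_constrained)
qed

section \<open>Concentration of the counts and propagation of relative errors\<close>

lemma count_binomial:
  "iterM (\<lambda>_ c. map_pmf (\<lambda>G. c + of_bool (P G)) L) m 1 0 = binomial_pmf m (prob L {G. P G})"
proof -
  let ?\<theta> = "prob L {G. P G}"
  have \<theta>: "?\<theta> \<in> {0..1}" by simp
  have b: "map_pmf P L = bernoulli_pmf ?\<theta>"
  proof (rule pmf_eqI)
    fix b
    have "prob L {G. \<not> P G} = 1 - ?\<theta>"
      using measure_pmf.prob_compl[of "{G. P G}" L] by (simp add: Compl_eq_Diff_UNIV[symmetric] Collect_neg_eq)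
    then show "pmf (map_pmf P L) b = pmf (bernoulli_pmf ?\<theta>) b"
      by (cases b) (simp_all add: pmf_map vimage_def)
  qed
  have f: "map_pmf (\<lambda>G. c + of_bool (P G)) L = map_pmf (\<lambda>b. c + of_bool b) (bernoulli_pmf ?\<theta>)" for c :: nat
    by (simp add: b[symmetric] map_pmf_comp)
  show ?thesis
  proof (induction m)
    case 0 then show ?case by (simp add: binomial_pmf_0)
  next
    case (Suc m)
    have "iterM (\<lambda>_ c. map_pmf (\<lambda>G. c + of_bool (P G)) L) (Suc m) 1 0 =
        bind_pmf (binomial_pmf m ?\<theta>) (\<lambda>c. bind_pmf (bernoulli_pmf ?\<theta>) (\<lambda>b. return_pmf (c + of_bool b)))"
      unfolding iterM_Suc_right Suc unfolding f unfolding map_pmf_def by (rule refl)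
    also have "\<dots> = bind_pmf (bernoulli_pmf ?\<theta>) (\<lambda>b. bind_pmf (binomial_pmf m ?\<theta>) (\<lambda>c. return_pmf (c + of_bool b)))"
      by (rule bind_commute_pmf)
    also have "\<dots> = binomial_pmf (Suc m) ?\<theta>"
      unfolding binomial_pmf_Suc[OF \<theta>] by (intro bind_pmf_cong refl) simp
    finally show ?case .
  qed
qed

text \<open>Hoeffding's inequality weakened by \<open>x \<le> exp x\<close>; decay of order
  \<open>1 / m\<close> is enough for a union over at most \<open>B ^ 2\<close> ratios.\<close>

lemma binomial_deviation:
  assumes "\<theta> \<in> {0..1}" "0 < m" "0 < \<delta>"
  shows "prob (binomial_pmf m \<theta>) {c. \<delta> \<le> \<bar>real c / real m - \<theta>\<bar>} \<le> 1 / (real m * \<delta>\<^sup>2)"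
proof -
  interpret binomial_distribution m \<theta> by unfold_locales (rule assms(1))
  have pos: "0 < real m * \<delta>\<^sup>2" using assms by simp
  have "prob (binomial_pmf m \<theta>) {c. \<delta> \<le> \<bar>real c / real m - \<theta>\<bar>} \<le> 2 * exp (-2 * real m * \<delta>\<^sup>2)"
    using prob_abs_ge'[of \<delta>] assms by simp
  also have "exp (-2 * real m * \<delta>\<^sup>2) = 1 / exp (2 * (real m * \<delta>\<^sup>2))"
    by (simp add: exp_minus inverse_eq_divide mult.assoc)
  also have "2 * (1 / exp (2 * (real m * \<delta>\<^sup>2))) \<le> 2 * (1 / (2 * (real m * \<delta>\<^sup>2)))"
  proof -
    have "2 * (real m * \<delta>\<^sup>2) \<le> exp (2 * (real m * \<delta>\<^sup>2))"
      using exp_ge_add_one_self[of "2 * (real m * \<delta>\<^sup>2)"] by linarith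
    then show ?thesis using pos by (intro mult_left_mono divide_left_mono) auto
  qed
  finally show ?thesis by simp
qed

lemma rel_approx_mult:
  assumes "rel_approx a M Z" "rel_approx b R r"
  shows "rel_approx (a + b) (M * R) (Z * r)"
proof -
  have 1: "0 < M" "exp (- a) * M \<le> Z" "Z \<le> exp a * M" "0 < R" "exp (- b) * R \<le> r" "r \<le> exp b * R"
    using assms by (auto simp: rel_approx_def)
  have r: "0 \<le> r" "0 \<le> Z" using 1 mult_nonneg_nonneg[of "exp (- b)" R] mult_nonneg_nonneg[of "exp (- a)" M]
    by (auto intro: order_trans[rotated])
  have "exp (- a) * M * (exp (- b) * R) \<le> Z * r" "Z * r \<le> exp a * M * (exp b * R)"
    using 1 r by (auto intro!: mult_mono)
  then show ?thesis using 1(1,4) by (simp add: rel_approx_def exp_add exp_diff exp_minus field_simps)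
qed

lemma rel_approx_mono:
  assumes "rel_approx a M Z" "a \<le> b"
  shows "rel_approx b M Z"
proof -
  have "exp (- b) * M \<le> exp (- a) * M" "exp a * M \<le> exp b * M"
    using assms by (auto intro!: mult_right_mono simp: rel_approx_def)
  moreover have "0 < M" "exp (- a) * M \<le> Z" "Z \<le> exp a * M" using assms(1) by (auto simp: rel_approx_def)
  ultimately have "exp (- b) * M \<le> Z" "Z \<le> exp b * M" by linarith+
  with \<open>0 < M\<close> show ?thesis by (simp add: rel_approx_def)
qed

text \<open>\<open>r \<ge> 1 / 2\<close> and \<open>\<delta> \<le> 1 / 8\<close> keep both
  \<open>R\<close> and \<open>r\<close> above \<open>1 / 4\<close>, so \<open>\<delta>\<close> is at
  most \<open>4 \<delta>\<close> times either of them, and \<open>1 + x \<le> exp x\<close> turns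
  this into a relative error.\<close>

lemma rel_approx_ratio:
  assumes "\<bar>R - r\<bar> \<le> \<delta>" "1 / 2 \<le> r" "0 \<le> \<delta>" "\<delta> \<le> 1 / 8"
  shows "rel_approx (4 * \<delta>) R r"
proof -
  have R: "0 < R" "R \<le> r + \<delta>" "r \<le> R + \<delta>" "3 / 8 \<le> R" using assms by linarith+
  have "\<delta> * 1 \<le> \<delta> * (4 * R)" using R assms by (intro mult_left_mono) auto
  then have "r \<le> (1 + 4 * \<delta>) * R" using R by (simp add: algebra_simps)
  also have "\<dots> \<le> exp (4 * \<delta>) * R" using R by (intro mult_right_mono exp_ge_add_one_self) auto
  finally have 1: "r \<le> exp (4 * \<delta>) * R" .
  have "\<delta> * 1 \<le> \<delta> * (4 * r)" using assms by (intro mult_left_mono) auto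
  then have "R \<le> (1 + 4 * \<delta>) * r" using R by (simp add: algebra_simps)
  also have "\<dots> \<le> exp (4 * \<delta>) * r" using assms by (intro mult_right_mono exp_ge_add_one_self) auto
  finally have "exp (- (4 * \<delta>)) * R \<le> exp (- (4 * \<delta>)) * (exp (4 * \<delta>) * r)" by (intro mult_left_mono) auto
  also have "\<dots> = r" by (simp add: exp_minus field_simps)
  finally show ?thesis using 1 R(1) by (simp add: rel_approx_def)
qed

lemma finite_set_iterM:
  assumes "\<And>k a. finite (set_pmf (f k a))"
  shows "finite (set_pmf (iterM f m k a))"
  by (induction m arbitrary: k a) (use assms in auto)

text \<open>A union bound over the rounds of a loop; nothing is claimed about a run after its first
  failure.\<close>

lemma prob_iterM_invariant:
  assumes fin: "\<And>k a. finite (set_pmf (f k a))"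
    and step: "\<And>k a. k0 \<le> k \<Longrightarrow> k < k0 + m \<Longrightarrow> I k a \<Longrightarrow> prob (f k a) {b. \<not> I (Suc k) b} \<le> \<beta>"
    and init: "I k0 a" and \<beta>: "0 \<le> \<beta>"
  shows "prob (iterM f m k0 a) {b. \<not> I (k0 + m) b} \<le> real m * \<beta>"
  using step
proof (induction m)
  case 0
  then show ?case using init by simp
next
  case (Suc m)
  have "prob (iterM f (Suc m) k0 a) {b. \<not> I (k0 + Suc m) b} \<le> prob (iterM f m k0 a) {b. \<not> I (k0 + m) b} + \<beta>"
    unfolding iterM_Suc_right
    by (rule prob_bind_le) (use Suc.prems fin finite_set_iterM[OF fin] \<beta> in auto)
  also have "prob (iterM f m k0 a) {b. \<not> I (k0 + m) b} \<le> real m * \<beta>"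
    by (rule Suc.IH) (use Suc.prems in auto)
  finally show ?case by (simp add: algebra_simps)
qed

section \<open>Parameters of the estimator, its accuracy and its running time\<close>

locale estimator =
  fixes c C p \<epsilon> :: real and m n :: nat
  \<comment> \<open>\<open>768\<close> is \<open>3 * 16 ^ 2\<close>: the square comes from
    \<open>\<delta>\<close>, the 3 from the total failure probability \<open>1 / 3\<close>.
    \<open>16 * C\<close> matches the number \<open>16 * B ^ 3\<close> of blocks.\<close>
  assumes c: "c < 1 / sqrt 2" and C: "mixes c C" "0 < C" and m: "16 * C \<le> real m" "768 \<le> m"
    and n: "1 \<le> n" and p: "0 \<le> p" and pc: "p \<le> c * real n powr (-1/2)" and \<epsilon>: "0 < \<epsilon>"
begin

text \<open>Since \<open>B \<ge> n\<close>, \<open>1/\<epsilon>\<close>, the number \<open>S = m B^8\<close> of steps of the chain is at least \<open>16 B^3\<close> blocks each of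
  which divides the total variation distance by 8, so a sample has error at most \<open>\<delta>\<close>. With \<open>S\<close> samples per
  ratio, Hoeffding's inequality bounds the probability of an error above \<open>\<delta>\<close> by \<open>1 / (S \<delta>\<^sup>2) \<le> 1 / (3 B\<^sup>2)\<close>,
  which sums to \<open>1/3\<close> over all pairs; the relative errors \<open>4 \<delta>\<close> of at most \<open>B\<^sup>2\<close> factors add up to at most \<open>\<epsilon>\<close>.\<close>

definition "B = n + nat \<lceil>1 / \<epsilon>\<rceil>"

definition "S = steps m 8 n \<epsilon>"

definition "\<delta> = 1 / (16 * real B ^ 3)"

abbreviation "Z \<equiv> partition_fun p"

lemma p1: "p < 1"
  by (rule edge_density_less_1[OF c pc n p])

lemma B: "n \<le> B" "1 \<le> B" "1 / \<epsilon> \<le> real B" "real B \<le> 2 * (real n + 1 / \<epsilon>)"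
proof -
  have "0 < 1 / \<epsilon>" using \<epsilon> by simp
  moreover from this have "real (nat \<lceil>1 / \<epsilon>\<rceil>) \<le> 1 / \<epsilon> + 1" "1 / \<epsilon> \<le> real (nat \<lceil>1 / \<epsilon>\<rceil>)" by linarith+
  moreover have "real B = real n + real (nat \<lceil>1 / \<epsilon>\<rceil>)" "1 \<le> real n" using n by (simp_all add: B_def)
  moreover have "e \<le> b \<and> b \<le> 2 * (a + e)" if "0 < e" "k \<le> e + 1" "e \<le> k" "b = a + k" "1 \<le> a"
    for a b e k :: real
    using that by auto
  ultimately show "1 / \<epsilon> \<le> real B" "real B \<le> 2 * (real n + 1 / \<epsilon>)" by blast+
qed (use n in \<open>simp_all add: B_def\<close>)

lemma S: "S = m * B ^ 8"
  by (simp add: S_def steps_def B_def)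

lemma S_pos: "0 < S"
  using B m by (simp add: S)

lemma \<delta>: "0 < \<delta>" "\<delta> \<le> 1 / 8"
proof -
  have "1 \<le> real B ^ 3" using B by (intro one_le_power) simp
  then have "8 \<le> 16 * real B ^ 3" by linarith
  then show "\<delta> \<le> 1 / 8" unfolding \<delta>_def by (intro frac_le) simp_all
  show "0 < \<delta>" using B(2) by (simp add: \<delta>_def)
qed

lemma \<delta>_le: "\<delta> < \<epsilon>" "4 * \<delta> * card (pairs n) \<le> \<epsilon>"
proof -
  have B0: "0 < real B" using B by simp
  have e: "1 \<le> real B * \<epsilon>" using B(3) by (simp only: pos_divide_le_eq[OF \<epsilon>])
  have B2: "1 \<le> real B ^ 2" using B by (intro one_le_power) simp
  have "1 < 16 * real B ^ 2" using B2 by linarith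
  then have "real B * 1 < real B * (16 * real B ^ 2)" by (rule mult_strict_left_mono[OF _ B0])
  moreover have "real B * (16 * real B ^ 2) = 16 * real B ^ 3" by (simp add: power3_eq_cube power2_eq_square)
  ultimately have "real B < 16 * real B ^ 3" by linarith
  then have "\<delta> < 1 / real B" unfolding \<delta>_def using B0 by (intro divide_strict_left_mono) auto
  moreover have "1 / real B \<le> \<epsilon>" using e B0 by (simp add: divide_le_eq mult.commute)
  ultimately show "\<delta> < \<epsilon>" by linarith
  have "card (pairs n) \<le> n * (n - 1)" by (simp add: card_pairs choose_two)
  also have "\<dots> \<le> B * B" using B by (intro mult_mono) auto
  finally have "real (card (pairs n)) \<le> real B ^ 2" by (simp add: power2_eq_square flip: of_nat_mult)
  then have "4 * \<delta> * card (pairs n) \<le> 4 * \<delta> * real B ^ 2" using \<delta> by (intro mult_left_mono) auto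
  also have "\<dots> = 1 / (4 * real B)" using B0 by (simp add: \<delta>_def power2_eq_square power3_eq_cube)
  also have "\<dots> \<le> 1 / real B" using B0 by (intro divide_left_mono) auto
  also note \<open>1 / real B \<le> \<epsilon>\<close>
  finally show "4 * \<delta> * card (pairs n) \<le> \<epsilon>" .
qed

lemma sample_accuracy:
  assumes "H \<subseteq> pairs n"
  shows "tv_dist (triangle_free_sample n p H S) (gibbs triangle_free H p) \<le> \<delta>"
proof -
  let ?k = "16 * B ^ 3"
  have "real ?k * (C * real n ^ 3) \<le> 16 * real B ^ 3 * (C * real B ^ 3)"
    using C B by (intro mult_mono power_mono) auto
  also have "\<dots> = (16 * C) * real B ^ 6" by (simp add: power_add[symmetric])
  also have "\<dots> \<le> real m * real B ^ 8" using m C B by (intro mult_mono power_increasing) auto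
  finally have "real ?k * (C * real n ^ 3) \<le> real S" by (simp add: S)
  then have "tv_dist (triangle_free_sample n p H S) (gibbs triangle_free H p) \<le> (1 / 8) ^ ?k"
    using C(1) n assms p pc unfolding mixes_def by blast
  also have "\<dots> \<le> \<delta>"
  proof -
    \<comment> \<open>\<open>\<delta>\<close> is the reciprocal of the number of blocks, so
      \<open>k \<le> 8 ^ k\<close> is all that is wanted.\<close>
    have "real ?k \<le> 2 ^ ?k" using less_exp[of ?k] by (metis less_imp_le of_nat_le_iff of_nat_numeral of_nat_power)
    also have "\<dots> \<le> 8 ^ ?k" by (intro power_mono) auto
    finally have "1 / 8 ^ ?k \<le> 1 / real ?k" using B by (intro divide_left_mono) auto
    then show ?thesis by (simp add: \<delta>_def power_one_over)
  qed
  finally show ?thesis .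
qed

lemma closure_count_binomial:
  "closure_count n p H S e k =
     binomial_pmf k (prob (triangle_free_sample n p H S) {G. \<not> triangle_free (insert e G)})"
  unfolding closure_count_def by (rule count_binomial)

text \<open>Bias and sampling error are at most \<open>\<delta>\<close> each; the factor
  \<open>p \<le> 1 / 2\<close> in front of them brings the sum back to
  \<open>\<delta>\<close>.\<close>

lemma ratio_accuracy:
  assumes "H \<subseteq> pairs n" "2 \<le> n"
  shows "prob (closure_count n p H S e S) {k. \<not> rel_approx (4 * \<delta>) (1 - p * (real k / real S))
      (1 - p * prob (gibbs triangle_free H p) {G. \<not> triangle_free (insert e G)})}
    \<le> 1 / (3 * real B ^ 2)"
proof -
  let ?bad = "{G. \<not> triangle_free (insert e G)}"
  let ?\<theta> = "prob (triangle_free_sample n p H S) ?bad" and ?\<theta>' = "prob (gibbs triangle_free H p) ?bad"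
  have p2: "p \<le> 1 / 2" by (rule edge_density_le_half[OF c pc assms(2) p])
  have \<theta>: "\<bar>?\<theta> - ?\<theta>'\<bar> \<le> \<delta>"
    using prob_diff_le_tv_dist sample_accuracy[OF assms(1)] by (rule order_trans)
  have "rel_approx (4 * \<delta>) (1 - p * (real k / real S)) (1 - p * ?\<theta>')"
    if "\<bar>real k / real S - ?\<theta>\<bar> < \<delta>" for k
  proof (rule rel_approx_ratio)
    have "\<bar>?\<theta>' - real k / real S\<bar> \<le> 2 * \<delta>" using that \<theta> by linarith
    then have "p * \<bar>?\<theta>' - real k / real S\<bar> \<le> 1 / 2 * (2 * \<delta>)" using p p2 by (intro mult_mono) auto
    moreover have "1 - p * (real k / real S) - (1 - p * ?\<theta>') = p * (?\<theta>' - real k / real S)"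
      by (simp add: algebra_simps)
    ultimately show "\<bar>1 - p * (real k / real S) - (1 - p * ?\<theta>')\<bar> \<le> \<delta>" using p by (simp add: abs_mult)
    have "p * ?\<theta>' \<le> 1 / 2 * 1" using p p2 by (intro mult_mono) auto
    then show "1 / 2 \<le> 1 - p * ?\<theta>'" by simp
  qed (use \<delta> in auto)
  then have "{k. \<not> rel_approx (4 * \<delta>) (1 - p * (real k / real S)) (1 - p * ?\<theta>')} \<subseteq>
      {k. \<delta> \<le> \<bar>real k / real S - ?\<theta>\<bar>}" by (auto simp: not_le[symmetric])
  then have "prob (closure_count n p H S e S) {k. \<not> rel_approx (4 * \<delta>) (1 - p * (real k / real S)) (1 - p * ?\<theta>')}
      \<le> prob (closure_count n p H S e S) {k. \<delta> \<le> \<bar>real k / real S - ?\<theta>\<bar>}"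
    by (intro measure_pmf.finite_measure_mono) auto
  also have "\<dots> \<le> 1 / (real S * \<delta>\<^sup>2)"
    unfolding closure_count_binomial by (rule binomial_deviation) (use S_pos \<delta> in auto)
  also have "real S * \<delta>\<^sup>2 = real m / 256 * real B ^ 2"
  proof -
    \<comment> \<open>\<open>b\<close> isolates the \<open>B ^ 6\<close> that cancels between
      \<open>S\<close> and \<open>\<delta>^2\<close>; with \<open>m \<ge> 768\<close> what is left
      is at least \<open>3 * B ^ 2\<close>.\<close>
    define b where "b = (real B ^ 3)\<^sup>2"
    have "b \<noteq> 0" using B by (simp add: b_def)
    moreover have "real S = real m * (real B ^ 2 * b)" by (simp add: S b_def flip: power_mult power_add)
    moreover have "\<delta>\<^sup>2 = 1 / (256 * b)" unfolding b_def \<delta>_def power_divide power_mult_distrib by simp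
    ultimately show ?thesis by simp
  qed
  also have "1 / \<dots> \<le> 1 / (3 * real B ^ 2)"
    using B m by (intro divide_left_mono mult_right_mono) auto
  finally show ?thesis .
qed

text \<open>The error budget is \<open>4 \<delta>\<close> per pair already added: it is 0 at the
  start and at most \<open>\<epsilon>\<close> for the complete host graph.\<close>

definition accurate :: "nat \<Rightarrow> nat \<Rightarrow> real \<Rightarrow> bool" where
  "accurate i j x \<longleftrightarrow> rel_approx (4 * \<delta> * card (pairs_before n i j)) x (Z (pairs_before n i j))"

lemma finite_ratio_law: "finite (set_pmf (ratio_law n p S i j x))"
  by (auto simp: ratio_law_def closure_count_binomial intro!: finite_set_pmf_binomial_pmf)

lemma ratio_law_accurate:
  assumes i: "1 \<le> i" "i \<le> n" and j: "1 \<le> j" "j \<le> n" and x: "accurate i j x"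
  shows "prob (ratio_law n p S i j x) {y. \<not> accurate i (Suc j) y} \<le> 1 / (3 * real B ^ 2)"
proof (cases "i < j")
  case False
  then show ?thesis using x i j by (simp add: ratio_law_def accurate_def pairs_before_Suc)
next
  case True
  let ?H = "pairs_before n i j" and ?e = "{i, j}"
  let ?r = "1 - p * prob (gibbs triangle_free ?H p) {G. \<not> triangle_free (insert ?e G)}"
  have finH: "finite ?H" by (rule finite_subset[OF pairs_before_subset finite_pairs])
  have nin: "?e \<notin> ?H" by (rule pair_notin_before[OF True])
  have eq: "pairs_before n i (Suc j) = insert ?e ?H" using True i j by (simp add: pairs_before_Suc)
  have "accurate i (Suc j) (x * R)" if "rel_approx (4 * \<delta>) R ?r" for R
    using rel_approx_mult[OF x[unfolded accurate_def] that] finH nin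
    unfolding accurate_def eq partition_fun_insert[OF finH nin p p1]
    by (simp add: algebra_simps)
  then have sub: "{k. \<not> accurate i (Suc j) (x * (1 - p * (real k / real S)))} \<subseteq>
      {k. \<not> rel_approx (4 * \<delta>) (1 - p * (real k / real S)) ?r}" by blast
  have "prob (ratio_law n p S i j x) {y. \<not> accurate i (Suc j) y} =
      prob (closure_count n p ?H S ?e S) {k. \<not> accurate i (Suc j) (x * (1 - p * (real k / real S)))}"
    using True by (simp add: ratio_law_def vimage_def)
  also have "\<dots> \<le> prob (closure_count n p ?H S ?e S) {k. \<not> rel_approx (4 * \<delta>) (1 - p * (real k / real S)) ?r}"
    by (rule measure_pmf.finite_measure_mono[OF sub]) simp
  also have "\<dots> \<le> 1 / (3 * real B ^ 2)"
    by (rule ratio_accuracy[OF pairs_before_subset]) (use True i j in simp)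
  finally show ?thesis .
qed

text \<open>The failure probabilities add up to at most
  \<open>n ^ 2 / (3 B ^ 2) \<le> 1 / 3\<close>; a whole inner loop is one round of the union bound
  for the outer loop.\<close>

lemma product_law_accurate:
  "prob (product_law n p S) {x. rel_approx \<epsilon> x (Z (pairs n))} \<ge> 2 / 3"
proof -
  let ?\<beta> = "1 / (3 * real B ^ 2)"
  have inner: "prob (iterM (ratio_law n p S i) n 1 x) {y. \<not> accurate (Suc i) 1 y} \<le> real n * ?\<beta>"
    if "1 \<le> i" "i < 1 + n" "accurate i 1 x" for i x
  proof -
    have "prob (iterM (ratio_law n p S i) n 1 x) {y. \<not> accurate i (1 + n) y} \<le> real n * ?\<beta>"
      by (rule prob_iterM_invariant[where I = "accurate i"])
         (use that in \<open>simp_all add: finite_ratio_law ratio_law_accurate\<close>)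
    then show ?thesis by (simp add: accurate_def pairs_before_row)
  qed
  have "prob (product_law n p S) {x. \<not> accurate (1 + n) 1 x} \<le> real n * (real n * ?\<beta>)"
    unfolding product_law_def
  proof (rule prob_iterM_invariant[where I = "\<lambda>i. accurate i 1"])
    show "accurate 1 1 1"
      unfolding accurate_def pairs_before_start partition_fun_empty by (simp add: rel_approx_def)
    show "finite (set_pmf (iterM (ratio_law n p S i) n 1 x))" for i x
      by (rule finite_set_iterM[OF finite_ratio_law])
    show "prob (iterM (ratio_law n p S i) n 1 x) {y. \<not> accurate (Suc i) 1 y} \<le> real n * ?\<beta>"
      if "1 \<le> i" "i < 1 + n" "accurate i 1 x" for i x
      using that by (rule inner)
  qed simp
  also have "\<dots> \<le> 1 / 3"
  proof -
    have "real n * real n \<le> real B ^ 2" unfolding power2_eq_square using B by (intro mult_mono) auto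
    then show ?thesis using B by (simp add: divide_le_eq)
  qed
  finally have 1: "prob (product_law n p S) {x. \<not> accurate (1 + n) 1 x} \<le> 1 / 3" .
  have "1 - prob (product_law n p S) {x. \<not> accurate (1 + n) 1 x} = prob (product_law n p S) {x. accurate (1 + n) 1 x}"
    using measure_pmf.prob_compl[of "{x. \<not> accurate (1 + n) 1 x}" "product_law n p S"]
    by (simp add: Collect_neg_eq Compl_eq_Diff_UNIV[symmetric])
  also have "\<dots> \<le> prob (product_law n p S) {x. rel_approx \<epsilon> x (Z (pairs n))}"
  proof (rule measure_pmf.finite_measure_mono)
    show "{x. accurate (1 + n) 1 x} \<subseteq> {x. rel_approx \<epsilon> x (Z (pairs n))}"
      using rel_approx_mono \<delta>_le(2) pairs_before_end[of n] by (auto simp: accurate_def)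
  qed simp
  finally show ?thesis using 1 by linarith
qed

text \<open>Everything is bounded crudely through \<open>n \<le> S\<close>: at most
  \<open>n ^ 2\<close> pairs, \<open>S\<close> samples each and \<open>S\<close> updates of linear
  cost per sample give order \<open>S ^ 5\<close>. As \<open>S = m * B ^ 8\<close>, the exponent is
  \<open>40 = 5 * 8\<close>; the constant is \<open>115 + 98 + 58 + 2\<close>.\<close>

lemma main_time_le: "real (main_time m 8 n \<epsilon>) \<le> 273 * real m ^ 5 * 2 ^ 40 * (real n + 1 / \<epsilon>) ^ 40"
proof -
  have "B ^ 1 \<le> B ^ 8" using B by (intro power_increasing) auto
  then have "1 * B \<le> m * B ^ 8" using m by (intro mult_mono) auto
  then have BS: "B \<le> S" by (simp add: S)
  have s1: "1 \<le> S" using S_pos by simp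
  have nS: "n \<le> S" using B BS by simp
  have pw: "S \<le> S ^ 2" "S ^ 2 \<le> S ^ 3" "S ^ 3 \<le> S ^ 4" "S ^ 4 \<le> S ^ 5" "1 \<le> S ^ 2" "1 \<le> S ^ 3" "1 \<le> S ^ 4" "1 \<le> S ^ 5"
    using s1 power_increasing[of 1 2 S] power_increasing[of 2 3 S] power_increasing[of 3 4 S] power_increasing[of 4 5 S]
    by (auto intro!: one_le_power)
  have nn: "n * n \<le> S ^ 2" unfolding power2_eq_square using nS by (intro mult_mono) auto
  have Sn: "S * n \<le> S ^ 2" unfolding power2_eq_square using nS by (intro mult_mono) auto
  have st: "sample_time n S \<le> 58 * S ^ 2"
    unfolding sample_time_def using nn Sn nS pw by (simp add: algebra_simps)
  have "ratio_time n S \<le> S * (58 * S ^ 2 + 5 * S + 11) + 7"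
    unfolding ratio_time_def using st nS by (intro add_mono mult_mono) auto
  also have "\<dots> = 58 * S ^ 3 + 5 * S ^ 2 + 11 * S + 7"
    by (simp add: algebra_simps power2_eq_square power3_eq_cube)
  also have "\<dots> \<le> 81 * S ^ 3" using pw by linarith
  finally have rt: "ratio_time n S \<le> 81 * S ^ 3" .
  have "product_time n S \<le> S * (S * (81 * S ^ 3 + 8) + 6) + 3"
    unfolding product_time_def using rt nS by (intro add_mono mult_mono) auto
  also have "\<dots> = 81 * S ^ 5 + 8 * S ^ 2 + 6 * S + 3"
    by (simp add: algebra_simps power2_eq_square power3_eq_cube power_numeral_reduce)
  also have "\<dots> \<le> 98 * S ^ 5" using pw by linarith
  finally have pt: "product_time n S \<le> 98 * S ^ 5" .
  have it: "init_time 8 n \<epsilon> \<le> 115 * S"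
    using BS s1 unfolding init_time_def B_def by simp
  have "main_time m 8 n \<epsilon> \<le> 273 * S ^ 5"
    unfolding main_time_def S_def[symmetric] using it pt st pw by linarith
  then have "real (main_time m 8 n \<epsilon>) \<le> real (273 * S ^ 5)" by (simp only: of_nat_le_iff)
  also have "\<dots> = 273 * real S ^ 5" by simp
  also have "\<dots> = 273 * real m ^ 5 * real B ^ 40" by (simp add: S power_mult_distrib flip: power_mult)
  also have "\<dots> \<le> 273 * real m ^ 5 * (2 * (real n + 1 / \<epsilon>)) ^ 40"
    using B by (intro mult_left_mono power_mono) auto
  also have "\<dots> = 273 * real m ^ 5 * 2 ^ 40 * (real n + 1 / \<epsilon>) ^ 40" by (simp only: power_mult_distrib mult.assoc)
  finally show ?thesis .
qed

text \<open>The number and the graph come from the same run, and each claim concerns one marginal of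
  their joint law.\<close>

lemma main_correct:
  "\<exists>D. halts_with_law (main_com m 8) (input_mem n p \<epsilon>) (273 * real m ^ 5 * 2 ^ 40 * (real n + 1 / \<epsilon>) ^ 40) D \<and>
     prob D {s. rel_approx \<epsilon> (output_number s) (prob (gnp n p) (TF n))} \<ge> 2 / 3 \<and>
     output_graph n ` set_pmf D \<subseteq> TF n \<and>
     tv_dist (map_pmf (output_graph n) D) (gnp_TF n p) < \<epsilon>"
proof -
  obtain D where D: "halts_in ([main_com m 8], input_mem n p \<epsilon>) (main_time m 8 n \<epsilon>) D"
    and law: "map_pmf (\<lambda>s. (output_number s, output_graph n s)) D = main_law m 8 n p \<epsilon>"
    by (rule main_halts[OF n \<epsilon>])
  have num: "map_pmf output_number D = product_law n p S"
  proof -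
    have "map_pmf output_number D = map_pmf fst (map_pmf (\<lambda>s. (output_number s, output_graph n s)) D)"
      by (simp add: map_pmf_comp)
    then show ?thesis by (simp add: law main_law_def map_bind_pmf map_pmf_comp S_def bind_return_pmf')
  qed
  have gr: "map_pmf (output_graph n) D = triangle_free_sample n p (pairs n) S"
  proof -
    have "map_pmf (output_graph n) D = map_pmf snd (map_pmf (\<lambda>s. (output_number s, output_graph n s)) D)"
      by (simp add: map_pmf_comp)
    then show ?thesis by (simp add: law main_law_def map_bind_pmf map_pmf_comp S_def)
  qed
  have "halts_with_law (main_com m 8) (input_mem n p \<epsilon>) (273 * real m ^ 5 * 2 ^ 40 * (real n + 1 / \<epsilon>) ^ 40) D"
    using D main_time_le unfolding halts_with_law_def halts_in_def by blast
  moreover have "prob D {s. rel_approx \<epsilon> (output_number s) (prob (gnp n p) (TF n))} \<ge> 2 / 3"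
  proof -
    have "prob (map_pmf output_number D) {x. rel_approx \<epsilon> x (Z (pairs n))} \<ge> 2 / 3"
      unfolding num by (rule product_law_accurate)
    then show ?thesis by (simp add: vimage_def partition_fun_def gnp_eq TF_eq)
  qed
  moreover have "output_graph n ` set_pmf D \<subseteq> TF n"
    using set_triangle_free_sample[of n p "pairs n" S] unfolding gr[symmetric] TF_eq by simp
  moreover have "tv_dist (map_pmf (output_graph n) D) (gnp_TF n p) < \<epsilon>"
    unfolding gr gnp_TF_eq using sample_accuracy[OF order_refl] \<delta>_le(1) by linarith
  ultimately show ?thesis by blast
qed

end

theorem theorem1p1:
  fixes c :: real
  assumes "c < 1 / sqrt 2"
  shows
    "(\<exists>C. \<forall>n p. 2 \<le> n \<longrightarrow> 0 \<le> p \<longrightarrow> p \<le> c * real n powr (-1/2) \<longrightarrow>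
        ereal_of_enat (mixing_time n p) \<le> ereal (C * real n ^ 2 * ln (real n)))
     \<and>
     (\<exists>P C d. \<forall>n p \<epsilon>. 1 \<le> n \<longrightarrow> 0 \<le> p \<longrightarrow> p \<le> c * real n powr (-1/2) \<longrightarrow> 0 < \<epsilon> \<longrightarrow>
        (\<exists>D. halts_with_law P (input_mem n p \<epsilon>) (C * (real n + 1 / \<epsilon>) ^ d) D \<and>
             measure_pmf.prob D
               {s. rel_approx \<epsilon> (output_number s) (measure_pmf.prob (gnp n p) (TF n))} \<ge> 2/3))
     \<and>
     (\<exists>P C d. \<forall>n p \<epsilon>. 1 \<le> n \<longrightarrow> 0 \<le> p \<longrightarrow> p \<le> c * real n powr (-1/2) \<longrightarrow> 0 < \<epsilon> \<longrightarrow>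
        (\<exists>D. halts_with_law P (input_mem n p \<epsilon>) (C * (real n + 1 / \<epsilon>) ^ d) D \<and>
             output_graph n ` set_pmf D \<subseteq> TF n \<and>
             tv_dist (map_pmf (output_graph n) D) (gnp_TF n p) < \<epsilon>))"
proof -
  obtain C where C: "0 < C" "mixes c C" using mixes_exists[OF assms] by blast
  \<comment> \<open>Programs contain no real constants, so the mixing constant, which comes from
    \<open>c\<close> alone, is rounded up to a natural number.\<close>
  define m where "m = nat \<lceil>16 * C\<rceil> + 768"
  have m: "16 * C \<le> real m" "768 \<le> m" unfolding m_def by (simp_all, linarith)
  have main: "\<exists>D. halts_with_law (main_com m 8) (input_mem n p \<epsilon>) (273 * real m ^ 5 * 2 ^ 40 * (real n + 1 / \<epsilon>) ^ 40) D \<and>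
     prob D {s. rel_approx \<epsilon> (output_number s) (prob (gnp n p) (TF n))} \<ge> 2 / 3 \<and>
     output_graph n ` set_pmf D \<subseteq> TF n \<and>
     tv_dist (map_pmf (output_graph n) D) (gnp_TF n p) < \<epsilon>"
    if "1 \<le> n" "0 \<le> p" "p \<le> c * real n powr (-1/2)" "0 < \<epsilon>" for n p \<epsilon>
    by (rule estimator.main_correct) (unfold_locales, use that assms C m in auto)
  show ?thesis
  proof (intro conjI mixing_time_bound[OF assms])
    show "\<exists>P C d. \<forall>n p \<epsilon>. 1 \<le> n \<longrightarrow> 0 \<le> p \<longrightarrow> p \<le> c * real n powr (-1/2) \<longrightarrow> 0 < \<epsilon> \<longrightarrow>
        (\<exists>D. halts_with_law P (input_mem n p \<epsilon>) (C * (real n + 1 / \<epsilon>) ^ d) D \<and>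
             measure_pmf.prob D
               {s. rel_approx \<epsilon> (output_number s) (measure_pmf.prob (gnp n p) (TF n))} \<ge> 2/3)"
      using main by (intro exI[of _ "main_com m 8"] exI[of _ "273 * real m ^ 5 * 2 ^ 40"] exI[of _ 40]) blast
    show "\<exists>P C d. \<forall>n p \<epsilon>. 1 \<le> n \<longrightarrow> 0 \<le> p \<longrightarrow> p \<le> c * real n powr (-1/2) \<longrightarrow> 0 < \<epsilon> \<longrightarrow>
        (\<exists>D. halts_with_law P (input_mem n p \<epsilon>) (C * (real n + 1 / \<epsilon>) ^ d) D \<and>
             output_graph n ` set_pmf D \<subseteq> TF n \<and>
             tv_dist (map_pmf (output_graph n) D) (gnp_TF n p) < \<epsilon>)"
      using main by (intro exI[of _ "main_com m 8"] exI[of _ "273 * real m ^ 5 * 2 ^ 40"] exI[of _ 40]) blast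
  qed
qed

end
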